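(* Let $\mathcal{P}$ be a (finite) polysquare translation surface with $b$ atomic squares, and let $\alpha$ be a badly approximable real number. Then for every real number $\varepsilon>0$ there exists a finite threshold $C_\varepsilon=C_\varepsilon(\mathcal{P};\alpha)>1$, depending only on $\mathcal{P}$, $\alpha$ and $\varepsilon$, such that the following holds. Let $L_\alpha(t)$, $t\ge 0$, be any half-infinite geodesic on $\mathcal{P}$ with slope $\alpha$, equipped with the usual arc-length parametrization. For any positive integer $n$, let $\mathcal{X}_n$ denote the set of the first $n$ intersection points of $L_\alpha(t)$, $t\ge0$, with the vertical edges of $\mathcal{P}$, and for any subinterval $I$ of any vertical edge of $\mathcal{P}$, let $V_n(I)=|I\cap\mathcal{X}_n|$ (the visiting number of $I$ with respect to $\mathcal{X}_n$). Then for every integer $n>C_\varepsilon$ and every subinterval $I$ of any vertical edge of $\mathcal{P}$ with length $|I|\ge C_\varepsilon/n$, $$\left|V_n(I)-\frac{n|I|}{b}\right|<\varepsilon\,\frac{n|I|}{b}.$$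
   Context: A finite polysquare translation surface $\mathcal{P}$ with $b$ atomic squares is a connected closed surface obtained from $b$ axis-parallel unit squares (the atomic squares) by gluing edges in pairs by translations: each right vertical edge of a square is identified with the left vertical edge of exactly one square (possibly the same square), and each top horizontal edge is identified with the bottom horizontal edge of exactly one square. (This is also known as a square-tiled translation surface.) After identification there are exactly $b$ distinct vertical edges, each of length $1$. A vertex of the squares may be a conical singularity of the flat metric. A half-infinite geodesic of slope $\alpha$ is a path $L_\alpha(t)$, $t\ge0$, on $\mathcal{P}$ which moves at unit speed along straight lines of slope $\alpha$ inside each square and continues through edges via the translation identifications; it is defined for all $t\ge 0$, i.e. it does not hit a singular vertex at any time $t>0$. The first $n$ intersection points with vertical edges are taken in order of increasing time $t$. A real number $\alpha$ is badly approximable if it is irrational and its continued fraction digits $a_1,a_2,a_3,\ldots$ (where $\alpha=[a_0;a_1,a_2,\ldots]$) are bounded. *)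

theory Defs
  imports "HOL-Analysis.Analysis"
begin

section \<open>Continued fractions\<close>

primrec complete_quotient :: "real \<Rightarrow> nat \<Rightarrow> real" where
  "complete_quotient \<alpha> 0 = \<alpha>"
| "complete_quotient \<alpha> (Suc k) = 1 / frac (complete_quotient \<alpha> k)"

definition cf_digit :: "real \<Rightarrow> nat \<Rightarrow> int" where
  "cf_digit \<alpha> k = \<lfloor>complete_quotient \<alpha> k\<rfloor>"

definition badly_approximable :: "real \<Rightarrow> bool" where
  "badly_approximable \<alpha> \<longleftrightarrow> \<alpha> \<notin> \<rat> \<and> (\<exists>A. \<forall>k\<ge>1. cf_digit \<alpha> k \<le> A)"


section \<open>Polysquare translation surfaces\<close>

text \<open>The right edge of square \<open>s\<close> is glued to the left edge of \<open>right_of P s\<close>,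
  and the top edge of \<open>s\<close> to the bottom edge of \<open>above P s\<close>.\<close>

record 'a polysquare =
  squares :: "'a set"
  right_of :: "'a \<Rightarrow> 'a"
  above :: "'a \<Rightarrow> 'a"

definition unit_square :: "(real \<times> real) set" where
  "unit_square = {0..1} \<times> {0..1}"

inductive edge_glue :: "('a, 'm) polysquare_scheme \<Rightarrow> 'a \<times> real \<times> real \<Rightarrow> 'a \<times> real \<times> real \<Rightarrow> bool"
  for P where
  vertical: "s \<in> squares P \<Longrightarrow> y \<in> {0..1} \<Longrightarrow> edge_glue P (s, 1, y) (right_of P s, 0, y)"
| horizontal: "s \<in> squares P \<Longrightarrow> x \<in> {0..1} \<Longrightarrow> edge_glue P (s, x, 1) (above P s, x, 0)"

text \<open>A point of the surface is a class of the equivalence relation generated by the edge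
  gluings on the disjoint union of the closed squares.\<close>

definition surface_point :: "('a, 'm) polysquare_scheme \<Rightarrow> 'a \<times> real \<times> real \<Rightarrow> ('a \<times> real \<times> real) set" where
  "surface_point P p = {q. equivclp (edge_glue P) p q}"

definition surface :: "('a, 'm) polysquare_scheme \<Rightarrow> ('a \<times> real \<times> real) set set" where
  "surface P = surface_point P ` (squares P \<times> unit_square)"

text \<open>The quotient topology.\<close>

definition surface_topology :: "('a, 'm) polysquare_scheme \<Rightarrow> ('a \<times> real \<times> real) set topology" where
  "surface_topology P = topology (\<lambda>U. U \<subseteq> surface P \<and>
     (\<forall>s\<in>squares P. openin (top_of_set unit_square) {p \<in> unit_square. surface_point P (s, p) \<in> U}))"

lemma openin_surface_topology:
  "openin (surface_topology P) U \<longleftrightarrow> U \<subseteq> surface P \<and>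
     (\<forall>s\<in>squares P. openin (top_of_set unit_square) {p \<in> unit_square. surface_point P (s, p) \<in> U})"
proof -
  have int: "{p \<in> unit_square. surface_point P (s, p) \<in> U \<inter> V} =
      {p \<in> unit_square. surface_point P (s, p) \<in> U} \<inter> {p \<in> unit_square. surface_point P (s, p) \<in> V}" for s U V
    by auto
  have un: "{p \<in> unit_square. surface_point P (s, p) \<in> \<Union>K} =
      (\<Union>U\<in>K. {p \<in> unit_square. surface_point P (s, p) \<in> U})" for s K
    by auto
  have "istopology (\<lambda>U. U \<subseteq> surface P \<and>
     (\<forall>s\<in>squares P. openin (top_of_set unit_square) {p \<in> unit_square. surface_point P (s, p) \<in> U}))"
    unfolding istopology_def int un by (auto intro!: openin_Int openin_Union)
  then show ?thesis
    unfolding surface_topology_def by simp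
qed

definition polysquare_surface :: "('a, 'm) polysquare_scheme \<Rightarrow> bool" where
  "polysquare_surface P \<longleftrightarrow>
     finite (squares P) \<and> squares P \<noteq> {} \<and>
     bij_betw (right_of P) (squares P) (squares P) \<and>
     bij_betw (above P) (squares P) (squares P) \<and>
     connected_space (surface_topology P)"

text \<open>At a vertex, every element of the class is a corner of a square and contributes a right
  angle, so the vertex is a regular point of the flat metric iff these angles add up to \<open>2 * pi\<close>.\<close>

definition surface_vertices :: "('a, 'm) polysquare_scheme \<Rightarrow> ('a \<times> real \<times> real) set set" where
  "surface_vertices P = surface_point P ` (squares P \<times> {0, 1} \<times> {0, 1})"

definition cone_angle :: "('a \<times> real \<times> real) set \<Rightarrow> real" where
  "cone_angle x = real (card x) * (pi / 2)"

definition singular_vertices :: "('a, 'm) polysquare_scheme \<Rightarrow> ('a \<times> real \<times> real) set set" where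
  "singular_vertices P = {x \<in> surface_vertices P. cone_angle x \<noteq> 2 * pi}"


section \<open>Geodesics\<close>

text \<open>The path moves with constant velocity \<open>v\<close>, a unit vector of slope \<open>\<alpha>\<close> pointing in either
  of the two possible directions.  Just after every time \<open>t \<ge> 0\<close>, and just before every time
  \<open>t > 0\<close>, it is a straight segment in one closed square; the two squares differ when an edge is
  crossed.  At a regular vertex, the squares into which \<open>v\<close> and \<open>- v\<close> point are unique,
  so that the path goes straight through.  The starting point \<open>L 0\<close> may be a singular vertex.\<close>

definition half_infinite_geodesic ::
  "('a, 'm) polysquare_scheme \<Rightarrow> real \<Rightarrow> (real \<Rightarrow> ('a \<times> real \<times> real) set) \<Rightarrow> bool" where
  "half_infinite_geodesic P \<alpha> L \<longleftrightarrow>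
     (\<exists>v :: real \<times> real. norm v = 1 \<and> snd v = \<alpha> * fst v \<and>
        (\<forall>t\<ge>0. \<exists>\<delta>>0. \<exists>s\<in>squares P. \<exists>p. \<forall>h\<in>{0..\<delta>}.
           p + h *\<^sub>R v \<in> unit_square \<and> L (t + h) = surface_point P (s, p + h *\<^sub>R v)) \<and>
        (\<forall>t>0. \<exists>\<delta>\<in>{0<..t}. \<exists>s\<in>squares P. \<exists>p. \<forall>h\<in>{0..\<delta>}.
           p - h *\<^sub>R v \<in> unit_square \<and> L (t - h) = surface_point P (s, p - h *\<^sub>R v)) \<and>
        (\<forall>t>0. L t \<notin> singular_vertices P))"


section \<open>Crossings and visiting numbers\<close>

text \<open>Every vertical edge is the left edge of exactly one square \<open>s\<close>.  For \<open>J \<subseteq> {0..1}\<close>, this is the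
  part of that edge at the heights in \<open>J\<close>.\<close>

definition edge_part :: "('a, 'm) polysquare_scheme \<Rightarrow> 'a \<Rightarrow> real set \<Rightarrow> ('a \<times> real \<times> real) set set" where
  "edge_part P s J = (\<lambda>y. surface_point P (s, 0, y)) ` J"

definition vertical_edge :: "('a, 'm) polysquare_scheme \<Rightarrow> 'a \<Rightarrow> ('a \<times> real \<times> real) set set" where
  "vertical_edge P s = edge_part P s {0..1}"

definition crossing_times :: "('a, 'm) polysquare_scheme \<Rightarrow> (real \<Rightarrow> ('a \<times> real \<times> real) set) \<Rightarrow> real set" where
  "crossing_times P L = {t. 0 \<le> t \<and> L t \<in> (\<Union>s\<in>squares P. vertical_edge P s)}"

definition first_crossings ::
  "('a, 'm) polysquare_scheme \<Rightarrow> (real \<Rightarrow> ('a \<times> real \<times> real) set) \<Rightarrow> nat \<Rightarrow> ('a \<times> real \<times> real) set set" where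
  "first_crossings P L n =
     L ` {t \<in> crossing_times P L. finite {t' \<in> crossing_times P L. t' < t} \<and>
            card {t' \<in> crossing_times P L. t' < t} < n}"

definition visiting_number ::
  "('a, 'm) polysquare_scheme \<Rightarrow> (real \<Rightarrow> ('a \<times> real \<times> real) set) \<Rightarrow> nat \<Rightarrow> ('a \<times> real \<times> real) set set \<Rightarrow> nat" where
  "visiting_number P L n I = card (I \<inter> first_crossings P L n)"

end

theory Submission
  imports Defs "HOL-Analysis.Kronecker_Approximation_Theorem"
begin

text \<open>The successive crossings of a geodesic with the vertical edges form an orbit of a skew product
  \<open>T\<close> over the rotation by \<open>\<alpha>\<close>, whose fibre is the set of squares; \<open>T\<close> commutes with small vertical
  translations unless a vertex intervenes.  Badly approximable means that points of a rotation
  orbit of length \<open>N\<close> are \<open>c / N\<close>-separated, so a vertical segment of length less than \<open>c / N\<close>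
  meets at most one vertex in time \<open>N\<close>.

  First, every orbit visits every vertical interval of length \<open>r\<close> within time \<open>K / r\<close>: consider the
  squares over a base point from which the interval is reached within time \<open>M\<close>.  If their minimal
  number does not increase when \<open>M\<close> is replaced by \<open>K * M\<close> (and the interval is slightly enlarged),
  then along an orbit over a minimising point this set of squares does not depend on the base
  point and is invariant under both gluings, so by connectedness it contains all squares.

  Secondly, suppose that visits to an interval of length \<open>l\<close> in time \<open>m\<close> number between
  \<open>\<mu> * l * m - C\<close> and \<open>\<kappa> * l * m + C\<close>.  Either all time windows of a suitable length \<open>N\<close>,
  comparable to \<open>1 / l\<close>, have at least the average number of visits, and \<open>\<mu>\<close> can be raised; or some window has fewer, it
  recurs in every window of length \<open>K * N\<close>, and \<open>\<kappa>\<close> can be lowered.  So \<open>\<kappa> - \<mu>\<close> can be made arbitrarily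
  small with \<open>C\<close> independent of the interval.  As \<open>T\<close> preserves Lebesgue measure, the density
  \<open>1 / b\<close> lies between \<open>\<mu>\<close> and \<open>\<kappa>\<close>.\<close>

text \<open>An ergodic theorem for each fixed interval would not be enough: the claim reaches
  intervals as short as a constant times \<open>1 / n\<close>. Every constant is therefore fixed
  before the interval, and orbit stretches are measured in units of the reciprocal interval length.
  The obstacle is the vertices, at which nearby orbits part. Since two vertices cannot come between
  the same two orbit pieces in the time considered, there is always a way round: compare the points
  at an earlier time, or approach from the other side. The recurrence constant is exponential in the
  number of squares, because each increase of the minimal count costs a factor in time, but it does
  not depend on the interval. In the second part \<open>N\<close> is taken so long that the deficit
  of one window outweighs the additive errors from cutting the orbit around it, while
  \<open>N * l\<close> stays bounded; this is why the new \<open>C\<close> is again independent of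
  \<open>l\<close>. Geodesics moving to the left are treated on the reflected surface with slope
  \<open>- \<alpha>\<close>.\<close>

subsection \<open>Continued fractions with bounded digits\<close>

text \<open>The form is invariant under the natural extension \<open>(x, y) \<mapsto> (1 / x - a, 1 / (a + y))\<close> of the
  Gauss map together with \<open>(q, p) \<mapsto> (p, q - a * p)\<close>; bounding \<open>\<bar>q * x - p\<bar> * q\<close> alone would lose a factor
  in each step.\<close>

lemma continued_fraction_form_ge:
  fixes x :: "nat \<Rightarrow> real" and a :: "nat \<Rightarrow> int" and B :: real
  assumes x: "\<And>k. 0 < x k" "\<And>k. x k < 1"
    and a: "\<And>k. 1 \<le> a k" "\<And>k. real_of_int (a k) \<le> B"
    and rec: "\<And>k. 1 / x k = real_of_int (a k) + x (Suc k)"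
  shows "0 < q \<Longrightarrow> 0 \<le> p \<Longrightarrow> 0 \<le> y \<Longrightarrow> y \<le> 1 \<Longrightarrow>
    1 / (2 * (B + 1)) \<le> \<bar>of_int q * x k - of_int p\<bar> * (of_int q + y * of_int p) / (1 + x k * y)"
proof (induction "nat (p + q)" arbitrary: p q y k rule: less_induct)
  case less
  have B: "1 \<le> B" using a[of 0] by linarith
  have xk: "x k = 1 / (a k + x (Suc k))"
    using rec[of k] x(1)[of k] by (metis div_by_1 divide_divide_eq_right mult_1)
  have den: "1 \<le> a k + x (Suc k)" using a(1)[of k] x(1)[of "Suc k"] by linarith
  have xB: "1 / (B + 1) \<le> x k"
    unfolding xk using a(2)[of k] x(2)[of "Suc k"] den by (intro divide_left_mono) auto
  have xy: "0 \<le> x k * y" "x k * y \<le> 1"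
    using x[of k] less.prems by (auto intro: mult_le_one less_imp_le)
  \<comment> \<open>The constant \<open>1 / (2 * (B + 1))\<close> combines the lower bound
    \<open>1 / (B + 1)\<close> for \<open>x k\<close> with the upper bound 2 for the denominator.
    This settles the cases without descent.\<close>
  have direct: ?case if ge: "x k \<le> \<bar>of_int q * x k - of_int p\<bar>"
  proof -
    have "1 \<le> of_int q + y * of_int p" using less.prems by (simp add: add_increasing2)
    then have "x k * 1 \<le> \<bar>of_int q * x k - of_int p\<bar> * (of_int q + y * of_int p)"
      using ge x(1)[of k] by (intro mult_mono) auto
    then have *: "1 / (B + 1) \<le> \<bar>of_int q * x k - of_int p\<bar> * (of_int q + y * of_int p)"
      using xB by linarith
    have "1 / (2 * (B + 1)) = (1 / (B + 1)) / 2" by simp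
    also have "\<dots> \<le> (1 / (B + 1)) / (1 + x k * y)"
      using xy B by (intro divide_left_mono) auto
    also have "\<dots> \<le> \<bar>of_int q * x k - of_int p\<bar> * (of_int q + y * of_int p) / (1 + x k * y)"
      using * xy by (intro divide_right_mono) auto
    finally show ?thesis .
  qed
  \<comment> \<open>For \<open>q < a k * p\<close> integrality gives
    \<open>p * (a k + x (Suc k)) - q >= 1\<close>, which after multiplication by \<open>x k\<close>
    is the direct case. For \<open>a k * p <= q\<close> the Euclidean step from
    \<open>(q, p)\<close> to \<open>(p, q - a k * p)\<close> stays in the admissible range and
    lowers \<open>p + q\<close>.\<close>
  consider "p = 0" | "0 < p" "q < a k * p" | "0 < p" "a k * p \<le> q"
    using less.prems by linarith
  then show ?case
  proof cases
    case 1
    have "x k * 1 \<le> x k * of_int q" using x(1)[of k] less.prems by (intro mult_left_mono) auto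
    then show ?thesis using 1 x(1)[of k] by (intro direct) (auto simp: mult.commute)
  next
    case 2
    then have "q + 1 \<le> a k * p" by linarith
    then have "real_of_int (q + 1) \<le> real_of_int (a k * p)" by (simp only: of_int_le_iff)
    moreover have "0 \<le> p * x (Suc k)" using 2 x(1)[of "Suc k"] by simp
    ultimately have "1 \<le> p * (a k + x (Suc k)) - q" by (simp add: algebra_simps)
    then have "x k * 1 \<le> x k * (p * (a k + x (Suc k)) - q)" using x(1)[of k] by (intro mult_left_mono) auto
    also have "\<dots> = p - q * x k" using den by (simp add: xk field_simps)
    finally show ?thesis by (intro direct) simp
  next
    case 3
    define y' where "y' = 1 / (a k + y)"
    have ay: "1 \<le> a k + y" using a(1)[of k] less.prems by linarith
    have y': "0 \<le> y'" "y' \<le> 1" using ay by (auto simp: y'_def)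
    have "p * 1 \<le> p * a k" using 3(1) a(1)[of k] by (intro mult_left_mono) auto
    then have "nat (q - a k * p + p) < nat (p + q)"
      using 3 less.prems by (auto simp: algebra_simps)
    from less.hyps[OF this \<open>0 < p\<close> _ y', of "Suc k"] 3
    have IH: "1 / (2 * (B + 1)) \<le> \<bar>of_int p * x (Suc k) - of_int (q - a k * p)\<bar> *
        (of_int p + y' * of_int (q - a k * p)) / (1 + x (Suc k) * y')" by simp
    have e1: "\<bar>of_int q * x k - of_int p\<bar> = x k * \<bar>of_int p * x (Suc k) - of_int (q - a k * p)\<bar>"
    proof -
      have "of_int q * x k - of_int p = - (x k * (of_int p * x (Suc k) - of_int (q - a k * p)))"
        using den by (simp add: xk field_simps)
      then show ?thesis using x(1)[of k] by (simp add: abs_mult)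
    qed
    have e2: "of_int q + y * of_int p = (a k + y) * (of_int p + y' * of_int (q - a k * p))"
      using ay by (simp add: y'_def field_simps)
    have pos: "0 < a k + x (Suc k) + y" using den less.prems by linarith
    \<comment> \<open>The factor \<open>x k\<close> from \<open>e1\<close> and the factor
      \<open>a k + y\<close> from \<open>e2\<close> turn the old denominator exactly into the new
      one, so the value of the form is unchanged and no constant is lost.\<close>
    have e3: "x k * (a k + y) / (1 + x k * y) = 1 / (1 + x (Suc k) * y')"
    proof -
      have "1 + x k * y = (a k + x (Suc k) + y) / (a k + x (Suc k))"
        using den by (simp add: xk field_simps)
      moreover have "1 + x (Suc k) * y' = (a k + x (Suc k) + y) / (a k + y)"
        using ay by (simp add: y'_def field_simps)
      ultimately show ?thesis using den ay pos by (simp add: xk)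
    qed
    have "\<bar>of_int q * x k - of_int p\<bar> * (of_int q + y * of_int p) / (1 + x k * y)
      = (\<bar>of_int p * x (Suc k) - of_int (q - a k * p)\<bar> * (of_int p + y' * of_int (q - a k * p))) *
        (x k * (a k + y) / (1 + x k * y))"
      unfolding e1 e2 by simp
    also have "\<dots> = \<bar>of_int p * x (Suc k) - of_int (q - a k * p)\<bar> *
        (of_int p + y' * of_int (q - a k * p)) / (1 + x (Suc k) * y')"
      unfolding e3 by simp
    finally show ?thesis using IH by simp
  qed
qed

lemma Rats_frac_iff: "frac (x::real) \<in> \<rat> \<longleftrightarrow> x \<in> \<rat>"
proof
  assume "frac x \<in> \<rat>"
  then have "frac x + of_int \<lfloor>x\<rfloor> \<in> \<rat>" by (intro Rats_add) auto
  then show "x \<in> \<rat>" by (simp add: frac_def)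
qed (auto simp: frac_def)

text \<open>At \<open>y = 0\<close> the form is \<open>\<bar>q * x - p\<bar> * q\<close>, so one
  constant serves all \<open>q\<close>. Irrationality keeps the expansion infinite, with every
  remainder strictly between 0 and 1.\<close>

lemma badly_approximable_lower_bound:
  assumes "badly_approximable \<alpha>"
  obtains c :: real where "0 < c" "\<And>p q :: int. 0 < q \<Longrightarrow> c / of_int q \<le> \<bar>of_int q * \<alpha> - of_int p\<bar>"
proof -
  from assms obtain B where irr: "\<alpha> \<notin> \<rat>" and B: "\<And>k. k \<ge> 1 \<Longrightarrow> cf_digit \<alpha> k \<le> B"
    by (auto simp: badly_approximable_def)
  define x where "x k = frac (complete_quotient \<alpha> k)" for k
  define a where "a k = cf_digit \<alpha> (Suc k)" for k
  have xirr: "x k \<notin> \<rat>" for k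
  proof (induction k)
    case 0 then show ?case using irr by (simp add: x_def Rats_frac_iff)
  next
    case (Suc k)
    have "1 / (1 / x k) \<notin> \<rat>" using Suc by simp
    then have "1 / x k \<notin> \<rat>" by (metis Rats_1 Rats_divide)
    then show ?case by (simp add: x_def Rats_frac_iff)
  qed
  have x: "0 < x k" "x k < 1" for k
    using xirr[of k] frac_ge_0[of "complete_quotient \<alpha> k"] frac_lt_1[of "complete_quotient \<alpha> k"]
    using Ints_subset_Rats Rats_frac_iff by (auto simp: x_def less_le)
  have a1: "1 \<le> a k" for k
    using x[of k] by (simp add: a_def cf_digit_def x_def[symmetric] le_floor_iff)
  have aB: "real_of_int (a k) \<le> of_int B" for k
    using B[of "Suc k"] by (simp add: a_def)
  have rec: "1 / x k = real_of_int (a k) + x (Suc k)" for k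
    by (simp add: a_def cf_digit_def x_def frac_def)
  have B1: "1 \<le> real_of_int B" using a1[of 0] aB[of 0] by linarith
  define c where "c = 1 / (2 * (real_of_int B + 1))"
  show ?thesis
  proof
    show "0 < c" using B1 by (simp add: c_def)
    fix p q :: int assume q: "0 < q"
    define p' where "p' = p - q * \<lfloor>\<alpha>\<rfloor>"
    have e: "of_int q * \<alpha> - of_int p = of_int q * x 0 - of_int p'"
      by (simp add: x_def p'_def frac_def algebra_simps)
    show "c / of_int q \<le> \<bar>of_int q * \<alpha> - of_int p\<bar>"
    proof (cases "0 \<le> p'")
      case True
      then have "c \<le> \<bar>of_int q * x 0 - of_int p'\<bar> * of_int q"
        using continued_fraction_form_ge[where x = x and a = a and B = "of_int B" and k = 0 and y = 0, OF x a1 aB rec q] by (simp add: c_def)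
      then have "c / of_int q \<le> \<bar>of_int q * x 0 - of_int p'\<bar>" using q by (simp add: field_simps)
      then show ?thesis by (simp only: e)
    next
      case False
      \<comment> \<open>For negative \<open>p'\<close> both terms of \<open>q * x 0 - p'\<close> are
        positive, so the distance is at least \<open>x 0\<close>, which the digit bound keeps above
        \<open>c\<close>.\<close>
      have "x 0 = 1 / (a 0 + x 1)"
        using rec[of 0] x(1)[of 0] by (metis One_nat_def div_by_1 divide_divide_eq_right mult_1)
      moreover have "1 / (2 * (real_of_int B + 1)) \<le> 1 / (a 0 + x 1)"
        using aB[of 0] x[of 1] a1[of 0] B1 by (intro divide_left_mono) auto
      ultimately have "c \<le> x 0" by (simp add: c_def)
      also have "x 0 \<le> x 0 * of_int q" using q x(1)[of 0] by simp
      also have "\<dots> \<le> \<bar>of_int q * x 0 - of_int p'\<bar>" using False by (simp add: mult.commute)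
      also have "\<dots> \<le> \<bar>of_int q * x 0 - of_int p'\<bar> * of_int q" using q
        by (simp add: mult_le_cancel_left1)
      finally have "c / of_int q \<le> \<bar>of_int q * x 0 - of_int p'\<bar>" using q by (simp add: field_simps)
      then show ?thesis by (simp only: e)
    qed
  qed
qed

subsection \<open>The skew product over a rotation\<close>

text \<open>\<open>inv f\<close> inverts \<open>f\<close> only when \<open>f\<close> is a bijection
  of the whole type. This is why the gluing map \<open>above P\<close> is later extended by the
  identity outside the squares.\<close>

definition zpow :: "('a \<Rightarrow> 'a) \<Rightarrow> int \<Rightarrow> 'a \<Rightarrow> 'a" where
  "zpow f k = (if 0 \<le> k then f ^^ nat k else inv f ^^ nat (- k))"

lemma zpow_0 [simp]: "zpow f 0 s = s"
  by (simp add: zpow_def)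

lemma zpow_1 [simp]: "zpow f 1 = f"
  by (simp add: zpow_def)

lemma zpow_Suc:
  assumes "bij f"
  shows "zpow f (k + 1) s = f (zpow f k s)"
proof (cases "0 \<le> k")
  case True
  then have "nat (k + 1) = Suc (nat k)" by linarith
  then show ?thesis using True by (simp add: zpow_def)
next
  case False
  then have "nat (- k) = Suc (nat (- (k + 1)))" by linarith
  moreover have "k + 1 \<ge> 0 \<Longrightarrow> k = - 1" using False by linarith
  ultimately show ?thesis using False assms
    by (auto simp: zpow_def bij_is_surj surj_f_inv_f)
qed

lemma zpow_add:
  assumes "bij f"
  shows "zpow f (j + k) s = zpow f j (zpow f k s)"
proof (induction j rule: int_induct[where k = 0])
  case base then show ?case by simp
next
  case (step1 i)
  then show ?case using zpow_Suc[OF assms, of "i + k"] zpow_Suc[OF assms, of i] by (simp add: ac_simps)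
next
  case (step2 i)
  have "f (zpow f (i - 1 + k) s) = f (zpow f (i - 1) (zpow f k s))"
    using zpow_Suc[OF assms, of "i - 1 + k"] zpow_Suc[OF assms, of "i - 1"] step2 by (simp add: ac_simps)
  then show ?case using assms by (simp add: bij_is_inj inj_eq)
qed

lemma zpow_uminus [simp]:
  assumes "bij f"
  shows "zpow f (- k) (zpow f k s) = s" "zpow f k (zpow f (- k) s) = s"
  using zpow_add[OF assms, of "-k" k] zpow_add[OF assms, of k "-k"] by simp_all

lemma zpow_in:
  assumes "bij f" "f ` S = S" "s \<in> S"
  shows "zpow f k s \<in> S"
proof (induction k rule: int_induct[where k = 0])
  case base then show ?case using assms by simp
next
  case (step1 i) then show ?case using assms by (auto simp: zpow_Suc)
next
  case (step2 i)
  have "f (zpow f (i - 1) s) \<in> f ` S" using step2 zpow_Suc[OF assms(1), of "i - 1" s] assms(2) by simp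
  then show ?case using assms(1) by (simp add: bij_is_inj inj_image_mem_iff)
qed

lemma bij_betw_zpow:
  assumes "bij f" "f ` S = S"
  shows "bij_betw (zpow f k) S S"
  by (rule bij_betwI[of _ _ _ "zpow f (- k)"]) (auto simp: assms zpow_in)

lemma frac_frac_add: "frac (frac x + y) = frac (x + y :: real)"
proof -
  have "frac (z + of_int k) = frac z" for z :: real and k by (simp add: frac_def)
  from this[of "x + y" "- \<lfloor>x\<rfloor>"] show ?thesis by (simp add: frac_def[of x] algebra_simps)
qed

text \<open>\<open>irred\<close> is the combinatorial content of connectedness, and
  \<open>badly\<close> is the arithmetic input. Negative powers are taken of \<open>A\<close> alone,
  so \<open>A\<close> is a bijection of the type while \<open>R\<close> just permutes
  \<open>S\<close>.\<close>

locale skew_rotation =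
  fixes S :: "'a set" and R A :: "'a \<Rightarrow> 'a" and \<alpha> c :: real
  assumes finS: "finite S" and neS: "S \<noteq> {}"
    and bijR: "bij_betw R S S" and bijA: "bij A" and AS: "A ` S = S"
    and irred: "\<And>F. F \<subseteq> S \<Longrightarrow> F \<noteq> {} \<Longrightarrow> A ` F \<subseteq> F \<Longrightarrow> R ` F \<subseteq> F \<Longrightarrow> F = S"
    and c_pos: "0 < c"
    and badly: "\<And>p q :: int. 0 < q \<Longrightarrow> c / of_int q \<le> \<bar>of_int q * \<alpha> - of_int p\<bar>"
begin

text \<open>The pair \<open>(s, y)\<close> stands for the point at height \<open>y\<close> on the
  left edge of square \<open>s\<close>. A line of slope \<alpha> leaves the unit column at height
  \<open>y + \<alpha>\<close>, whose integer part counts the squares climbed or descended before the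
  step to the right.\<close>

definition T :: "'a \<times> real \<Rightarrow> 'a \<times> real" where
  "T x = (R (zpow A \<lfloor>snd x + \<alpha>\<rfloor> (fst x)), frac (snd x + \<alpha>))"

lemma card_pos: "0 < card S"
  using finS neS by (simp add: card_gt_0_iff)

lemma R_in: "s \<in> S \<Longrightarrow> R s \<in> S"
  using bijR by (auto simp: bij_betw_def)

lemma c_le_half: "c \<le> 1/2"
proof -
  have "c \<le> \<bar>\<alpha> - of_int (round \<alpha>)\<bar>" using badly[of 1 "round \<alpha>"] by simp
  also have "\<dots> \<le> 1/2" using of_int_round_abs_le[of \<alpha>] by (simp add: abs_minus_commute)
  finally show ?thesis .
qed

lemma snd_T_pow: "0 \<le> y \<Longrightarrow> y < 1 \<Longrightarrow> snd ((T ^^ n) (t, y)) = frac (y + real n * \<alpha>)"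
proof (induction n)
  case 0 then show ?case by (simp add: frac_eq)
next
  case (Suc n)
  then have "snd ((T ^^ Suc n) (t, y)) = frac (frac (y + real n * \<alpha>) + \<alpha>)" by (simp add: T_def[of "(T ^^ n) _"])
  also have "\<dots> = frac (y + real (Suc n) * \<alpha>)"
    by (simp add: frac_frac_add algebra_simps)
  finally show ?case .
qed

lemma fst_T_pow_in: "t \<in> S \<Longrightarrow> fst ((T ^^ n) (t, y)) \<in> S"
  by (induction n) (auto simp: T_def intro!: R_in zpow_in bijA AS)

text \<open>The exponent of \<open>A\<close> depends on the height alone, so over a fixed height the
  squares are permuted. Sets of squares over a base point can therefore be carried along its orbit
  without loss of cardinality.\<close>

definition step_perm :: "real \<Rightarrow> 'a \<Rightarrow> 'a" where
  "step_perm z t = R (zpow A \<lfloor>z + \<alpha>\<rfloor> t)"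

lemma T_eq: "T (t, z) = (step_perm z t, frac (z + \<alpha>))"
  by (simp add: T_def step_perm_def)

lemma bij_step_perm: "bij_betw (step_perm z) S S"
  using bij_betw_comp_iff[THEN iffD1, OF bij_betw_zpow[OF bijA AS] bijR] bij_betw_trans[OF bij_betw_zpow[OF bijA AS] bijR]
  unfolding step_perm_def by (simp add: comp_def)

lemma bij_fst_T_pow: "bij_betw (\<lambda>t. fst ((T ^^ n) (t, z))) S S"
proof (induction n arbitrary: z)
  case 0 then show ?case by (simp add: bij_betw_def)
next
  case (Suc n)
  have "(\<lambda>t. fst ((T ^^ Suc n) (t, z))) = (\<lambda>t. fst ((T ^^ n) (t, frac (z + \<alpha>)))) \<circ> step_perm z"
    by (simp add: funpow_Suc_right T_eq comp_def del: funpow.simps)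
  then show ?case using bij_betw_trans[OF bij_step_perm Suc] by simp
qed

text \<open>\<open>(zpow A \<lfloor>y + h\<rfloor> t, frac (y + h))\<close> is the point at height \<open>h\<close> above \<open>(t, y)\<close>; the map
  commutes with this vertical motion unless a vertex lies in between.\<close>

lemma T_shift:
  assumes "0 \<le> frac (y + \<alpha>) + h" "frac (y + \<alpha>) + h < 1"
  shows "T (zpow A \<lfloor>y + h\<rfloor> t, frac (y + h)) = (fst (T (t, y)), snd (T (t, y)) + h)"
proof -
  have "\<lfloor>y + \<alpha> + h\<rfloor> = \<lfloor>y + \<alpha>\<rfloor>" using assms by (intro floor_unique) (auto simp: frac_def)
  moreover have "y + \<alpha> + h = (frac (y + h) + \<alpha>) + of_int \<lfloor>y + h\<rfloor>" by (simp add: frac_def)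
  ultimately have e: "\<lfloor>frac (y + h) + \<alpha>\<rfloor> + \<lfloor>y + h\<rfloor> = \<lfloor>y + \<alpha>\<rfloor>" by (metis floor_add_int)
  then have "R (zpow A \<lfloor>frac (y + h) + \<alpha>\<rfloor> (zpow A \<lfloor>y + h\<rfloor> t)) = R (zpow A \<lfloor>y + \<alpha>\<rfloor> t)"
    by (simp add: zpow_add[OF bijA, symmetric])
  moreover have "frac (frac (y + h) + \<alpha>) = frac (y + \<alpha>) + h"
    using \<open>\<lfloor>y + \<alpha> + h\<rfloor> = \<lfloor>y + \<alpha>\<rfloor>\<close> by (simp add: frac_frac_add) (simp add: frac_def ac_simps)
  ultimately show ?thesis by (simp add: T_def)
qed

text \<open>The condition starts at \<open>i = 1\<close>: the initial motion may itself lead across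
  a horizontal edge, and then the two starting squares differ by a power of \<open>A\<close>. This
  case yields the invariance under \<open>A\<close> in \<open>hitting_stage\<close>.\<close>

lemma T_pow_shift:
  assumes "0 \<le> y" "y < 1" "1 \<le> n" "\<And>i. 1 \<le> i \<Longrightarrow> i \<le> n \<Longrightarrow> 0 \<le> frac (y + real i * \<alpha>) + h \<and> frac (y + real i * \<alpha>) + h < 1"
  shows "(T ^^ n) (zpow A \<lfloor>y + h\<rfloor> t, frac (y + h)) = (fst ((T ^^ n) (t, y)), snd ((T ^^ n) (t, y)) + h)"
  using assms(3,4)
proof (induction n rule: nat_induct_at_least)
  case base
  then show ?case using T_shift[of y h t] by simp
next
  case (Suc n)
  let ?y = "snd ((T ^^ n) (t, y))" and ?t = "fst ((T ^^ n) (t, y))"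
  have y: "?y = frac (y + real n * \<alpha>)" using assms by (simp add: snd_T_pow)
  have b: "0 \<le> ?y + h" "?y + h < 1" using Suc.prems[of n] Suc.hyps by (auto simp: y)
  have fr: "frac (?y + \<alpha>) = frac (y + real (Suc n) * \<alpha>)"
    using snd_T_pow[OF assms(1,2), of "Suc n" t] by (simp add: T_def)
  have "(T ^^ Suc n) (zpow A \<lfloor>y + h\<rfloor> t, frac (y + h)) = T (?t, ?y + h)"
    using Suc by simp
  also have "\<dots> = T (zpow A \<lfloor>?y + h\<rfloor> ?t, frac (?y + h))"
    using b by (simp add: floor_eq_iff frac_eq flip: zpow_0) (simp add: floor_unique[of 0])
  also have "\<dots> = (fst (T (?t, ?y)), snd (T (?t, ?y)) + h)"
    using Suc.prems[of "Suc n"] by (intro T_shift) (auto simp: fr)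
  finally show ?case by simp
qed

lemma T_pow_shift0:
  assumes "0 \<le> y" "y < 1" "\<And>i. i \<le> n \<Longrightarrow> 0 \<le> frac (y + real i * \<alpha>) + h \<and> frac (y + real i * \<alpha>) + h < 1"
  shows "(T ^^ n) (t, y + h) = (fst ((T ^^ n) (t, y)), snd ((T ^^ n) (t, y)) + h)"
proof (cases "n = 0")
  case False
  have b: "0 \<le> y + h" "y + h < 1" using assms(3)[of 0] assms(1,2) by (auto simp: frac_eq)
  then have "\<lfloor>y + h\<rfloor> = 0" by linarith
  then show ?thesis using T_pow_shift[of y n h t] assms b False by (simp add: frac_eq)
qed simp

text \<open>Integer heights on a vertical edge are vertices, so this expresses that a vertex
  separates the point at height \<open>w\<close> from the one \<open>h\<close> above it. Reaching
  height 1 counts as a crossing and reaching height 0 does not, as heights range over the half-open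
  unit interval.\<close>

definition crosses :: "real \<Rightarrow> real \<Rightarrow> bool" where
  "crosses h w \<longleftrightarrow> \<not> (0 \<le> frac w + h \<and> frac w + h < 1)"

text \<open>At each of the two times an integer lies in a half-open interval of length
  \<open>\<bar>h\<bar>\<close>, on the same side of the orbit point. Hence
  \<open>(j - i) * \<alpha>\<close> is closer than \<open>\<bar>h\<bar>\<close> to an integer,
  against \<open>badly\<close>.\<close>

lemma crosses_unique_less:
  fixes i j :: nat
  assumes "i < j" "\<bar>h\<bar> * real (j - i) < c" "crosses h (y + real i * \<alpha>)" "crosses h (y + real j * \<alpha>)"
  shows False
proof -
  let ?w = "\<lambda>i. y + real i * \<alpha>"
  have fr: "0 \<le> frac (?w k)" "frac (?w k) < 1" for k by (auto simp: frac_lt_1)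
  have "\<exists>m. (0 \<le> h \<and> 0 < of_int m - ?w k \<and> of_int m - ?w k \<le> h) \<or>
      (h < 0 \<and> h < of_int m - ?w k \<and> of_int m - ?w k \<le> 0)" if "crosses h (?w k)" for k
  proof (cases "0 \<le> h")
    case True
    then have "1 \<le> frac (?w k) + h" using that fr[of k] by (auto simp: crosses_def)
    then show ?thesis using True fr[of k] by (intro exI[of _ "\<lfloor>?w k\<rfloor> + 1"]) (auto simp: frac_def)
  next
    case False
    then have "frac (?w k) + h < 0" using that fr[of k] by (auto simp: crosses_def)
    then show ?thesis using False fr[of k] by (intro exI[of _ "\<lfloor>?w k\<rfloor>"]) (auto simp: frac_def)
  qed
  note m = this
  obtain m n where
    "\<bar>(?w j - ?w i) - (of_int n - of_int m)\<bar> < \<bar>h\<bar>" 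
  proof (cases "0 \<le> h")
    case True
    with m[OF assms(3)] m[OF assms(4)] obtain m n where "0 < of_int m - ?w i" "of_int m - ?w i \<le> h"
      "0 < of_int n - ?w j" "of_int n - ?w j \<le> h" by auto
    then show ?thesis using True by (intro that[of n m]) linarith
  next
    case False
    with m[OF assms(3)] m[OF assms(4)] obtain m n where "h < of_int m - ?w i" "of_int m - ?w i \<le> 0"
      "h < of_int n - ?w j" "of_int n - ?w j \<le> 0" by auto
    then show ?thesis using False by (intro that[of n m]) linarith
  qed
  moreover have "?w j - ?w i = of_int (int (j - i)) * \<alpha>"
    using assms(1) by (simp add: of_nat_diff algebra_simps)
  ultimately have "\<bar>of_int (int (j - i)) * \<alpha> - of_int (n - m)\<bar> < \<bar>h\<bar>" by simp
  moreover have "c / of_int (int (j - i)) \<le> \<bar>of_int (int (j - i)) * \<alpha> - of_int (n - m)\<bar>"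
    using assms(1) by (intro badly) simp
  ultimately have "c / real (j - i) < \<bar>h\<bar>" by simp
  then show False using assms(1,2) by (simp add: field_simps)
qed

lemma crosses_unique:
  fixes i j :: nat
  assumes "\<bar>h\<bar> * real n < c" "i \<le> j + n" "j \<le> i + n"
    "crosses h (y + real i * \<alpha>)" "crosses h (y + real j * \<alpha>)"
  shows "i = j"
proof (rule ccontr)
  assume "i \<noteq> j"
  have *: "\<bar>h\<bar> * real k < c" if "k \<le> n" for k
    using assms(1) mult_left_mono[of "real k" "real n" "\<bar>h\<bar>"] that by simp
  show False
    using crosses_unique_less[of i j h y] crosses_unique_less[of j i h y] assms \<open>i \<noteq> j\<close>
      *[of "i - j"] *[of "j - i"] by (cases "i < j") auto
qed

text \<open>A Dirichlet approximation \<open>p / q\<close> with \<open>q <= Q\<close> has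
  \<open>q > c * Q\<close> by \<open>badly\<close>. The first \<open>q\<close> orbit points are
  within \<open>1 / q\<close> of a translate of the multiples of \<open>1 / q\<close>, so one of
  them is within \<open>2 / q < \<eta> / 2\<close> of the midpoint. Rounding
  \<open>4 / (c * \<eta>)\<close> up to \<open>Q\<close> accounts for the 5.\<close>

lemma rotation_dense:
  assumes "0 < \<eta>" "\<eta> \<le> 1" "0 \<le> a" "b \<le> 1" "\<eta> \<le> b - a"
  obtains i :: nat where "real i < 5 / (c * \<eta>)" "a < frac (z + real i * \<alpha>)" "frac (z + real i * \<alpha>) < b"
proof -
  define Q where "Q = nat \<lceil>4 / (c * \<eta>)\<rceil>"
  have pos: "0 < 4 / (c * \<eta>)" using assms c_pos by simp
  have Q: "4 / (c * \<eta>) \<le> real Q" "real Q < 4 / (c * \<eta>) + 1"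
    unfolding Q_def using pos by (auto simp: le_of_int_ceiling) linarith
  have Q0: "0 < Q" using Q(1) pos by (metis gr0I le_less_trans not_less of_nat_0 order_less_irrefl)
  obtain p q where pq: "coprime p q" "0 < q" "q \<le> int Q" "\<bar>of_int q * \<alpha> - of_int p\<bar> < 1 / real Q"
    using Dirichlet_approx_coprime[OF Q0, of \<alpha>] by metis
  have q: "0 < real_of_int q" using pq by simp
  have qQ: "c * real Q < q"
  proof -
    have "c / of_int q < 1 / real Q" using badly[OF pq(2), of p] pq(4) by linarith
    then show ?thesis using q Q0 by (simp add: field_simps)
  qed
  define m where "m = (a + b) / 2"
  define j where "j = \<lfloor>q * (m - z)\<rfloor>"
  have j: "j \<le> q * (m - z)" "q * (m - z) < j + 1" by (auto simp: j_def)
  obtain u v where uv: "u * p + v * q = 1" using bezout_int[of p q] pq(1) by auto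
  \<comment> \<open>Bezout gives the index whose rational approximation falls at the wanted residue:
    \<open>i * p\<close> is congruent to \<open>j\<close> modulo \<open>q\<close>.\<close>
  define i where "i = (u * j) mod q"
  have i: "0 \<le> i" "i < q" using pq(2) by (auto simp: i_def)
  define k where "k = - (v * j) - (u * j div q) * p"
  have "i = u * j - q * (u * j div q)" by (simp add: i_def minus_mult_div_eq_mod)
  then have "i * p = (u * j - q * (u * j div q)) * p" by (simp only:)
  also have "\<dots> = (u * p) * j - q * (u * j div q) * p" by (simp add: algebra_simps)
  also have "u * p = 1 - v * q" using uv by simp
  finally have k: "i * p = j + q * k" by (simp add: k_def algebra_simps)
  have "q * (z + i * \<alpha> - k - m) = i * (q * \<alpha> - p) + (j - q * (m - z))"
  proof -
    have "real_of_int i * p = j + q * k" using k by (metis of_int_add of_int_mult)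
    then show ?thesis by (simp add: algebra_simps)
  qed
  moreover have "\<bar>i * (q * \<alpha> - p)\<bar> \<le> 1"
  proof -
    have "\<bar>i * (q * \<alpha> - p)\<bar> \<le> real Q * (1 / real Q)"
      unfolding abs_mult using i pq by (intro mult_mono) auto
    then show ?thesis using Q0 by simp
  qed
  ultimately have "\<bar>q * (z + i * \<alpha> - k - m)\<bar> \<le> 2" using j by linarith
  then have "\<bar>(z + i * \<alpha> - k) - m\<bar> \<le> 2 / q"
    using q by (simp only: abs_mult abs_of_pos pos_le_divide_eq mult.commute)
  also have "2 / q < 2 / (c * real Q)"
    using qQ c_pos Q0 q by (intro divide_strict_left_mono mult_pos_pos) auto
  also have "\<dots> \<le> \<eta> / 2"
    using Q(1) assms c_pos Q0 by (simp add: field_simps)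
  finally have close: "\<bar>(z + i * \<alpha> - k) - m\<bar> < \<eta> / 2" .
  then have ab: "a < z + i * \<alpha> - k" "z + i * \<alpha> - k < b"
    using assms unfolding m_def by (auto simp: abs_less_iff field_simps)
  then have "frac (z + i * \<alpha>) = z + i * \<alpha> - k"
    using assms by (intro frac_unique_iff[THEN iffD2]) auto
  moreover have "real (nat i) < 5 / (c * \<eta>)"
  proof -
    have "real (nat i) < real Q" using i pq by simp
    also have "c * \<eta> \<le> 1" using c_le_half assms c_pos by (intro mult_le_one) auto
    then have "1 \<le> 1 / (c * \<eta>)" using assms c_pos by simp
    then have "real Q \<le> 5 / (c * \<eta>)" using Q(2) by (simp add: field_simps)
    finally show ?thesis by simp
  qed
  ultimately show ?thesis using that[of "nat i"] ab i by simp
qed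

end

subsection \<open>Linear recurrence\<close>

context skew_rotation
begin

definition hitting :: "'a \<Rightarrow> real \<Rightarrow> real \<Rightarrow> nat \<Rightarrow> real \<Rightarrow> 'a set" where
  "hitting s w r M z = {t \<in> S. \<exists>i<M. fst ((T ^^ i) (t, z)) = s \<and> \<bar>snd ((T ^^ i) (t, z)) - w\<bar> \<le> r}"

lemma hitting_subset: "hitting s w r M z \<subseteq> S"
  by (auto simp: hitting_def)

lemma finite_hitting [simp]: "finite (hitting s w r M z)"
  using finite_subset[OF hitting_subset finS] .

lemma hitting_mono: "r \<le> r' \<Longrightarrow> M \<le> M' \<Longrightarrow> hitting s w r M z \<subseteq> hitting s w r' M' z"
  by (force simp: hitting_def)

lemma card_hitting_mono: "r \<le> r' \<Longrightarrow> M \<le> M' \<Longrightarrow> card (hitting s w r M z) \<le> card (hitting s w r' M' z)"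
  by (intro card_mono hitting_mono) auto

lemma hitting_step:
  assumes "t \<in> S" "step_perm z t \<in> hitting s w r M (frac (z + \<alpha>))"
  shows "t \<in> hitting s w r (Suc M) z"
proof -
  obtain i where i: "i < M" "fst ((T ^^ i) (step_perm z t, frac (z + \<alpha>))) = s"
    "\<bar>snd ((T ^^ i) (step_perm z t, frac (z + \<alpha>))) - w\<bar> \<le> r"
    using assms(2) by (auto simp: hitting_def)
  have "(T ^^ i) (step_perm z t, frac (z + \<alpha>)) = (T ^^ Suc i) (t, z)"
    by (simp add: funpow_Suc_right T_eq del: funpow.simps)
  then show ?thesis using i assms(1) by (auto simp: hitting_def intro!: exI[of _ "Suc i"] simp del: funpow.simps)
qed

text \<open>Pulling back along the fibre permutation over \<open>z\<close> is injective and costs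
  one unit of time.\<close>

lemma card_hitting_step: "card (hitting s w r M (frac (z + \<alpha>))) \<le> card (hitting s w r (Suc M) z)"
proof (rule card_inj_on_le)
  let ?g = "inv_into S (step_perm z)"
  have inj: "inj_on (step_perm z) S" "step_perm z ` S = S"
    using bij_step_perm[of z] by (auto simp: bij_betw_def)
  show "inj_on ?g (hitting s w r M (frac (z + \<alpha>)))"
    by (rule inj_on_subset[OF inj_on_inv_into[of S "step_perm z" S]]) (auto simp: inj hitting_subset)
  show "?g ` hitting s w r M (frac (z + \<alpha>)) \<subseteq> hitting s w r (Suc M) z"
  proof safe
    fix t assume t: "t \<in> hitting s w r M (frac (z + \<alpha>))"
    then have "t \<in> step_perm z ` S" using hitting_subset[THEN subsetD] inj by auto
    then show "?g t \<in> hitting s w r (Suc M) z"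
      using t by (intro hitting_step) (auto simp: inv_into_into f_inv_into_f)
  qed
qed auto

lemma card_hitting_pow:
  "card (hitting s w r M (frac (z + real i * \<alpha>))) \<le> card (hitting s w r (M + i) (frac z))"
proof (induction i arbitrary: M)
  case 0 then show ?case by simp
next
  case (Suc i)
  have "frac (z + real (Suc i) * \<alpha>) = frac (frac (z + real i * \<alpha>) + \<alpha>)"
    by (simp add: frac_frac_add algebra_simps)
  then show ?case using card_hitting_step[of s w r M "frac (z + real i * \<alpha>)"] Suc[of "Suc M"] by simp
qed

text \<open>The rotation brings the base point into the interval, and the fibre permutation at that
  moment sends some \<open>t\<close> to \<open>s\<close>.\<close>

lemma hitting_nonempty:
  assumes "s \<in> S" "0 < r" "0 \<le> w - r" "w + r \<le> 1" "5 / (c * r) \<le> real M" "0 \<le> z" "z < 1"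
  shows "hitting s w r M z \<noteq> {}"
proof -
  have r1: "r \<le> 1" using assms(3,4) by linarith
  have r2: "r \<le> w + r - (w - r)" using assms(2) by simp
  obtain i where i: "real i < 5 / (c * r)" "w - r < frac (z + real i * \<alpha>)" "frac (z + real i * \<alpha>) < w + r"
    by (rule rotation_dense[OF assms(2) r1 assms(3,4) r2])
  have "s \<in> (\<lambda>t. fst ((T ^^ i) (t, z))) ` S"
    using bij_fst_T_pow[of i z] assms(1) by (simp add: bij_betw_def)
  then obtain t where t: "t \<in> S" "fst ((T ^^ i) (t, z)) = s" by blast
  have "t \<in> hitting s w r M z"
    using i t assms by (auto simp: hitting_def snd_T_pow abs_le_iff intro!: exI[of _ i])
  then show ?thesis by auto
qed

text \<open>Without an increase, the count is exactly \<open>e\<close> along the first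
  \<open>L\<close> steps of the orbit of \<open>z\<close>, for both radii, and the sets
  \<open>F i\<close> become rigid enough to be compared by translation. The scale
  \<open>c / (4 * M)\<close> permits at most one vertex crossing in \<open>2 * M\<close> steps;
  \<open>40 / c\<^sup>2\<close> steps per unit of \<open>M\<close> make the orbit
  \<open>\<eta> / 2\<close>-dense after time \<open>M\<close>.\<close>

lemma hitting_stage:
  assumes e: "\<And>z. 0 \<le> z \<Longrightarrow> z < 1 \<Longrightarrow> e \<le> card (hitting s w r M z)" and e1: "1 \<le> e" "e < card S"
    and M: "1 \<le> M" and r: "0 < r" "0 \<le> w - r'" "w + r' \<le> 1" "c / (4 * real M) \<le> r' - r"
    and K: "40 / c\<^sup>2 + 3 \<le> real K" and z: "0 \<le> z" "z < 1"
  shows "e + 1 \<le> card (hitting s w r' (K * M) z)"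
proof (rule ccontr)
  assume "\<not> e + 1 \<le> card (hitting s w r' (K * M) z)"
  then have le: "card (hitting s w r' (K * M) z) \<le> e" by simp
  define \<eta> where "\<eta> = c / (4 * real M)"
  have \<eta>: "0 < \<eta>" "\<eta> \<le> r' - r" using c_pos M r by (auto simp: \<eta>_def)
  have \<eta>1: "\<eta> \<le> 1"
  proof -
    have "\<eta> \<le> c / 1" unfolding \<eta>_def using M c_pos by (intro divide_left_mono) auto
    then show ?thesis using c_le_half by simp
  qed
  have rr: "r \<le> r'" using \<eta> by simp
  have "0 \<le> 40 / c\<^sup>2" by simp
  then have K3: "3 \<le> K" using K by linarith
  define L where "L = (K - 1) * M"
  have KM: "K * M = L + M" using K3 by (simp add: L_def algebra_simps)
  have LM: "2 * M \<le> L" using K3 unfolding L_def by (intro mult_le_mono1) auto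
  define x where "x i = frac (z + real i * \<alpha>)" for i :: nat
  have x: "0 \<le> x i" "x i < 1" for i by (auto simp: x_def frac_lt_1)
  have xadd: "frac (x i + real j * \<alpha>) = x (i + j)" for i j
    by (simp add: x_def frac_frac_add algebra_simps)
  define F where "F i = hitting s w r M (x i)" for i
  have up: "card (hitting s w r' m (x i)) \<le> e" if "m + i \<le> L + M" for i m
  proof -
    have "card (hitting s w r' m (x i)) \<le> card (hitting s w r' (m + i) z)"
      using card_hitting_pow[of s w r' m z i] z by (simp add: x_def frac_eq)
    also have "\<dots> \<le> card (hitting s w r' (K * M) z)" using that KM by (intro card_hitting_mono) auto
    finally show ?thesis using le by simp
  qed
  \<comment> \<open>The count is at least \<open>e\<close> for the small radius and time
    \<open>M\<close>, and at most \<open>e\<close> for the large radius and the full time. So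
    changing radius or time within these limits does not change the set, which absorbs all losses in
    the comparisons that follow.\<close>
  have Feq: "hitting s w r' m (x i) = F i" if "M \<le> m" "m + i \<le> L + M" for i m
  proof -
    have "F i \<subseteq> hitting s w r' m (x i)" unfolding F_def using that rr by (intro hitting_mono)
    moreover have "card (hitting s w r' m (x i)) \<le> card (F i)"
      using up[OF that(2)] e[OF x] by (auto simp: F_def intro: order_trans)
    ultimately show ?thesis by (metis card_seteq finite_hitting)
  qed
  have cardF: "card (F i) = e" if "i \<le> L" for i
    using up[of M i] e[OF x, of i] Feq[of M i] that by (auto simp: F_def intro: antisym)
  \<comment> \<open>A pulled-back visit takes time \<open>Suc M\<close>, which \<open>Feq\<close>
    reduces to \<open>M\<close>; equal cardinalities turn the inclusion into an equality.\<close>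
  have equi: "step_perm (x i) ` F i = F (Suc i)" if "Suc i \<le> L" for i
  proof -
    have xs: "frac (x i + \<alpha>) = x (Suc i)" using xadd[of i 1] by simp
    have inj: "inj_on (step_perm (x i)) S" "step_perm (x i) ` S = S"
      using bij_step_perm[of "x i"] by (auto simp: bij_betw_def)
    have "F (Suc i) \<subseteq> step_perm (x i) ` F i"
    proof
      fix t' assume t': "t' \<in> F (Suc i)"
      then have "t' \<in> step_perm (x i) ` S" using hitting_subset[THEN subsetD] inj by (auto simp: F_def)
      then obtain t where t: "t \<in> S" "t' = step_perm (x i) t" by auto
      have "t \<in> hitting s w r (Suc M) (x i)"
        using t t' by (intro hitting_step) (auto simp: xs F_def)
      also have "\<dots> \<subseteq> hitting s w r' (Suc M) (x i)" using rr by (intro hitting_mono) auto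
      also have "\<dots> = F i" using that by (intro Feq) auto
      finally show "t' \<in> step_perm (x i) ` F i" using t by auto
    qed
    moreover have "card (step_perm (x i) ` F i) = card (F i)"
      by (intro card_image inj_on_subset[OF inj(1)]) (auto simp: F_def hitting_subset)
    ultimately show ?thesis using cardF[of i] cardF[of "Suc i"] that
      by (metis Suc_leD card_subset_eq finite_hitting finite_imageI F_def)
  qed
  have small: "\<bar>h\<bar> * real (2 * M) < c" if "\<bar>h\<bar> \<le> \<eta>" for h
  proof -
    have "\<bar>h\<bar> * real (2 * M) \<le> \<eta> * real (2 * M)" using that by (intro mult_right_mono) auto
    also have "\<dots> = c / 2" using M by (simp add: \<eta>_def)
    finally show ?thesis using c_pos by simp
  qed
  \<comment> \<open>Without a vertex in between, a visit is merely shifted by \<open>h\<close>, so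
    it stays within the larger radius \<open>r'\<close>.\<close>
  have near0: "F i = F k" if ik: "i \<le> L" "k \<le> L" and h: "x k = x i + h" "\<bar>h\<bar> \<le> \<eta>"
    and nc: "\<And>l. l < M \<Longrightarrow> \<not> crosses h (x i + real l * \<alpha>)" for i k h
  proof -
    have "F i \<subseteq> F k"
    proof
      fix t assume "t \<in> F i"
      then obtain l where l: "t \<in> S" "l < M" "fst ((T ^^ l) (t, x i)) = s" "\<bar>snd ((T ^^ l) (t, x i)) - w\<bar> \<le> r"
        by (auto simp: F_def hitting_def)
      have "(T ^^ l) (t, x i + h) = (fst ((T ^^ l) (t, x i)), snd ((T ^^ l) (t, x i)) + h)"
        using nc l x by (intro T_pow_shift0) (auto simp: crosses_def)
      then have "t \<in> hitting s w r' M (x k)"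
        using l h \<eta> unfolding hitting_def by (auto intro!: exI[of _ l])
      then show "t \<in> F k" using Feq[of M k] ik by auto
    qed
    then show ?thesis using cardF ik by (metis card_subset_eq finite_hitting F_def)
  qed
  text \<open>A vertex between two nearby points is avoided by comparing them \<open>M\<close> steps earlier, since a
    second vertex is too far away in time.\<close>
  have near: "F i = F k" if ik: "M \<le> i" "i \<le> L" "M \<le> k" "k \<le> L" and h: "x k = x i + h" "\<bar>h\<bar> \<le> \<eta>" for i k h
  proof (cases "\<exists>l<M. crosses h (x i + real l * \<alpha>)")
    case False
    then show ?thesis using near0[OF _ _ h] ik by auto
  next
    case True
    then obtain l where l: "l < M" "crosses h (x i + real l * \<alpha>)" by auto
    define i' k' where "i' = i - M" and "k' = k - M"
    have i': "i = i' + M" "k = k' + M" using ik by (auto simp: i'_def k'_def)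
    \<comment> \<open>Both \<open>x i\<close> and \<open>x i + h\<close> lie in the unit interval,
      so the crossing happens after time 0, that is, more than \<open>M\<close> steps after the
      earlier points \<open>x i'\<close> and \<open>x k'\<close>.\<close>
    have l0: "l \<noteq> 0" using l h x[of i] x[of k] by (auto simp: crosses_def frac_eq intro!: Nat.gr0I)
    have nc: "\<not> crosses h (x i' + real j * \<alpha>)" if "j \<le> M" for j
    proof
      assume "crosses h (x i' + real j * \<alpha>)"
      moreover have "crosses h (x i' + real (M + l) * \<alpha>)" using l(2) by (simp only: crosses_def xadd i' add.assoc simp_thms)
      ultimately have "j = M + l"
        using crosses_unique[OF small[OF h(2)], of j "M + l" "x i'"] that l by auto
      then show False using that l0 by simp
    qed
    \<comment> \<open>The two orbits differ by \<open>h\<close> modulo 1 at all times; as no vertex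
      separates them in this stretch, the difference is exactly \<open>h\<close>.\<close>
    have xk': "x (k' + j) = x (i' + j) + h" if "j \<le> M" for j
    proof -
      have b: "0 \<le> x (i' + j) + h" "x (i' + j) + h < 1"
        using nc[OF that] by (auto simp: crosses_def xadd)
      define m1 m2 where "m1 = \<lfloor>x (i' + j) + real (M - j) * \<alpha>\<rfloor>" and "m2 = \<lfloor>x (k' + j) + real (M - j) * \<alpha>\<rfloor>"
      have m1: "x i = x (i' + j) + real (M - j) * \<alpha> - of_int m1"
        using xadd[of "i' + j" "M - j"] that unfolding frac_def m1_def i' by simp
      have m2: "x k = x (k' + j) + real (M - j) * \<alpha> - of_int m2"
        using xadd[of "k' + j" "M - j"] that unfolding frac_def m2_def i' by simp
      have "x (i' + j) + h - x (k' + j) = of_int (m1 - m2)" using m1 m2 h(1) by simp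
      then have "x (i' + j) + h - x (k' + j) \<in> \<int>" by (simp only: Ints_of_int)
      then have "frac (x (i' + j) + h) = x (k' + j)"
        using x[of "k' + j"] by (intro frac_unique_iff[THEN iffD2]) auto
      then show ?thesis using b by (simp add: frac_eq)
    qed
    \<comment> \<open>With no vertex between them both points apply the same fibre permutation, so
      \<open>equi\<close> carries the equality from \<open>i'\<close> up to
      \<open>i\<close>.\<close>
    have "F (i' + j) = F (k' + j)" if "j \<le> M" for j
      using that
    proof (induction j)
      case 0
      then show ?case using near0[of i' k' h] xk'[of 0] h nc ik i' by auto
    next
      case (Suc j)
      have "\<not> crosses h (x (i' + j) + \<alpha>)"
        using nc[of "Suc j"] Suc.prems xadd[of "i' + j" 1] xadd[of i' "Suc j"] by (simp add: crosses_def)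
      then have "\<lfloor>x (i' + j) + \<alpha> + h\<rfloor> = \<lfloor>x (i' + j) + \<alpha>\<rfloor>"
        by (intro floor_unique) (auto simp: crosses_def frac_def)
      then have "step_perm (x (i' + j)) = step_perm (x (k' + j))"
        using xk'[of j] Suc.prems by (simp add: step_perm_def fun_eq_iff add_ac)
      then show ?case using Suc equi[of "i' + j"] equi[of "k' + j"] ik i' by simp
    qed
    from this[of M] show ?thesis by (simp add: i')
  qed
  have dense: "\<exists>i. M \<le> i \<and> i \<le> L \<and> a < x i \<and> x i < a + \<eta> / 2" if a: "0 \<le> a" "a + \<eta> / 2 \<le> 1" for a
  proof -
    obtain i where i: "real i < 5 / (c * (\<eta> / 2))" "a < frac ((z + real M * \<alpha>) + real i * \<alpha>)"
      "frac ((z + real M * \<alpha>) + real i * \<alpha>) < a + \<eta> / 2"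
      by (rule rotation_dense[of "\<eta> / 2" a "a + \<eta> / 2" "z + real M * \<alpha>"]) (use a \<eta> \<eta>1 in auto)
    have "5 / (c * (\<eta> / 2)) = 40 / c\<^sup>2 * real M"
      unfolding \<eta>_def using c_pos M by (simp add: field_simps power2_eq_square)
    also have "\<dots> \<le> (real K - 3) * real M" using K by (intro mult_right_mono) auto
    also have "\<dots> \<le> real L - real M"
      using K3 by (simp add: L_def of_nat_diff algebra_simps)
    finally have "real (M + i) \<le> real L" using i(1) by simp
    then have "M + i \<le> L" by (simp only: of_nat_le_iff)
    then show ?thesis using i by (intro exI[of _ "M + i"]) (auto simp: x_def algebra_simps)
  qed
  have const_less: "F i = F k" if ik: "M \<le> i" "i \<le> L" "M \<le> k" "k \<le> L" "x i \<le> x k" for i k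
  proof -
    \<comment> \<open>The highest orbit point not above \<open>x k\<close> with the same set as
      \<open>x i\<close> must be within \<open>\<eta>\<close> of \<open>x k\<close>, since otherwise
      density provides a higher one.\<close>
    define J where "J = {j \<in> {M..L}. F j = F i \<and> x j \<le> x k}"
    have J: "finite J" "i \<in> J" using ik by (auto simp: J_def)
    then have "Max (x ` J) \<in> x ` J" by (intro Max_in) auto
    then obtain j where j: "j \<in> J" "x j = Max (x ` J)" by auto
    have jmax: "x j' \<le> x j" if "j' \<in> J" for j' using that J by (simp add: j)
    have xk: "x k \<le> x j + \<eta>"
    proof (rule ccontr)
      assume "\<not> x k \<le> x j + \<eta>"
      then have gt: "x j + \<eta> < x k" by simp
      then obtain m where m: "M \<le> m" "m \<le> L" "x j < x m" "x m < x j + \<eta> / 2"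
        using dense[of "x j"] x[of j] x[of k] \<eta> by auto
      then have "F j = F m" using j \<eta> by (intro near[of j m "x m - x j"]) (auto simp: J_def)
      then have "m \<in> J" using m j gt \<eta> by (auto simp: J_def)
      then show False using jmax[of m] m by simp
    qed
    have "F j = F k" using j ik xk by (intro near[of j k "x k - x j"]) (auto simp: J_def)
    then show ?thesis using j by (simp add: J_def)
  qed
  have const: "F i = F M" if "M \<le> i" "i \<le> L" for i
    using const_less[of i M] const_less[of M i] that LM M by (cases "x i \<le> x M") auto
  text \<open>Points just below height \<open>1\<close> and just above height \<open>0\<close> are neighbours across a horizontal edge.\<close>
  have AF: "A ` F M \<subseteq> F M"
  proof -
    obtain i where i: "M \<le> i" "i \<le> L" "1 - \<eta> / 2 < x i"
      using dense[of "1 - \<eta> / 2"] \<eta> \<eta>1 by auto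
    obtain k where k: "M \<le> k" "k \<le> L" "x k < \<eta> / 2" "0 < x k"
      using dense[of 0] \<eta>1 by auto
    define h where "h = x k + 1 - x i"
    have h: "\<bar>h\<bar> \<le> \<eta>" "0 < h" using i k x[of i] x[of k] by (auto simp: h_def)
    have fl: "\<lfloor>x i + h\<rfloor> = 1" "frac (x i + h) = x k"
      using x[of k] by (auto simp: h_def frac_def floor_eq_iff)
    \<comment> \<open>The vertex between \<open>x i\<close> and \<open>x k\<close> is met at time 0,
      so by uniqueness none is met in the following \<open>M\<close> steps.\<close>
    have c0: "crosses h (x i + real 0 * \<alpha>)"
      using x[of i] x[of k] by (simp add: crosses_def frac_eq) (simp add: h_def)
    have "A t \<in> F k" if "t \<in> F i" for t
    proof -
      from that obtain l where l: "t \<in> S" "l < M" "fst ((T ^^ l) (t, x i)) = s" "\<bar>snd ((T ^^ l) (t, x i)) - w\<bar> \<le> r"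
        by (auto simp: F_def hitting_def)
      \<comment> \<open>A visit at time 0 is impossible: \<open>x i\<close> is above
        \<open>1 - \<eta> / 2\<close>, whereas \<open>w + r <= 1 - \<eta>\<close>. So the shift
        lemma whose condition starts at time 1 applies.\<close>
      have l1: "1 \<le> l"
      proof (rule ccontr)
        assume "\<not> 1 \<le> l"
        then have "l = 0" by simp
        then have "x i \<le> w + r" using l(4) by simp
        then show False using i \<eta> r by linarith
      qed
      have "\<not> crosses h (x i + real j * \<alpha>)" if "1 \<le> j" "j \<le> l" for j
        using crosses_unique[OF small[OF h(1)], of j 0 "x i"] c0 that l(2) by linarith
      then have "(T ^^ l) (zpow A \<lfloor>x i + h\<rfloor> t, frac (x i + h)) = (fst ((T ^^ l) (t, x i)), snd ((T ^^ l) (t, x i)) + h)"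
        using x[of i] l1 by (intro T_pow_shift) (auto simp: crosses_def)
      then have "(T ^^ l) (A t, x k) = (s, snd ((T ^^ l) (t, x i)) + h)" using l by (simp add: fl)
      moreover have "A t \<in> S" using AS l by auto
      ultimately have "A t \<in> hitting s w r' M (x k)"
        using l h \<eta> by (auto simp: hitting_def intro!: exI[of _ l])
      then show "A t \<in> F k" using Feq[of M k] k by auto
    qed
    then show ?thesis using const[OF i(1,2)] const[OF k(1,2)] by auto
  qed
  have FS: "F M \<subseteq> S" by (simp add: F_def hitting_subset)
  have finF: "finite (F M)" by (simp add: F_def)
  have AFeq: "A ` F M = F M"
    using AF finF bijA by (intro card_subset_eq) (auto simp: card_image bij_def inj_on_subset)
  have "step_perm (x M) ` F M = F M"
    using equi[of M] const[of "Suc M"] LM M by simp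
  \<comment> \<open>The power of \<open>A\<close> maps \<open>F M\<close> onto itself, so invariance
    under the fibre permutation becomes invariance under \<open>R\<close>.\<close>
  moreover have "step_perm (x M) ` F M = R ` F M"
  proof -
    have "zpow A \<lfloor>x M + \<alpha>\<rfloor> ` F M = F M"
      using bij_betw_zpow[OF bijA AFeq] by (auto simp: bij_betw_def)
    then show ?thesis unfolding step_perm_def by (metis image_image)
  qed
  moreover have cF: "card (F M) = e" using cardF[of M] LM by simp
  then have "F M \<noteq> {}" using e1 by auto
  ultimately have FM: "F M = S"
    using FS AF by (intro irred) auto
  have "card S = e" using cF unfolding FM .
  then have "e < e" using e1(2) by metis
  then show False by simp
qed

text \<open>Start from a count of at least 1 at radius \<open>r / card S\<close> and apply the stage
  \<open>card S - 1\<close> times; each stage costs another \<open>r / card S\<close> of radius and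
  a constant factor in time. The number of stages does not depend on \<open>r\<close>, so the time
  stays linear in \<open>1 / r\<close>.\<close>

lemma hitting_time:
  obtains K :: nat where "1 \<le> K"
    "\<And>s w (r::real) t z. s \<in> S \<Longrightarrow> 0 < r \<Longrightarrow> 0 \<le> w - r \<Longrightarrow> w + r \<le> 1 \<Longrightarrow> t \<in> S \<Longrightarrow> 0 \<le> z \<Longrightarrow> z < 1 \<Longrightarrow>
      \<exists>i. real i \<le> real K / r \<and> fst ((T ^^ i) (t, z)) = s \<and> \<bar>snd ((T ^^ i) (t, z)) - w\<bar> \<le> r"
proof -
  define b where "b = card S"
  have b: "1 \<le> b" using card_pos by (simp add: b_def)
  define K where "K = nat \<lceil>40 / c\<^sup>2 + 3\<rceil>"
  have K: "40 / c\<^sup>2 + 3 \<le> real K" unfolding K_def by (rule real_nat_ceiling_ge)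
  define D where "D = nat \<lceil>5 / c\<rceil> + 1"
  have D: "5 / c \<le> real D" "1 \<le> D" unfolding D_def by (auto intro: order_trans[OF real_nat_ceiling_ge])
  have "0 \<le> 40 / c\<^sup>2" by simp
  then have "1 \<le> real K" using K by linarith
  then have K1: "1 \<le> K" by simp
  show ?thesis
  proof (rule that)
    show "1 \<le> K ^ b * (2 * D * b)" using K1 D b by simp
    fix s :: 'a and w r :: real and t :: 'a and z :: real assume s: "s \<in> S" and r: "0 < r" "0 \<le> w - r" "w + r \<le> 1" and t: "t \<in> S" and z: "0 \<le> z" "z < 1"
    define \<rho> where "\<rho> = r / b"
    have \<rho>: "0 < \<rho>" using r b by (simp add: \<rho>_def)
    have rhole: "\<rho> * real (Suc j) \<le> r" if "j < b" for j
    proof -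
      have "\<rho> * real (Suc j) \<le> \<rho> * real b" using \<rho> that by (intro mult_left_mono) auto
      then show ?thesis using b by (simp add: \<rho>_def)
    qed
    define M where "M = nat \<lceil>real D / \<rho>\<rceil>"
    have M: "real D / \<rho> \<le> real M" unfolding M_def by (rule real_nat_ceiling_ge)
    have r1: "r \<le> 1/2" using r by linarith
    have rho1: "\<rho> \<le> 1" using rhole[of 0] b r1 by simp
    have "0 < real D / \<rho>" using \<rho> D by simp
    then have "0 < real M" using M by linarith
    then have Mpos: "1 \<le> M" by simp
    have "\<And>z. 0 \<le> z \<Longrightarrow> z < 1 \<Longrightarrow> j + 1 \<le> card (hitting s w (\<rho> * real (Suc j)) (K ^ j * M) z)" if "j < b" for j
      using that
    proof (induction j)
      case 0
      have "5 / (c * \<rho>) = (5 / c) / \<rho>" by simp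
      also have "\<dots> \<le> real D / \<rho>" using D \<rho> by (intro divide_right_mono) auto
      finally have "hitting s w \<rho> M z \<noteq> {}"
        using M s \<rho> rhole[of 0] r b 0 by (intro hitting_nonempty) auto
      then have "0 < card (hitting s w \<rho> M z)" by (simp add: card_gt_0_iff)
      then show ?case by simp
    next
      case (Suc j)
      have Mj: "1 \<le> K ^ j * M" using K1 Mpos by simp
      have "c / (4 * real (K ^ j * M)) \<le> 1 / real (K ^ j * M)"
        using divide_right_mono[of "c / 4" 1 "real (K ^ j * M)"] c_le_half by simp
      also have "\<dots> \<le> 1 / real M" using K1 Mpos by (intro divide_left_mono) auto
      also have "\<dots> \<le> \<rho>"
      proof -
        have "1 / \<rho> \<le> real D / \<rho>" using D \<rho> by (intro divide_right_mono) auto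
        then show ?thesis using M \<rho> Mpos by (simp add: field_simps)
      qed
      finally have g: "c / (4 * real (K ^ j * M)) \<le> \<rho> * real (Suc (Suc j)) - \<rho> * real (Suc j)"
        by (simp add: algebra_simps)
      have "(j + 1) + 1 \<le> card (hitting s w (\<rho> * real (Suc (Suc j))) (K * (K ^ j * M)) z)"
      proof (intro hitting_stage[OF _ _ _ Mj _ _ _ g K])
        show "j + 1 \<le> card (hitting s w (\<rho> * real (Suc j)) (K ^ j * M) z)" if "0 \<le> z" "z < 1" for z
          using Suc.IH[of z] Suc.prems(3) that by linarith
        show "0 < \<rho> * real (Suc j)" using \<rho> by simp
        show "0 \<le> w - \<rho> * real (Suc (Suc j))" "w + \<rho> * real (Suc (Suc j)) \<le> 1"
          using rhole[OF Suc.prems(3)] r by linarith+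
      qed (use Suc.prems b_def in linarith)+
      then show ?case by (simp add: mult_ac)
    qed
    from this[OF _ z, of "b - 1"] have "b \<le> card (hitting s w (\<rho> * b) (K ^ (b - 1) * M) z)"
      using b by simp
    then have "hitting s w (\<rho> * b) (K ^ (b - 1) * M) z = S"
      using hitting_subset finS by (metis b_def card_seteq)
    moreover have "\<rho> * b = r" using b by (simp add: \<rho>_def)
    ultimately obtain i where i: "i < K ^ (b - 1) * M" "fst ((T ^^ i) (t, z)) = s" "\<bar>snd ((T ^^ i) (t, z)) - w\<bar> \<le> r"
      using t unfolding hitting_def by auto
    have "0 \<le> real D / \<rho>" using \<rho> by simp
    then have "real M = of_int \<lceil>real D / \<rho>\<rceil>" by (simp add: M_def)
    then have "real M \<le> real D / \<rho> + 1" by linarith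
    also have "\<dots> \<le> 2 * real D / \<rho>"
    proof -
      have "1 * \<rho> \<le> real D" using rho1 D by linarith
      then show ?thesis using \<rho> by (simp add: field_simps)
    qed
    finally have M2: "real M \<le> 2 * real D * b / r" by (simp add: \<rho>_def)
    have "real i \<le> real (K ^ (b - 1)) * real M" using i(1) by (metis less_imp_le of_nat_le_iff of_nat_mult)
    also have "\<dots> \<le> real (K ^ b) * (2 * real D * b / r)"
    proof (intro mult_mono M2)
      have "K ^ (b - 1) \<le> K ^ b" using K1 by (intro power_increasing) auto
      then show "real (K ^ (b - 1)) \<le> real (K ^ b)" by (simp only: of_nat_le_iff)
    qed auto
    also have "\<dots> = real (K ^ b * (2 * D * b)) / r" by simp
    finally show "\<exists>i. real i \<le> real (K ^ b * (2 * D * b)) / r \<and> fst ((T ^^ i) (t, z)) = s \<and> \<bar>snd ((T ^^ i) (t, z)) - w\<bar> \<le> r"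
      using i by blast
  qed
qed

end

subsection \<open>Uniform visiting frequencies\<close>

lemma interval_convexD: "is_interval J \<Longrightarrow> a \<in> J \<Longrightarrow> b \<in> J \<Longrightarrow> a \<le> z \<Longrightarrow> z \<le> b \<Longrightarrow> z \<in> (J :: real set)"
  by (meson is_interval_1)

context skew_rotation
begin

definition phase :: "('a \<times> real) set" where
  "phase = S \<times> {0..<1}"

lemma T_pow_phase: "x \<in> phase \<Longrightarrow> (T ^^ n) x \<in> phase"
proof -
  assume x: "x \<in> phase"
  obtain t y where [simp]: "x = (t, y)" by (cases x)
  have "fst ((T ^^ n) x) \<in> S" "snd ((T ^^ n) x) = frac (y + real n * \<alpha>)"
    using x by (auto simp: phase_def intro!: fst_T_pow_in snd_T_pow)
  then show ?thesis by (auto simp: phase_def mem_Times_iff frac_lt_1)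
qed

text \<open>The integer \<open>m\<close> makes this a separation on the circle; \<open>m = 1\<close>
  compares a height just below 1 with one just above 0.\<close>

lemma frac_orbit_sep:
  fixes i j N :: nat and m :: int
  assumes "i \<noteq> j" "i \<le> j + N" "j \<le> i + N"
  shows "c / real N \<le> \<bar>frac (y + real j * \<alpha>) - frac (y + real i * \<alpha>) + of_int m\<bar>"
proof -
  have *: "c / real N \<le> \<bar>frac (y + real j * \<alpha>) - frac (y + real i * \<alpha>) + of_int m\<bar>"
    if "i < j" "j \<le> i + N" for i j and m :: int
  proof -
    let ?k = "\<lfloor>y + real j * \<alpha>\<rfloor> - \<lfloor>y + real i * \<alpha>\<rfloor> - m"
    have "c / real N \<le> c / real (j - i)"
      using that c_pos by (intro divide_left_mono) auto
    also have "\<dots> = c / of_int (int (j - i))" by simp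
    also have "\<dots> \<le> \<bar>of_int (int (j - i)) * \<alpha> - of_int ?k\<bar>" using that by (intro badly) simp
    also have "of_int (int (j - i)) * \<alpha> - of_int ?k = frac (y + real j * \<alpha>) - frac (y + real i * \<alpha>) + of_int m"
      using that by (simp add: frac_def of_nat_diff algebra_simps)
    finally show ?thesis .
  qed
  show ?thesis
  proof (cases "i < j")
    case True then show ?thesis using * assms by simp
  next
    case False
    then have "c / real N \<le> \<bar>frac (y + real i * \<alpha>) - frac (y + real j * \<alpha>) + of_int (- m)\<bar>"
      using assms by (intro *) auto
    then show ?thesis by (simp add: abs_if split: if_splits)
  qed
qed

section \<open>Counting visits of an orbit to an interval\<close>

definition visits :: "'a \<Rightarrow> real set \<Rightarrow> nat \<Rightarrow> 'a \<times> real \<Rightarrow> nat" where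
  "visits s J n x = card {i. i < n \<and> fst ((T ^^ i) x) = s \<and> snd ((T ^^ i) x) \<in> J}"

lemma visits_le: "visits s J n x \<le> n"
proof -
  have "visits s J n x \<le> card {..<n}" unfolding visits_def by (intro card_mono) auto
  then show ?thesis by simp
qed

lemma visits_mono: "m \<le> n \<Longrightarrow> visits s J m x \<le> visits s J n x"
  unfolding visits_def by (intro card_mono) auto

lemma visits_sum:
  "real (visits s J n x) = (\<Sum>i<n. if fst ((T ^^ i) x) = s \<and> snd ((T ^^ i) x) \<in> J then 1 else 0)"
  unfolding visits_def by (subst sum.inter_filter[symmetric]) (auto intro!: arg_cong[where f = card])

lemma visits_add: "visits s J (m + n) x = visits s J m x + visits s J n ((T ^^ m) x)"
proof -
  have "{i. i < m + n \<and> fst ((T ^^ i) x) = s \<and> snd ((T ^^ i) x) \<in> J} =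
      {i. i < m \<and> fst ((T ^^ i) x) = s \<and> snd ((T ^^ i) x) \<in> J} \<union>
      (+) m ` {i. i < n \<and> fst ((T ^^ i) ((T ^^ m) x)) = s \<and> snd ((T ^^ i) ((T ^^ m) x)) \<in> J}"
    (is "?A = ?B \<union> _ ` ?C")
  proof (intro equalityI subsetI)
    fix i assume i: "i \<in> ?A"
    show "i \<in> ?B \<union> (+) m ` ?C"
    proof (cases "i < m")
      case False
      then have "i = m + (i - m)" by simp
      moreover have "(T ^^ ((i - m) + m)) x = (T ^^ (i - m)) ((T ^^ m) x)"
        by (simp only: funpow_add o_apply)
      then have "(T ^^ (i - m)) ((T ^^ m) x) = (T ^^ i) x" using False by simp
      ultimately show ?thesis using i False by (intro UnI2 image_eqI[of _ _ "i - m"]) auto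
    qed (use i in auto)
  next
    fix i assume "i \<in> ?B \<union> (+) m ` ?C"
    then show "i \<in> ?A" by (auto simp: funpow_add add.commute[of m])
  qed
  moreover have "?B \<inter> (+) m ` ?C = {}" by auto
  ultimately show ?thesis
    unfolding visits_def by (simp add: card_Un_disjoint card_image)
qed

text \<open>The last, incomplete block is estimated by a complete one, whence the
  \<open>+ 1\<close>; in the lower bound it is dropped, whence the \<open>- 1\<close> there.\<close>

lemma visits_upper_blocks:
  assumes w: "1 \<le> w" and B: "\<And>x. x \<in> phase \<Longrightarrow> real (visits s J w x) \<le> B" and x: "x \<in> phase"
  shows "real (visits s J m x) \<le> B * (real m / real w + 1)"
  using x
proof (induction m arbitrary: x rule: less_induct)
  case (less m)
  have B0: "0 \<le> B" using B[OF less.prems] by linarith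
  show ?case
  proof (cases "m < w")
    case True
    have "real (visits s J m x) \<le> real (visits s J w x)" using True by (simp add: visits_mono)
    also have "\<dots> \<le> B" using B less.prems by blast
    also have "\<dots> = B * 1" by simp
    also have "\<dots> \<le> B * (real m / real w + 1)" using B0 by (intro mult_left_mono) auto
    finally show ?thesis .
  next
    case False
    have "real (visits s J m x) = real (visits s J w x) + real (visits s J (m - w) ((T ^^ w) x))"
      using False visits_add[of s J w "m - w" x] by simp
    also have "\<dots> \<le> B + B * (real (m - w) / real w + 1)"
      using False w less.prems by (intro add_mono B less.IH T_pow_phase) auto
    also have "\<dots> = B * (real m / real w + 1)" using False w by (simp add: of_nat_diff field_simps)
    finally show ?thesis .
  qed
qed

lemma visits_lower_blocks:
  assumes w: "1 \<le> w" and B0: "0 \<le> B" and B: "\<And>x. x \<in> phase \<Longrightarrow> B \<le> real (visits s J w x)" and x: "x \<in> phase"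
  shows "B * (real m / real w - 1) \<le> real (visits s J m x)"
  using x
proof (induction m arbitrary: x rule: less_induct)
  case (less m)
  show ?case
  proof (cases "m < w")
    case True
    have "B * (real m / real w - 1) \<le> 0" using B0 True by (intro mult_nonneg_nonpos) auto
    then show ?thesis by linarith
  next
    case False
    have "B * (real m / real w - 1) = B + B * (real (m - w) / real w - 1)"
      using False w by (simp add: of_nat_diff field_simps)
    also have "\<dots> \<le> real (visits s J w x) + real (visits s J (m - w) ((T ^^ w) x))"
      using False w less.prems by (intro add_mono B less.IH T_pow_phase) auto
    also have "\<dots> = real (visits s J m x)"
      using False visits_add[of s J w "m - w" x] by simp
    finally show ?thesis .
  qed
qed

text \<open>With \<open>w = \<lfloor>c / l\<rfloor>\<close>, separation of the orbit allows at most one visit in time \<open>w\<close>.\<close>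

lemma visits_apriori:
  assumes l: "0 < l" "l \<le> 1" and J: "\<And>u v. u \<in> J \<Longrightarrow> v \<in> J \<Longrightarrow> \<bar>u - v\<bar> \<le> l" and x: "x \<in> phase"
  shows "real (visits s J m x) \<le> 2 / c * l * real m + 1"
proof -
  define w where "w = nat \<lfloor>c / l\<rfloor>"
  have cl: "0 < c / l" using c_pos l by simp
  show ?thesis
  proof (cases "w = 0")
    case True
    then have "c / l < 1" using cl by (simp add: w_def)
    then have "1 \<le> 2 / c * l" using l c_pos by (simp add: field_simps)
    then have "1 * real m \<le> 2 / c * l * real m" by (intro mult_right_mono) auto
    then show ?thesis using visits_le[of s J m x] by linarith
  next
    case False
    moreover have "real w = of_int \<lfloor>c / l\<rfloor>" using cl by (simp add: w_def)
    ultimately have w: "1 \<le> w" "real w \<le> c / l" "c / l < real w + 1" by linarith+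
    have one: "real (visits s J w x) \<le> 1" if x: "x \<in> phase" for x
    proof -
      obtain t y where [simp]: "x = (t, y)" and y: "0 \<le> y" "y < 1" using x by (cases x) (auto simp: phase_def)
      have "i = j" if ij: "i < w" "j < w" "snd ((T ^^ i) x) \<in> J" "snd ((T ^^ j) x) \<in> J" for i j
      proof (rule ccontr)
        assume "i \<noteq> j"
        have w2: "2 \<le> w" using \<open>i \<noteq> j\<close> ij by linarith
        have "c / real (w - 1) \<le> \<bar>frac (y + real j * \<alpha>) - frac (y + real i * \<alpha>) + of_int 0\<bar>"
          using \<open>i \<noteq> j\<close> ij by (intro frac_orbit_sep) auto
        also have "\<dots> \<le> l" using J[OF ij(4,3)] y by (simp add: snd_T_pow)
        finally have "c / l \<le> real (w - 1)" using l w2 by (simp add: field_simps)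
        then show False using w w2 by (simp add: of_nat_diff)
      qed
      then have "card {i. i < w \<and> fst ((T ^^ i) x) = s \<and> snd ((T ^^ i) x) \<in> J} \<le> 1"
        by (auto simp: card_le_Suc0_iff_eq)
      then show ?thesis by (simp add: visits_def)
    qed
    have "real (visits s J m x) \<le> 1 * (real m / real w + 1)"
      by (rule visits_upper_blocks[OF w(1) one x])
    \<comment> \<open>Since \<open>w\<close> is at least 1, rounding down loses at most a factor 2;
      hence the constant \<open>2 / c\<close>.\<close>
    also have "real m / real w \<le> real m / (c / l / 2)"
      using w cl by (intro divide_left_mono mult_pos_pos) auto
    finally show ?thesis using l by (simp add: field_simps)
  qed
qed

text \<open>A new visit has to enter \<open>J\<close> through the end determined by the sign of
  \<open>h\<close>, so its old position lies in a strip of width \<open>\<bar>h\<bar>\<close> at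
  that end. By separation at most one of the first \<open>N\<close> orbit points does.\<close>

lemma visits_shift:
  assumes J: "is_interval J" and y: "0 \<le> y" "y < 1" and h: "\<bar>h\<bar> * real N < c"
    and nc: "\<And>i. i < N \<Longrightarrow> \<not> crosses h (y + real i * \<alpha>)"
  shows "visits s J N (t, y + h) \<le> visits s J N (t, y) + 1"
proof -
  define p where "p i = frac (y + real i * \<alpha>)" for i :: nat
  define D where "D = {i. i < N \<and> p i \<notin> J \<and> p i + h \<in> J}"
  have sh: "(T ^^ i) (t, y + h) = (fst ((T ^^ i) (t, y)), p i + h)" if "i < N" for i
    using that nc y by (subst T_pow_shift0) (auto simp: crosses_def snd_T_pow p_def)
  have "i = j" if "i \<in> D" "j \<in> D" for i j
  proof (rule ccontr)
    assume ij: "i \<noteq> j"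
    have *: False if ij: "i \<in> D" "j \<in> D" "i \<noteq> j" "p i \<le> p j" for i j
    proof -
      have "c / real N \<le> \<bar>p j - p i + of_int 0\<bar>"
        using ij unfolding p_def D_def by (intro frac_orbit_sep) auto
      moreover have "\<bar>h\<bar> < c / real N" using h ij(1) by (auto simp: D_def field_simps)
      ultimately have gt: "\<bar>h\<bar> < p j - p i" using ij by simp
      show False
      proof (cases "0 \<le> h")
        case True
        then have "p j \<in> J" using gt ij J interval_convexD[of J "p i + h" "p j + h" "p j"] by (auto simp: D_def)
        then show False using ij by (simp add: D_def)
      next
        case False
        then have "p i \<in> J" using gt ij J interval_convexD[of J "p i + h" "p j + h" "p i"] by (auto simp: D_def)
        then show False using ij by (simp add: D_def)
      qed
    qed
    show False using *[of i j] *[of j i] that ij by linarith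
  qed
  moreover have finD: "finite D" by (simp add: D_def)
  ultimately have "card D \<le> 1" by (simp add: card_le_Suc0_iff_eq)
  moreover have "visits s J N (t, y + h) \<le> card ({i. i < N \<and> fst ((T ^^ i) (t, y)) = s \<and> snd ((T ^^ i) (t, y)) \<in> J} \<union> D)"
    unfolding visits_def using y by (intro card_mono) (auto simp: sh D_def snd_T_pow p_def)
  ultimately show ?thesis
    using card_Un_le[of "{i. i < N \<and> fst ((T ^^ i) (t, y)) = s \<and> snd ((T ^^ i) (t, y)) \<in> J}" D]
    unfolding visits_def by linarith
qed

text \<open>When the orbit of \<open>x\<close> meets a short segment next to \<open>x0\<close> on
  the same vertical edge, the window at \<open>x0\<close> is reproduced up to one additional visit.
  The segment must avoid vertices for \<open>N\<close> steps, which holds on at least one side of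
  \<open>x0\<close>. Its length \<open>c / (4 * N)\<close> makes the hitting time proportional to
  \<open>N\<close>.\<close>

lemma visits_recurrence:
  obtains K :: nat where "2 \<le> K"
    "\<And>s J N x0 x. is_interval J \<Longrightarrow> 1 \<le> N \<Longrightarrow> x0 \<in> phase \<Longrightarrow> x \<in> phase \<Longrightarrow>
      \<exists>i. i + N \<le> K * N \<and> visits s J N ((T ^^ i) x) \<le> visits s J N x0 + 1"
proof -
  obtain K where K: "1 \<le> K" and hit: "\<And>s w (r::real) t z. s \<in> S \<Longrightarrow> 0 < r \<Longrightarrow> 0 \<le> w - r \<Longrightarrow> w + r \<le> 1 \<Longrightarrow>
      t \<in> S \<Longrightarrow> 0 \<le> z \<Longrightarrow> z < 1 \<Longrightarrow>
      \<exists>i. real i \<le> real K / r \<and> fst ((T ^^ i) (t, z)) = s \<and> \<bar>snd ((T ^^ i) (t, z)) - w\<bar> \<le> r"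
    using hitting_time by blast
  define K2 where "K2 = nat \<lceil>8 * real K / c\<rceil>"
  have K2: "8 * real K / c \<le> real K2" unfolding K2_def by (rule real_nat_ceiling_ge)
  have "0 < 8 * real K / c" using K c_pos by simp
  then have K21: "1 \<le> K2" using K2 by linarith
  show ?thesis
  \<comment> \<open>The extra 1 leaves room for the window itself.\<close>
  proof (rule that[of "K2 + 1"])
    show "2 \<le> K2 + 1" using K21 by simp
    fix s :: 'a and J :: "real set" and N :: nat and x0 x :: "'a \<times> real"
    assume J: "is_interval J" and N: "1 \<le> N" and x0: "x0 \<in> phase" and x: "x \<in> phase"
    obtain t y where x0e: "x0 = (t, y)" and t: "t \<in> S" and y: "0 \<le> y" "y < 1"
      using x0 by (cases x0) (auto simp: phase_def)
    obtain t' z where xe: "x = (t', z)" and t': "t' \<in> S" and z: "0 \<le> z" "z < 1"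
      using x by (cases x) (auto simp: phase_def)
    define \<eta> where "\<eta> = c / (4 * real N)"
    have \<eta>: "0 < \<eta>" using c_pos N by (simp add: \<eta>_def)
    have \<eta>N: "\<eta> * real N = c / 4" using N by (simp add: \<eta>_def)
    have "\<eta> * 1 \<le> \<eta> * real N" using \<eta> N by (intro mult_left_mono) auto
    then have \<eta>1: "\<eta> \<le> 1/8" using \<eta>N c_le_half by linarith
    \<comment> \<open>If both sides were blocked, two orbit heights would be within
      \<open>2 * \<eta> = c / (2 * N)\<close> of each other around an integer, against the
      separation \<open>c / N\<close>.\<close>
    have "\<exists>\<sigma>\<in>{1, -1}. \<forall>i<N. \<not> crosses (\<sigma> * \<eta>) (y + real i * \<alpha>)"
    proof (rule ccontr)
      assume "\<not> ?thesis"
      then obtain i j where i: "i < N" "crosses \<eta> (y + real i * \<alpha>)" and j: "j < N" "crosses (- \<eta>) (y + real j * \<alpha>)"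
        by auto
      have fi: "1 - \<eta> \<le> frac (y + real i * \<alpha>)" "frac (y + real i * \<alpha>) < 1"
        using i \<eta> frac_ge_0[of "y + real i * \<alpha>"] frac_lt_1[of "y + real i * \<alpha>"] unfolding crosses_def by linarith+
      have fj: "frac (y + real j * \<alpha>) < \<eta>" "0 \<le> frac (y + real j * \<alpha>)"
        using j \<eta> frac_lt_1[of "y + real j * \<alpha>"] by (auto simp: crosses_def)
      have "i \<noteq> j" using fi fj \<eta>1 by auto
      then have "c / real N \<le> \<bar>frac (y + real j * \<alpha>) - frac (y + real i * \<alpha>) + of_int 1\<bar>"
        using i j by (intro frac_orbit_sep) auto
      also have "\<dots> < 2 * \<eta>" using fi fj \<eta> unfolding of_int_1 by linarith
      finally show False using c_pos N by (simp add: \<eta>_def field_simps)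
    qed
    then obtain \<sigma> where \<sigma>: "\<sigma> = 1 \<or> \<sigma> = (-1::real)" and nc: "\<And>i. i < N \<Longrightarrow> \<not> crosses (\<sigma> * \<eta>) (y + real i * \<alpha>)" by blast
    have b: "0 \<le> y + \<sigma> * \<eta>" "y + \<sigma> * \<eta> < 1"
      using nc[of 0] N y by (auto simp: crosses_def frac_eq)
    define w where "w = y + \<sigma> * \<eta> / 2"
    have w: "0 \<le> w - \<eta> / 2" "w + \<eta> / 2 \<le> 1" using b \<sigma> y by (auto simp: w_def field_simps)
    obtain i where i: "real i \<le> real K / (\<eta> / 2)" "fst ((T ^^ i) (t', z)) = t" "\<bar>snd ((T ^^ i) (t', z)) - w\<bar> \<le> \<eta> / 2"
      using hit[OF t _ w t' z] \<eta> by auto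
    define h where "h = snd ((T ^^ i) (t', z)) - y"
    have h: "(0 \<le> h \<and> h \<le> \<sigma> * \<eta>) \<or> (\<sigma> * \<eta> \<le> h \<and> h \<le> 0)"
      using i(3) \<sigma> by (auto simp: h_def w_def abs_le_iff field_simps)
    have habs: "\<bar>h\<bar> \<le> \<eta>" using h \<sigma> \<eta> by auto
    have "\<bar>h\<bar> * real N \<le> \<eta> * real N" using habs by (intro mult_right_mono) auto
    then have hN: "\<bar>h\<bar> * real N < c" using \<eta>N c_pos by linarith
    have nch: "\<not> crosses h (y + real j * \<alpha>)" if "j < N" for j
      using nc[OF that] h frac_ge_0[of "y + real j * \<alpha>"] frac_lt_1[of "y + real j * \<alpha>"] by (auto simp: crosses_def)
    have "(T ^^ i) x = (t, y + h)" using i(2) by (simp add: xe h_def prod_eq_iff)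
    then have v: "visits s J N ((T ^^ i) x) \<le> visits s J N x0 + 1"
      using visits_shift[OF J y hN nch, of s t] by (simp add: x0e)
    have "real K / (\<eta> / 2) = 8 * real K / c * real N" using N c_pos by (simp add: \<eta>_def)
    also have "\<dots> \<le> real K2 * real N" using K2 by (intro mult_right_mono) auto
    finally have "real i \<le> real (K2 * N)" using i(1) by simp
    then have "i \<le> K2 * N" by (simp only: of_nat_le_iff)
    then show "\<exists>i. i + N \<le> (K2 + 1) * N \<and> visits s J N ((T ^^ i) x) \<le> visits s J N x0 + 1"
      using v by (intro exI[of _ i]) simp
  qed
qed

end

section \<open>Lebesgue measure of subintervals of the unit interval\<close>

lemma unit_interval_fmeasurable:
  assumes "is_interval (J :: real set)" "J \<subseteq> {0..1}"
  shows "J \<in> fmeasurable lborel"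
proof (rule fmeasurableI2[of "{0..1}"])
  show "{0..1::real} \<in> fmeasurable lborel" by (rule fmeasurableI) auto
  show "J \<in> sets lborel" using real_interval_borel_measurable[OF assms(1)] by simp
qed (use assms in auto)

lemma interval_diameter_le:
  assumes "is_interval (J :: real set)" "J \<subseteq> {0..1}" "u \<in> J" "v \<in> J"
  shows "\<bar>u - v\<bar> \<le> measure lborel J"
proof -
  have *: "b - a \<le> measure lborel J" if "a \<in> J" "b \<in> J" "a \<le> b" for a b
  proof -
    have "{a..b} \<subseteq> J" using interval_convexD[OF assms(1) that(1,2)] by auto
    then have "measure lborel {a..b} \<le> measure lborel J"
      by (intro measure_mono_fmeasurable unit_interval_fmeasurable assms) auto
    then show ?thesis using that by simp
  qed
  show ?thesis using *[OF assms(3,4)] *[OF assms(4,3)] by linarith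
qed

lemma unit_interval_measure_le_1:
  assumes "is_interval (J :: real set)" "J \<subseteq> {0..1}"
  shows "measure lborel J \<le> 1"
proof -
  have "measure lborel J \<le> measure lborel {0..1::real}"
    using assms by (intro measure_mono_fmeasurable fmeasurableD[OF unit_interval_fmeasurable]) (auto intro: fmeasurableI)
  then show ?thesis by simp
qed

section \<open>Contracting the gap between lower and upper visiting slopes\<close>

context skew_rotation
begin

text \<open>The slopes may vary with \<open>s\<close> and \<open>J\<close>, but \<open>C\<close> may
  not: this uniformity is what reaches intervals of length about \<open>1 / n\<close>. The bound
  \<open>\<kappa> <= 2 / c\<close> is carried along so that the next constant can be chosen before
  the interval.\<close>

definition slope_bounds :: "real \<Rightarrow> real \<Rightarrow> bool" where
  "slope_bounds d C \<longleftrightarrow> 0 \<le> C \<and> (\<forall>s\<in>S. \<forall>J. is_interval J \<and> J \<subseteq> {0..1} \<and> 0 < measure lborel J \<longrightarrow>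
     (\<exists>\<kappa> \<mu>. 0 \<le> \<mu> \<and> \<mu> \<le> \<kappa> \<and> \<kappa> \<le> 2 / c \<and> \<kappa> - \<mu> \<le> d \<and>
       (\<forall>m. \<forall>x\<in>phase. \<mu> * measure lborel J * real m - C \<le> real (visits s J m x) \<and>
          real (visits s J m x) \<le> \<kappa> * measure lborel J * real m + C)))"

lemma slope_bounds_initial: "slope_bounds (2 / c) 1"
  unfolding slope_bounds_def
proof (intro conjI ballI allI impI)
  fix s :: 'a and J :: "real set" assume J: "is_interval J \<and> J \<subseteq> {0..1} \<and> 0 < measure lborel J"
  show "\<exists>\<kappa> \<mu>. 0 \<le> \<mu> \<and> \<mu> \<le> \<kappa> \<and> \<kappa> \<le> 2 / c \<and> \<kappa> - \<mu> \<le> 2 / c \<and>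
       (\<forall>m. \<forall>x\<in>phase. \<mu> * measure lborel J * real m - 1 \<le> real (visits s J m x) \<and>
          real (visits s J m x) \<le> \<kappa> * measure lborel J * real m + 1)"
  proof (rule exI[of _ "2 / c"], rule exI[of _ "0::real"], intro conjI allI ballI)
    fix m :: nat and x :: "'a \<times> real" assume "x \<in> phase"
    then show "real (visits s J m x) \<le> 2 / c * measure lborel J * real m + 1"
      using J by (intro visits_apriori interval_diameter_le unit_interval_measure_le_1) auto
  qed (use c_pos in auto)
qed simp

text \<open>In the first case a window with at most the midpoint count occurs in each stretch of
  length \<open>K * N\<close> and saves half the gap on its length \<open>N\<close>; half of this
  saving pays for the additive errors, the rest lowers the upper slope by
  \<open>g / (4 * K)\<close>. In the second case the lower slope rises to the midpoint, which
  suffices since the contraction factor is at least \<open>1/2\<close>.\<close>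

lemma slope_bounds_contract:
  assumes K: "2 \<le> K"
    and rec: "\<And>s J N x0 x. is_interval J \<Longrightarrow> 1 \<le> N \<Longrightarrow> x0 \<in> phase \<Longrightarrow> x \<in> phase \<Longrightarrow>
      \<exists>i. i + N \<le> K * N \<and> visits s J N ((T ^^ i) x) \<le> visits s J N x0 + 1"
    and SB: "slope_bounds d C" and d: "0 < d"
  obtains C' where "slope_bounds ((1 - 1 / (4 * real K)) * d) C'"
proof -
  define \<theta> where "\<theta> = 1 - 1 / (4 * real K)"
  have "1 / (4 * real K) \<le> 1 / 8" using K by (intro divide_left_mono) auto
  then have \<theta>: "1/2 \<le> \<theta>" "\<theta> \<le> 1" using K by (auto simp: \<theta>_def)
  have \<theta>d: "0 < \<theta> * d" using \<theta> d by simp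
  have C0: "0 \<le> C" using SB by (simp add: slope_bounds_def)
  \<comment> \<open>\<open>N * l >= Q\<close> will make \<open>g / 4 * l * N\<close> at least
    \<open>2 * C + 1\<close> for every gap \<open>g > \<theta> * d\<close>.\<close>
  define Q where "Q = max 1 (4 * (1 + 2 * C) / (\<theta> * d))"
  have Q: "1 \<le> Q" "4 * (1 + 2 * C) \<le> Q * (\<theta> * d)"
    using \<theta>d by (auto simp: Q_def pos_divide_le_eq[symmetric])
  \<comment> \<open>Bounds the count of one whole block: slope at most \<open>2 / c\<close>, block
    length at most \<open>K * N\<close>, and \<open>N * l <= Q + 1\<close>.\<close>
  define C' where "C' = max C (real K * (2 / c) * (Q + 1))"
  have "0 < 2 / c" using c_pos by simp
  have C': "C \<le> C'" "real K * (2 / c) * (Q + 1) \<le> C'" "0 \<le> C'" using C0 by (auto simp: C'_def)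
  have "slope_bounds (\<theta> * d) C'"
    unfolding slope_bounds_def
  proof (intro conjI ballI allI impI C'(3))
    fix s :: 'a and J :: "real set" assume s: "s \<in> S" and J: "is_interval J \<and> J \<subseteq> {0..1} \<and> 0 < measure lborel J"
    define l where "l = measure lborel J"
    have l: "0 < l" "l \<le> 1" using J unit_interval_measure_le_1[of J] by (auto simp: l_def)
    obtain \<kappa> \<mu> where sl: "0 \<le> \<mu>" "\<mu> \<le> \<kappa>" "\<kappa> \<le> 2 / c" "\<kappa> - \<mu> \<le> d"
      and lo: "\<And>m x. x \<in> phase \<Longrightarrow> \<mu> * l * real m - C \<le> real (visits s J m x)"
      and up: "\<And>m x. x \<in> phase \<Longrightarrow> real (visits s J m x) \<le> \<kappa> * l * real m + C"
      using SB[unfolded slope_bounds_def, THEN conjunct2, THEN bspec, OF s, THEN spec, THEN mp, OF J]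
      unfolding l_def by blast
    show "\<exists>\<kappa> \<mu>. 0 \<le> \<mu> \<and> \<mu> \<le> \<kappa> \<and> \<kappa> \<le> 2 / c \<and> \<kappa> - \<mu> \<le> \<theta> * d \<and>
       (\<forall>m. \<forall>x\<in>phase. \<mu> * measure lborel J * real m - C' \<le> real (visits s J m x) \<and>
          real (visits s J m x) \<le> \<kappa> * measure lborel J * real m + C')"
      unfolding l_def[symmetric]
    proof (cases "\<kappa> - \<mu> \<le> \<theta> * d")
      case True
      have "\<mu> * l * real m - C' \<le> real (visits s J m x) \<and> real (visits s J m x) \<le> \<kappa> * l * real m + C'"
        if "x \<in> phase" for m x using lo[OF that, of m] up[OF that, of m] C' by linarith
      then show "\<exists>\<kappa> \<mu>. 0 \<le> \<mu> \<and> \<mu> \<le> \<kappa> \<and> \<kappa> \<le> 2 / c \<and> \<kappa> - \<mu> \<le> \<theta> * d \<and>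
       (\<forall>m. \<forall>x\<in>phase. \<mu> * l * real m - C' \<le> real (visits s J m x) \<and>
          real (visits s J m x) \<le> \<kappa> * l * real m + C')" using True sl by blast
    next
      case False
      define g where "g = \<kappa> - \<mu>"
      have g: "\<theta> * d < g" "0 < g" "g \<le> d" using False sl \<theta>d by (auto simp: g_def)
      define N where "N = nat \<lceil>Q / l\<rceil>"
      have Ql: "1 \<le> Q / l" using Q l by (simp add: field_simps)
      have "real N = of_int \<lceil>Q / l\<rceil>" using Ql by (simp add: N_def)
      then have Nl: "Q / l \<le> real N" "real N \<le> Q / l + 1" by linarith+
      then have "1 \<le> real N" using Ql by linarith
      then have N: "Q \<le> real N * l" "real N * l \<le> Q + 1" "1 \<le> N"
        using l Nl by (auto simp: field_simps)
      show "\<exists>\<kappa> \<mu>. 0 \<le> \<mu> \<and> \<mu> \<le> \<kappa> \<and> \<kappa> \<le> 2 / c \<and> \<kappa> - \<mu> \<le> \<theta> * d \<and>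
       (\<forall>m. \<forall>x\<in>phase. \<mu> * l * real m - C' \<le> real (visits s J m x) \<and>
          real (visits s J m x) \<le> \<kappa> * l * real m + C')"
      proof (cases "\<exists>x0\<in>phase. real (visits s J N x0) \<le> (\<kappa> + \<mu>) / 2 * l * real N")
        case True
        then obtain x0 where x0: "x0 \<in> phase" "real (visits s J N x0) \<le> (\<kappa> + \<mu>) / 2 * l * real N" by blast
        define \<kappa>' where "\<kappa>' = \<kappa> - g / (4 * real K)"
        define e where "e = g / (4 * real K)"
        have "g / (4 * real K) \<le> g / 1" using K g by (intro divide_left_mono) auto
        then have e: "0 \<le> e" "e \<le> g" using g by (auto simp: e_def)
        have "\<kappa>' = \<kappa> - e" by (simp add: \<kappa>'_def e_def)
        then have \<kappa>': "\<mu> \<le> \<kappa>'" "\<kappa>' \<le> 2 / c" "\<kappa>' \<le> \<kappa>" using sl e unfolding g_def by linarith+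
        have gap: "\<kappa>' - \<mu> \<le> \<theta> * d"
        proof -
          have "\<kappa>' - \<mu> = \<theta> * g" by (simp add: \<kappa>'_def \<theta>_def g_def algebra_simps)
          then show ?thesis using \<theta> g by simp
        qed
        define B where "B = \<kappa>' * l * real (K * N)"
        have gN: "2 * C + 1 \<le> g / 4 * l * real N"
        proof -
          have "Q * (\<theta> * d) \<le> (real N * l) * g"
            using N g Q \<theta>d by (intro mult_mono) auto
          then show ?thesis using Q(2) by (simp add: algebra_simps)
        qed
        have vB: "real (visits s J (K * N) x) \<le> B" if x: "x \<in> phase" for x
        proof -
          obtain i where i: "i + N \<le> K * N" "visits s J N ((T ^^ i) x) \<le> visits s J N x0 + 1"
            using rec[OF _ N(3) x0(1) x, of J s] J by blast
          define r where "r = K * N - (i + N)"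
          have KN: "K * N = i + (N + r)" using i by (simp add: r_def)
          then have KNr: "real K * real N = real i + (real N + real r)" by (metis of_nat_add of_nat_mult)
          \<comment> \<open>Before and after the poor window the old upper bound is used, each time
            with error \<open>C\<close>; with the one extra visit from recurrence this makes
            \<open>2 * C + 1\<close>.\<close>
          have "real (visits s J (K * N) x) = real (visits s J i x) + (real (visits s J N ((T ^^ i) x)) +
             real (visits s J r ((T ^^ N) ((T ^^ i) x))))"
            unfolding KN visits_add by simp
          also have "\<dots> \<le> (\<kappa> * l * real i + C) + (((\<kappa> + \<mu>) / 2 * l * real N + 1) + (\<kappa> * l * real r + C))"
            using i(2) x0(2) x by (intro add_mono up T_pow_phase) auto
          also have "\<dots> = \<kappa> * l * (real i + (real N + real r)) - g / 2 * l * real N + (2 * C + 1)"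
            by (simp add: g_def field_simps)
          also have "\<dots> \<le> \<kappa> * l * (real K * real N) - g / 4 * l * real N"
            using gN by (simp add: KNr)
          also have "\<dots> = B" using K by (simp add: B_def \<kappa>'_def field_simps)
          finally show ?thesis .
        qed
        have BC: "B \<le> C'"
        proof -
          have "B = real K * \<kappa>' * (real N * l)" by (simp add: B_def)
          also have "\<dots> \<le> real K * (2 / c) * (Q + 1)"
            using \<kappa>' sl N l c_pos by (intro mult_mono) auto
          finally show ?thesis using C' by linarith
        qed
        have "\<mu> * l * real m - C' \<le> real (visits s J m x) \<and> real (visits s J m x) \<le> \<kappa>' * l * real m + C'"
          if x: "x \<in> phase" for m x
        proof
          show "\<mu> * l * real m - C' \<le> real (visits s J m x)" using lo[OF x, of m] C' by linarith
          have "1 \<le> K * N" using K N by simp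
          from visits_upper_blocks[OF this vB x, of m]
          have "real (visits s J m x) \<le> B * (real m / real (K * N) + 1)" .
          also have "\<dots> = \<kappa>' * l * real m + B" using K N by (simp add: B_def field_simps)
          finally show "real (visits s J m x) \<le> \<kappa>' * l * real m + C'" using BC by linarith
        qed
        then show ?thesis using \<kappa>' gap sl by blast
      next
        case False
        define \<mu>' where "\<mu>' = (\<kappa> + \<mu>) / 2"
        have \<mu>': "0 \<le> \<mu>'" "\<mu>' \<le> \<kappa>" using sl by (auto simp: \<mu>'_def)
        have gap: "\<kappa> - \<mu>' \<le> \<theta> * d"
        proof -
          have "\<kappa> - \<mu>' = 1/2 * g" by (simp add: \<mu>'_def g_def field_simps)
          also have "\<dots> \<le> \<theta> * d" using \<theta> g by (intro mult_mono) auto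
          finally show ?thesis .
        qed
        define B where "B = \<mu>' * l * real N"
        have vB: "B \<le> real (visits s J N x)" if "x \<in> phase" for x
          using False that by (force simp: B_def \<mu>'_def)
        have B0: "0 \<le> B" using \<mu>' l by (simp add: B_def)
        have BC: "B \<le> C'"
        proof -
          have "B = 1 * \<mu>' * (real N * l)" by (simp add: B_def)
          also have "\<dots> \<le> real K * (2 / c) * (Q + 1)"
            using \<mu>' sl N l K c_pos by (intro mult_mono) auto
          finally show ?thesis using C' by linarith
        qed
        have "\<mu>' * l * real m - C' \<le> real (visits s J m x) \<and> real (visits s J m x) \<le> \<kappa> * l * real m + C'"
          if x: "x \<in> phase" for m x
        proof
          show "real (visits s J m x) \<le> \<kappa> * l * real m + C'" using up[OF x, of m] C' by linarith
          have "B * (real m / real N - 1) = \<mu>' * l * real m - B" using N by (simp add: B_def field_simps)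
          then show "\<mu>' * l * real m - C' \<le> real (visits s J m x)"
            using visits_lower_blocks[OF N(3) B0 vB x, of m] BC by linarith
        qed
        then show ?thesis using \<mu>' gap sl by blast
      qed
    qed
  qed
  then show ?thesis using that by (simp add: \<theta>_def)
qed

lemma slope_bounds_small:
  assumes "0 < d"
  obtains C where "slope_bounds d C"
proof -
  obtain K :: nat where K: "2 \<le> K"
    and rec: "\<And>s J N x0 x. is_interval J \<Longrightarrow> 1 \<le> N \<Longrightarrow> x0 \<in> phase \<Longrightarrow> x \<in> phase \<Longrightarrow>
      \<exists>i. i + N \<le> K * N \<and> visits s J N ((T ^^ i) x) \<le> visits s J N x0 + 1"
    using visits_recurrence by blast
  define \<theta> where "\<theta> = 1 - 1 / (4 * real K)"
  have \<theta>: "0 < \<theta>" "\<theta> < 1" using K by (auto simp: \<theta>_def)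
  have "\<exists>C. slope_bounds (\<theta> ^ n * (2 / c)) C" for n
  proof (induction n)
    case 0 then show ?case using slope_bounds_initial by auto
  next
    case (Suc n)
    then obtain C where C: "slope_bounds (\<theta> ^ n * (2 / c)) C" by blast
    have "0 < \<theta> ^ n * (2 / c)" using \<theta> c_pos by simp
    from slope_bounds_contract[OF K rec C this] show ?case
      unfolding \<theta>_def[symmetric] power_Suc mult.assoc by blast
  qed
  moreover obtain n where "\<theta> ^ n < d / (2 / c)"
    using real_arch_pow_inv[of "d / (2 / c)" \<theta>] assms c_pos \<theta> by auto
  then have "\<theta> ^ n * (2 / c) \<le> d" using c_pos by (simp add: field_simps)
  ultimately obtain C where "slope_bounds (\<theta> ^ n * (2 / c)) C" by blast
  then have "slope_bounds d C"
    using \<open>\<theta> ^ n * (2 / c) \<le> d\<close> unfolding slope_bounds_def by (meson order_trans)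
  then show ?thesis using that by blast
qed

text \<open>The rotation is a translation on each of two intervals, and over each of them the
  squares undergo one fixed permutation. Reindexing by these permutations requires the sum over all
  squares; a single \<open>P t\<close> need not have the measure of \<open>B t\<close>.\<close>

lemma measure_preimage_T:
  fixes B :: "'a \<Rightarrow> real set"
  assumes B: "\<And>t. t \<in> S \<Longrightarrow> B t \<in> lmeasurable" "\<And>t. t \<in> S \<Longrightarrow> B t \<subseteq> {0..<1}"
  defines "P \<equiv> \<lambda>t. {y \<in> {0..<1}. frac (y + \<alpha>) \<in> B (step_perm y t)}"
  shows "\<And>t. t \<in> S \<Longrightarrow> P t \<in> lmeasurable" "(\<Sum>t\<in>S. measure lebesgue (P t)) = (\<Sum>t\<in>S. measure lebesgue (B t))"
proof -
  define k where "k = \<lfloor>\<alpha>\<rfloor>"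
  define \<beta> where "\<beta> = frac \<alpha>"
  have \<beta>: "0 \<le> \<beta>" "\<beta> < 1" by (auto simp: \<beta>_def frac_lt_1)
  have \<alpha>: "\<alpha> = of_int k + \<beta>" by (simp add: \<beta>_def k_def frac_def)
  define p0 p1 where "p0 = (\<lambda>t. R (zpow A k t))" and "p1 = (\<lambda>t. R (zpow A (k + 1) t))"
  have bij: "bij_betw p0 S S" "bij_betw p1 S S"
    using bij_betw_trans[OF bij_betw_zpow[OF bijA AS] bijR] by (simp_all add: p0_def p1_def comp_def)
  have fl: "\<lfloor>y + \<alpha>\<rfloor> = (if y < 1 - \<beta> then k else k + 1)" if "0 \<le> y" "y < 1" for y
    using that \<beta> \<alpha> by (auto intro!: floor_unique)
  define U V where "U = (\<lambda>t. B (p0 t) \<inter> {\<beta>..<1})" and "V = (\<lambda>t. B (p1 t) \<inter> {0..<\<beta>})"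
  have Pt: "P t = (+) (- \<beta>) ` U t \<union> (+) (1 - \<beta>) ` V t" if t: "t \<in> S" for t
  proof (intro equalityI subsetI)
    fix y assume y: "y \<in> P t"
    then have y01: "0 \<le> y" "y < 1" and yB: "frac (y + \<alpha>) \<in> B (step_perm y t)" by (auto simp: P_def)
    show "y \<in> (+) (- \<beta>) ` U t \<union> (+) (1 - \<beta>) ` V t"
    proof (cases "y < 1 - \<beta>")
      case True
      have "frac (y + \<alpha>) = y + \<beta>" using fl[OF y01] True \<alpha> by (simp add: frac_def)
      moreover have "step_perm y t = p0 t" using fl[OF y01] True by (simp add: step_perm_def p0_def)
      ultimately have "y + \<beta> \<in> U t" using yB y01 True by (auto simp: U_def)
      then show ?thesis by (intro UnI1 image_eqI[of _ _ "y + \<beta>"]) auto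
    next
      case False
      have "frac (y + \<alpha>) = y + \<beta> - 1" using fl[OF y01] False \<alpha> by (simp add: frac_def)
      moreover have "step_perm y t = p1 t" using fl[OF y01] False by (simp add: step_perm_def p1_def)
      ultimately have "y + \<beta> - 1 \<in> V t" using yB y01 False by (auto simp: V_def)
      then show ?thesis by (intro UnI2 image_eqI[of _ _ "y + \<beta> - 1"]) auto
    qed
  next
    fix y assume "y \<in> (+) (- \<beta>) ` U t \<union> (+) (1 - \<beta>) ` V t"
    then show "y \<in> P t"
    proof
      assume "y \<in> (+) (- \<beta>) ` U t"
      then have y: "y + \<beta> \<in> U t" by auto
      then have y01: "0 \<le> y" "y < 1 - \<beta>" "y < 1" using \<beta> by (auto simp: U_def)
      have "frac (y + \<alpha>) = y + \<beta>" using fl[OF y01(1,3)] y01(2) \<alpha> by (simp add: frac_def)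
      moreover have "step_perm y t = p0 t" using fl[OF y01(1,3)] y01(2) by (simp add: step_perm_def p0_def)
      ultimately show ?thesis using y y01 by (auto simp: P_def U_def)
    next
      assume "y \<in> (+) (1 - \<beta>) ` V t"
      then have y: "y + \<beta> - 1 \<in> V t" by auto
      then have y01: "0 \<le> y" "\<not> y < 1 - \<beta>" "y < 1" using \<beta> by (auto simp: V_def)
      have "frac (y + \<alpha>) = y + \<beta> - 1" using fl[OF y01(1,3)] y01(2) \<alpha> by (simp add: frac_def)
      moreover have "step_perm y t = p1 t" using fl[OF y01(1,3)] y01(2) by (simp add: step_perm_def p1_def)
      ultimately show ?thesis using y y01 by (auto simp: P_def V_def)
    qed
  qed
  have inS: "p0 t \<in> S" "p1 t \<in> S" if "t \<in> S" for t using bij that by (auto simp: bij_betw_def)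
  have [intro]: "{\<beta>..<1} \<in> lmeasurable" "{0..<\<beta>} \<in> lmeasurable"
    by (auto intro: bounded_set_imp_lmeasurable)
  have mU: "U t \<in> lmeasurable" "V t \<in> lmeasurable" if "t \<in> S" for t
    using B(1)[OF inS(1)[OF that]] B(1)[OF inS(2)[OF that]] unfolding U_def V_def by (auto intro: fmeasurable.Int)
  have mT: "(+) (- \<beta>) ` U t \<in> lmeasurable" "(+) (1 - \<beta>) ` V t \<in> lmeasurable" if "t \<in> S" for t
    using mU[OF that, THEN measurable_translation] by blast+
  show "P t \<in> lmeasurable" if "t \<in> S" for t
    unfolding Pt[OF that] using mT[OF that] by (rule fmeasurable.Un)
  have mP: "measure lebesgue (P t) = measure lebesgue (U t) + measure lebesgue (V t)" if t: "t \<in> S" for t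
  proof -
    have "(+) (1 - \<beta>) ` V t - (+) (- \<beta>) ` U t = (+) (1 - \<beta>) ` V t"
      by (auto simp: U_def V_def)
    then have "measure lebesgue (P t) = measure lebesgue ((+) (- \<beta>) ` U t) + measure lebesgue ((+) (1 - \<beta>) ` V t)"
      using measure_Un2[OF mT[OF t]] by (simp add: Pt[OF t])
    then show ?thesis by (simp only: measure_translation)
  qed
  have mB: "measure lebesgue (B t) = measure lebesgue (B t \<inter> {\<beta>..<1}) + measure lebesgue (B t \<inter> {0..<\<beta>})" if t: "t \<in> S" for t
  proof -
    have "B t = (B t \<inter> {\<beta>..<1}) \<union> (B t \<inter> {0..<\<beta>})" using B(2)[OF t] by auto
    moreover have "(B t \<inter> {0..<\<beta>}) - (B t \<inter> {\<beta>..<1}) = B t \<inter> {0..<\<beta>}" by auto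
    moreover have "B t \<inter> {\<beta>..<1} \<in> lmeasurable" "B t \<inter> {0..<\<beta>} \<in> lmeasurable" 
      using B(1)[OF t] by (auto intro: fmeasurable.Int)
    ultimately show ?thesis using measure_Un2[of "B t \<inter> {\<beta>..<1}" lebesgue "B t \<inter> {0..<\<beta>}"] by simp
  qed
  have "(\<Sum>t\<in>S. measure lebesgue (P t)) = (\<Sum>t\<in>S. measure lebesgue (U t)) + (\<Sum>t\<in>S. measure lebesgue (V t))"
    by (simp add: mP sum.distrib)
  also have "(\<Sum>t\<in>S. measure lebesgue (U t)) = (\<Sum>t\<in>S. measure lebesgue (B t \<inter> {\<beta>..<1}))"
    unfolding U_def by (rule sum.reindex_bij_betw[OF bij(1)])
  also have "(\<Sum>t\<in>S. measure lebesgue (V t)) = (\<Sum>t\<in>S. measure lebesgue (B t \<inter> {0..<\<beta>}))"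
    unfolding V_def by (rule sum.reindex_bij_betw[OF bij(2)])
  also have "(\<Sum>t\<in>S. measure lebesgue (B t \<inter> {\<beta>..<1})) + (\<Sum>t\<in>S. measure lebesgue (B t \<inter> {0..<\<beta>})) = (\<Sum>t\<in>S. measure lebesgue (B t))"
    by (simp add: mB sum.distrib)
  finally show "(\<Sum>t\<in>S. measure lebesgue (P t)) = (\<Sum>t\<in>S. measure lebesgue (B t))" .
qed

definition visit_region :: "'a \<Rightarrow> real set \<Rightarrow> nat \<Rightarrow> 'a \<Rightarrow> real set" where
  "visit_region s J i t = {y \<in> {0..<1}. fst ((T ^^ i) (t, y)) = s \<and> snd ((T ^^ i) (t, y)) \<in> J}"

lemma visit_region_measure:
  assumes J: "is_interval J" "J \<subseteq> {0..1}" and s: "s \<in> S"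
  shows "t \<in> S \<Longrightarrow> visit_region s J i t \<in> lmeasurable"
    "(\<Sum>t\<in>S. measure lebesgue (visit_region s J i t)) = measure lborel J"
proof -
  have "(\<forall>t\<in>S. visit_region s J i t \<in> lmeasurable) \<and>
    (\<Sum>t\<in>S. measure lebesgue (visit_region s J i t)) = measure lborel J"
  proof (induction i)
    case 0
    have e: "visit_region s J 0 t = (if t = s then J \<inter> {0..<1} else {})" for t
      by (auto simp: visit_region_def)
    have Jb: "J \<in> sets borel" by (rule real_interval_borel_measurable[OF J(1)])
    have Jf: "J \<in> fmeasurable lborel" using J by (rule unit_interval_fmeasurable)
    have m: "J \<inter> {0..<1} \<in> lmeasurable"
      using Jb by (intro bounded_set_imp_lmeasurable) (auto intro: bounded_subset[of "{0..1}"])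
    have "measure lebesgue (J \<inter> {0..<1}) = measure lborel (J \<inter> {0..<1})" using Jb by simp
    \<comment> \<open>\<open>J\<close> may contain height 1, which no orbit point has; a single
      point is null.\<close>
    also have "\<dots> = measure lborel J"
    proof -
      have "J \<inter> {0..<1} \<in> fmeasurable lborel"
        using Jb by (intro fmeasurableI2[OF Jf]) auto
      moreover have "J \<inter> {1} \<in> fmeasurable lborel" using Jb by (intro fmeasurableI2[OF Jf]) auto
      moreover have "J = (J \<inter> {0..<1}) \<union> (J \<inter> {1})" using J(2) by auto
      moreover have "(J \<inter> {1}) - (J \<inter> {0..<1}) = J \<inter> {1}" by auto
      moreover have "measure lborel (J \<inter> {1}) = 0" by (cases "1 \<in> J") auto
      ultimately show ?thesis using measure_Un2[of "J \<inter> {0..<1}" lborel "J \<inter> {1}"] by simp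
    qed
    finally have "measure lebesgue (J \<inter> {0..<1}) = measure lborel J" .
    moreover have "(\<Sum>t\<in>S. measure lebesgue (visit_region s J 0 t)) = (\<Sum>t\<in>S. if t = s then measure lebesgue (J \<inter> {0..<1}) else 0)"
      by (intro sum.cong) (auto simp: e)
    ultimately show ?case using m s finS by (simp add: e)
  next
    case (Suc i)
    have e: "visit_region s J (Suc i) t = {y \<in> {0..<1}. frac (y + \<alpha>) \<in> visit_region s J i (step_perm y t)}" for t
      by (auto simp: visit_region_def funpow_Suc_right T_eq frac_lt_1 simp del: funpow.simps)
    have sub: "visit_region s J i t \<subseteq> {0..<1}" for t by (auto simp: visit_region_def)
    have "\<And>t. t \<in> S \<Longrightarrow> visit_region s J i t \<in> lmeasurable" using Suc by blast
    from measure_preimage_T[of "visit_region s J i", OF this sub] Suc show ?case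
      unfolding e by simp
  qed
  then show "t \<in> S \<Longrightarrow> visit_region s J i t \<in> lmeasurable"
    "(\<Sum>t\<in>S. measure lebesgue (visit_region s J i t)) = measure lborel J" by auto
qed

text \<open>\<open>f t\<close> is the integral over all heights of the number of visits starting in
  square \<open>t\<close>. Stating just its sum and its monotonicity lets pointwise bounds be
  averaged without further integration.\<close>

lemma visits_integral:
  assumes J: "is_interval J" "J \<subseteq> {0..1}" and s: "s \<in> S"
  obtains f :: "'a \<Rightarrow> real" where
    "(\<Sum>t\<in>S. f t) = real m * measure lborel J"
    "\<And>t U. t \<in> S \<Longrightarrow> (\<And>y. 0 \<le> y \<Longrightarrow> y < 1 \<Longrightarrow> real (visits s J m (t, y)) \<le> U) \<Longrightarrow> f t \<le> U"
    "\<And>t U. t \<in> S \<Longrightarrow> (\<And>y. 0 \<le> y \<Longrightarrow> y < 1 \<Longrightarrow> U \<le> real (visits s J m (t, y))) \<Longrightarrow> U \<le> f t"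
proof
  define f where "f t = (\<Sum>i<m. measure lebesgue (visit_region s J i t))" for t
  show "(\<Sum>t\<in>S. f t) = real m * measure lborel J"
    unfolding f_def by (subst sum.swap) (simp add: visit_region_measure(2)[OF J s])
  fix t :: 'a and U :: real assume t: "t \<in> S"
  let ?g = "\<lambda>y. \<Sum>i<m. indicator (visit_region s J i t) y :: real"
  have int: "integrable lebesgue (indicator (visit_region s J i t) :: real \<Rightarrow> real)" for i
    using visit_region_measure(1)[OF J s t, of i] by (auto simp: fmeasurable_def integrable_indicator_iff)
  have f: "f t = integral\<^sup>L lebesgue ?g"
  proof -
    have "integral\<^sup>L lebesgue ?g = (\<Sum>i<m. integral\<^sup>L lebesgue (indicator (visit_region s J i t) :: real \<Rightarrow> real))"
      by (rule Bochner_Integration.integral_sum) (rule int)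
    also have "\<dots> = f t" using visit_region_measure(1)[OF J s t]
      by (auto simp: f_def fmeasurable_def intro!: sum.cong)
    finally show ?thesis by simp
  qed
  have ig: "integrable lebesgue ?g" by (intro Bochner_Integration.integrable_sum int)
  have g1: "?g y = real (visits s J m (t, y))" if "0 \<le> y" "y < 1" for y
    unfolding visits_sum using that by (intro sum.cong) (auto simp: visit_region_def indicator_def)
  have g0: "?g y = 0" if "\<not> (0 \<le> y \<and> y < 1)" for y
    using that by (intro sum.neutral) (auto simp: visit_region_def indicator_def)
  have iU: "integrable lebesgue (\<lambda>y. U * indicator {0..<1::real} y)"
    using integrable_mult_right[of U lebesgue "indicator {0..<1::real} :: real \<Rightarrow> real"]
    by (simp add: integrable_indicator_iff)
  have U: "integral\<^sup>L lebesgue (\<lambda>y. U * indicator {0..<1::real} y) = U" by simp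
  show "f t \<le> U" if "\<And>y. 0 \<le> y \<Longrightarrow> y < 1 \<Longrightarrow> real (visits s J m (t, y)) \<le> U"
  proof -
    have "integral\<^sup>L lebesgue ?g \<le> integral\<^sup>L lebesgue (\<lambda>y. U * indicator {0..<1::real} y)"
    proof (rule integral_mono[OF ig iU])
      fix y show "?g y \<le> U * indicator {0..<1} y"
        using g1[of y] g0[of y] that[of y] by (cases "0 \<le> y \<and> y < 1") auto
    qed
    then show ?thesis using f U by simp
  qed
  show "U \<le> f t" if "\<And>y. 0 \<le> y \<Longrightarrow> y < 1 \<Longrightarrow> U \<le> real (visits s J m (t, y))"
  proof -
    have "integral\<^sup>L lebesgue (\<lambda>y. U * indicator {0..<1::real} y) \<le> integral\<^sup>L lebesgue ?g"
    proof (rule integral_mono[OF iU ig])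
      fix y show "U * indicator {0..<1} y \<le> ?g y"
        using g1[of y] g0[of y] that[of y] by (cases "0 \<le> y \<and> y < 1") auto
    qed
    then show ?thesis using f U by simp
  qed
qed

lemma slope_le_mean:
  fixes a b C :: real
  assumes "\<And>m :: nat. a * real m \<le> b * real m + C"
  shows "a \<le> b"
proof (rule ccontr)
  assume "\<not> a \<le> b"
  then obtain m :: nat where "C < real m * (a - b)"
    using reals_Archimedean3[of "a - b"] by auto
  then show False using assms[of m] by (simp add: algebra_simps)
qed

lemma visits_uniform:
  assumes "0 < d"
  obtains C where "0 \<le> C" "\<And>s (J :: real set) m x. s \<in> S \<Longrightarrow> is_interval J \<Longrightarrow> J \<subseteq> {0..1} \<Longrightarrow> 0 < measure lborel J \<Longrightarrow> x \<in> phase \<Longrightarrow>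
    \<bar>real (visits s J m x) - real m * measure lborel J / real (card S)\<bar> \<le> d * measure lborel J * real m + C"
proof -
  obtain C where C: "slope_bounds d C" using slope_bounds_small[OF assms] by blast
  show ?thesis
  proof
    show "0 \<le> C" using C by (simp add: slope_bounds_def)
    fix s :: 'a and J :: "real set" and m :: nat and x :: "'a \<times> real"
    assume s: "s \<in> S" and J: "is_interval J" "J \<subseteq> {0..1}" and l0: "0 < measure lborel J" and x: "x \<in> phase"
    define l where "l = measure lborel J"
    define b where "b = real (card S)"
    have b: "0 < b" using card_pos by (simp add: b_def)
    have JJ: "is_interval J \<and> J \<subseteq> {0..1} \<and> 0 < measure lborel J" using J l0 by blast
    obtain \<kappa> \<mu> where sl: "0 \<le> \<mu>" "\<mu> \<le> \<kappa>" "\<kappa> \<le> 2 / c" "\<kappa> - \<mu> \<le> d"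
      and lo: "\<And>m x. x \<in> phase \<Longrightarrow> \<mu> * l * real m - C \<le> real (visits s J m x)"
      and up: "\<And>m x. x \<in> phase \<Longrightarrow> real (visits s J m x) \<le> \<kappa> * l * real m + C"
      using C[unfolded slope_bounds_def, THEN conjunct2, THEN bspec, OF s, THEN spec, THEN mp, OF JJ]
      unfolding l_def by blast
    have mean: "l * real m \<le> b * (\<kappa> * l * real m + C)" "b * (\<mu> * l * real m - C) \<le> l * real m" for m
    proof -
      obtain f where f: "(\<Sum>t\<in>S. f t) = real m * l"
        "\<And>t U. t \<in> S \<Longrightarrow> (\<And>y. 0 \<le> y \<Longrightarrow> y < 1 \<Longrightarrow> real (visits s J m (t, y)) \<le> U) \<Longrightarrow> f t \<le> U"
        "\<And>t U. t \<in> S \<Longrightarrow> (\<And>y. 0 \<le> y \<Longrightarrow> y < 1 \<Longrightarrow> U \<le> real (visits s J m (t, y))) \<Longrightarrow> U \<le> f t"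
        using visits_integral[OF J s, of m] unfolding l_def by blast
      have "f t \<le> \<kappa> * l * real m + C" "\<mu> * l * real m - C \<le> f t" if "t \<in> S" for t
        using that by (auto intro!: f lo up simp: phase_def)
      then have "(\<Sum>t\<in>S. f t) \<le> b * (\<kappa> * l * real m + C)" "b * (\<mu> * l * real m - C) \<le> (\<Sum>t\<in>S. f t)"
        unfolding b_def by (auto intro!: sum_bounded_above sum_bounded_below)
      then show "l * real m \<le> b * (\<kappa> * l * real m + C)" "b * (\<mu> * l * real m - C) \<le> l * real m"
        using f(1) by (simp_all add: mult.commute)
    qed
    \<comment> \<open>\<open>mean\<close> holds for every \<open>m\<close>, so letting
      \<open>m\<close> grow removes \<open>C\<close>; this places \<open>1 / b\<close> between the
      two slopes.\<close>
    have "l \<le> b * \<kappa> * l" by (rule slope_le_mean[of _ _ "b * C"]) (use mean(1) in \<open>simp add: algebra_simps\<close>)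
    then have "1 / b * l \<le> \<kappa> * l" using b by (simp add: field_simps)
    have "b * \<mu> * l \<le> l" by (rule slope_le_mean[of _ _ "b * C"]) (use mean(2) in \<open>simp add: algebra_simps\<close>)
    then have "\<mu> * l \<le> 1 / b * l" using b by (simp add: field_simps)
    have "(\<kappa> - \<mu>) * l \<le> d * l" using sl l0 by (intro mult_right_mono) (auto simp: l_def)
    then have ld: "\<kappa> * l \<le> 1 / b * l + d * l" "1 / b * l - d * l \<le> \<mu> * l"
      using \<open>1 / b * l \<le> \<kappa> * l\<close> \<open>\<mu> * l \<le> 1 / b * l\<close> by (auto simp: algebra_simps)
    have "\<kappa> * l * real m \<le> (1 / b * l + d * l) * real m" "(1 / b * l - d * l) * real m \<le> \<mu> * l * real m"
      using ld by (auto intro!: mult_right_mono)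
    then have "\<bar>real (visits s J m x) - (1 / b * l) * real m\<bar> \<le> d * l * real m + C"
      using lo[OF x, of m] up[OF x, of m] unfolding distrib_right left_diff_distrib abs_le_iff by linarith
    then show "\<bar>real (visits s J m x) - real m * measure lborel J / real (card S)\<bar> \<le> d * measure lborel J * real m + C"
      by (simp add: l_def b_def mult.commute)
  qed
qed

end

subsection \<open>Coding geodesics\<close>

lemma locally_constant_connected:
  fixes f :: "real \<Rightarrow> 'b"
  assumes "connected D" "\<And>t. t \<in> D \<Longrightarrow> \<exists>\<delta>>0. \<forall>t'\<in>D. \<bar>t' - t\<bar> < \<delta> \<longrightarrow> f t' = f t" "a \<in> D" "b \<in> D"
  shows "f a = f b"
proof -
  have "f constant_on D"
  proof (rule locally_constant_imp_constant[OF assms(1)])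
    fix t assume t: "t \<in> D"
    then obtain \<delta> where "\<delta> > 0" "\<forall>t'\<in>D. \<bar>t' - t\<bar> < \<delta> \<longrightarrow> f t' = f t" using assms(2) by blast
    then have \<delta>: "f x = f t" if "x \<in> D" "\<bar>x - t\<bar> < \<delta>" for x using that by blast
    have "\<forall>x\<in>D \<inter> ball t \<delta>. f x = f t"
      by (intro ballI \<delta>) (auto simp: dist_real_def abs_minus_commute)
    moreover have "t \<in> D \<inter> ball t \<delta>" using t \<open>\<delta> > 0\<close> by simp
    ultimately show "\<exists>T. openin (top_of_set D) T \<and> t \<in> T \<and> (\<forall>x\<in>T. f x = f t)"
      using openin_open_Int[OF open_ball] by blast
  qed
  then show ?thesis using assms(3,4) by (metis constant_on_def)
qed

section \<open>Coordinates that are well defined on the glued surface\<close>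

lemma surface_point_self: "p \<in> surface_point P p"
  by (simp add: surface_point_def)

lemma surface_point_eqI: "edge_glue P p q \<Longrightarrow> surface_point P p = surface_point P q"
  unfolding surface_point_def by (auto intro: equivclp_trans equivclp_sym)

lemma edge_invariant:
  assumes inv: "\<And>p q. edge_glue P p q \<Longrightarrow> f p = f q" and "q \<in> surface_point P p"
  shows "f q = f p"
proof -
  have "equivclp (edge_glue P) p q" using assms(2) by (simp add: surface_point_def)
  then show ?thesis by (induction rule: equivclp_induct) (auto dest: inv)
qed

text \<open>Geodesics take classes as values, while coordinates are functions of representatives;
  the arbitrary choice is harmless for functions that respect \<open>edge_glue\<close>.\<close>

definition class_val :: "('b \<Rightarrow> 'c) \<Rightarrow> 'b set \<Rightarrow> 'c" where
  "class_val f X = f (SOME q. q \<in> X)"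

lemma class_val_surface_point:
  assumes "\<And>p q. edge_glue P p q \<Longrightarrow> f p = f q"
  shows "class_val f (surface_point P p) = f p"
  unfolding class_val_def
  by (rule edge_invariant[OF assms someI[of "\<lambda>q. q \<in> surface_point P p", OF surface_point_self]])

text \<open>Taking \<open>frac\<close> projects the surface to the unit torus, where opposite edges
  of a square coincide and a geodesic becomes a straight line.\<close>

definition torus_x :: "'a \<times> real \<times> real \<Rightarrow> real" where
  "torus_x p = frac (fst (snd p))"

definition torus_y :: "'a \<times> real \<times> real \<Rightarrow> real" where
  "torus_y p = frac (snd (snd p))"

lemma torus_x_invariant: "edge_glue P p q \<Longrightarrow> torus_x p = torus_x q"
  and torus_y_invariant: "edge_glue P p q \<Longrightarrow> torus_y p = torus_y q"
  by (auto elim!: edge_glue.cases simp: torus_x_def torus_y_def)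

text \<open>Away from the horizontal (resp. vertical) grid lines, a point of the surface has a canonical
  representative off the right (resp. top) edges.\<close>

definition chart_v :: "('a, 'm) polysquare_scheme \<Rightarrow> 'a \<times> real \<times> real \<Rightarrow> ('a \<times> real \<times> real) option" where
  "chart_v P = (\<lambda>(s, x, y). if 0 < y \<and> y < 1 then Some (if x = 1 then (right_of P s, 0, y) else (s, x, y)) else None)"

definition chart_h :: "('a, 'm) polysquare_scheme \<Rightarrow> 'a \<times> real \<times> real \<Rightarrow> ('a \<times> real \<times> real) option" where
  "chart_h P = (\<lambda>(s, x, y). if 0 < x \<and> x < 1 then Some (if y = 1 then (above P s, x, 0) else (s, x, y)) else None)"

lemma chart_v_invariant: "edge_glue P p q \<Longrightarrow> chart_v P p = chart_v P q"
  and chart_h_invariant: "edge_glue P p q \<Longrightarrow> chart_h P p = chart_h P q"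
  by (auto elim!: edge_glue.cases simp: chart_v_def chart_h_def)

lemma surface_point_eqD:
  assumes "surface_point P p = surface_point P q"
  shows "torus_x p = torus_x q" "torus_y p = torus_y q" "chart_v P p = chart_v P q" "chart_h P p = chart_h P q"
proof -
  have p: "p \<in> surface_point P q" using assms surface_point_self by blast
  show "torus_x p = torus_x q" "torus_y p = torus_y q" "chart_v P p = chart_v P q" "chart_h P p = chart_h P q"
    using edge_invariant[OF torus_x_invariant p] edge_invariant[OF torus_y_invariant p]
      edge_invariant[OF chart_v_invariant p] edge_invariant[OF chart_h_invariant p] by auto
qed

lemma frac_eq_iff_Ints: "frac (a::real) = frac b \<longleftrightarrow> a - b \<in> \<int>"
proof
  assume "frac a = frac b"
  then have "a - b = of_int (\<lfloor>a\<rfloor> - \<lfloor>b\<rfloor>)" by (simp add: frac_def algebra_simps)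
  then show "a - b \<in> \<int>" by (metis Ints_of_int)
next
  assume "a - b \<in> \<int>"
  then obtain k where "a = b + of_int k" by (auto elim!: Ints_cases simp: algebra_simps)
  then show "frac a = frac b" by (simp add: frac_def)
qed

lemma frac_in_unit_interval: "0 \<le> x \<Longrightarrow> x \<le> 1 \<Longrightarrow> frac x \<noteq> 0 \<Longrightarrow> 0 < x \<and> x < 1 \<and> frac (x::real) = x"
  by (cases "x = 0"; cases "x = 1") (auto simp: frac_eq)

text \<open>Motion is to the right, so each vertical edge is left through \<open>right_of P\<close>;
  motion to the left is reduced to this by reflection. \<open>A\<close> extends
  \<open>above P\<close> to a bijection of the type, as its integer powers require.\<close>

locale right_geodesic =
  fixes P :: "'a polysquare" and \<alpha> :: real and L :: "real \<Rightarrow> ('a \<times> real \<times> real) set" and v :: "real \<times> real"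
    and A :: "'a \<Rightarrow> 'a"
  assumes finS: "finite (squares P)" and bijR: "bij_betw (right_of P) (squares P) (squares P)"
    and bijA: "bij A" and AS: "A ` squares P = squares P" and A_eq: "\<And>s. s \<in> squares P \<Longrightarrow> A s = above P s"
    and irrational: "\<alpha> \<notin> \<rat>"
    and v1: "0 < fst v" and v2: "snd v = \<alpha> * fst v"
    and forward: "\<And>t. 0 \<le> t \<Longrightarrow> \<exists>\<delta>>0. \<exists>s\<in>squares P. \<exists>p. \<forall>h\<in>{0..\<delta>}.
           p + h *\<^sub>R v \<in> unit_square \<and> L (t + h) = surface_point P (s, p + h *\<^sub>R v)"
    and backward: "\<And>t. 0 < t \<Longrightarrow> \<exists>\<delta>\<in>{0<..t}. \<exists>s\<in>squares P. \<exists>p. \<forall>h\<in>{0..\<delta>}.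
           p - h *\<^sub>R v \<in> unit_square \<and> L (t - h) = surface_point P (s, p - h *\<^sub>R v)"
begin

abbreviation "S \<equiv> squares P"

lemma L_point:
  assumes "0 \<le> t"
  obtains s x y where "s \<in> S" "x \<in> {0..1}" "y \<in> {0..1}" "L t = surface_point P (s, x, y)"
proof -
  from forward[OF assms] obtain \<delta> s p where *: "\<delta> > 0" "s \<in> S"
    "\<forall>h\<in>{0..\<delta>}. p + h *\<^sub>R v \<in> unit_square \<and> L (t + h) = surface_point P (s, p + h *\<^sub>R v)" by blast
  then have "p \<in> unit_square" "L t = surface_point P (s, p)" using *(3)[rule_format, of 0] by auto
  then show ?thesis using that[of s "fst p" "snd p"] *(2) by (cases p) (auto simp: unit_square_def)
qed

definition X0 :: real where "X0 = class_val torus_x (L 0)"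
definition Y0 :: real where "Y0 = class_val torus_y (L 0)"

text \<open>\<open>class_val f (L t) - t * w\<close> is locally constant modulo 1, because the
  segments just after and just before each time are straight; connectedness of the half-line does
  the rest.\<close>

lemma torus_orbit:
  assumes f: "(f = torus_x \<and> w = fst v) \<or> (f = torus_y \<and> w = snd v)" and t: "0 \<le> t"
  shows "class_val f (L t) = frac (class_val f (L 0) + t * w)"
proof -
  define \<pi> :: "real \<times> real \<Rightarrow> real" where "\<pi> = (if f = torus_x \<and> w = fst v then fst else snd)"
  have val: "class_val f (surface_point P (s, p + h *\<^sub>R v)) = frac (\<pi> p + h * w)" for s p h
  proof -
    have "class_val f (surface_point P (s, p + h *\<^sub>R v)) = f (s, p + h *\<^sub>R v)"
      using f class_val_surface_point[of P torus_x] class_val_surface_point[of P torus_y]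
        torus_x_invariant torus_y_invariant by metis
    then show ?thesis using f by (auto simp: \<pi>_def torus_x_def torus_y_def)
  qed
  define g where "g t = frac (class_val f (L t) - t * w)" for t
  have loc: "g (t + h) = frac (\<pi> p - t * w)" if "L (t + h) = surface_point P (s, p + h *\<^sub>R v)" for t h s p
  proof -
    have "g (t + h) = frac (frac (\<pi> p + h * w) + (- ((t + h) * w)))" by (simp add: g_def that val)
    also have "\<dots> = frac (\<pi> p - t * w)" unfolding frac_frac_add by (simp add: algebra_simps)
    finally show ?thesis .
  qed
  have "g t = g 0"
  proof (rule locally_constant_connected[where D = "{0..}" and f = g])
    fix t :: real assume "t \<in> {0..}"
    then have t: "0 \<le> t" by simp
    from forward[OF t] obtain \<delta> s p where F: "\<delta> > 0" 
      "\<And>h. 0 \<le> h \<Longrightarrow> h \<le> \<delta> \<Longrightarrow> L (t + h) = surface_point P (s, p + h *\<^sub>R v)" by fastforce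
    have fwd: "g (t + h) = g t" if "0 \<le> h" "h \<le> \<delta>" for h
      using loc[OF F(2)[OF that]] loc[OF F(2)[of 0]] F(1) by simp
    show "\<exists>\<delta>>0. \<forall>t'\<in>{0..}. \<bar>t' - t\<bar> < \<delta> \<longrightarrow> g t' = g t"
    proof (cases "t = 0")
      case True
      have "g t' = g t" if "t' \<in> {0..}" "\<bar>t' - t\<bar> < \<delta>" for t'
        using fwd[of "t' - t"] that True by simp
      then show ?thesis using F(1) by blast
    next
      case False
      then have "0 < t" using t by simp
      from backward[OF this] obtain \<delta>' s' p' where B: "\<delta>' > 0" "\<delta>' \<le> t"
        "\<And>h. 0 \<le> h \<Longrightarrow> h \<le> \<delta>' \<Longrightarrow> L (t - h) = surface_point P (s', p' - h *\<^sub>R v)" by fastforce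
      have B': "L (t + (- h)) = surface_point P (s', p' + (- h) *\<^sub>R v)" if "0 \<le> h" "h \<le> \<delta>'" for h
        using B(3)[OF that] by simp
      have bwd: "g (t - h) = g t" if "0 \<le> h" "h \<le> \<delta>'" for h
        using loc[OF B'[OF that]] loc[OF B'[of 0]] B(1) by simp
      have "g t' = g t" if "\<bar>t' - t\<bar> < min \<delta> \<delta>'" for t'
        using fwd[of "t' - t"] bwd[of "t - t'"] that by (cases "t \<le> t'") auto
      moreover have "0 < min \<delta> \<delta>'" using F(1) B(1) by simp
      ultimately show ?thesis by blast
    qed
  qed (use t in auto)
  moreover have r: "0 \<le> class_val f (L t)" "class_val f (L t) < 1" for t
    using f by (auto simp: class_val_def torus_x_def torus_y_def frac_lt_1)
  ultimately have "frac (class_val f (L t) + - (t * w)) = class_val f (L 0)"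
    by (simp add: g_def frac_eq)
  then have "frac (class_val f (L 0) + t * w) = frac (frac (class_val f (L t) + - (t * w)) + t * w)" by simp
  also have "\<dots> = class_val f (L t)" unfolding frac_frac_add using r by (simp add: frac_eq)
  finally show ?thesis by simp
qed

lemma torus_coordinates:
  assumes "0 \<le> t" "L t = surface_point P (s, x, y)"
  shows "frac x = frac (X0 + t * fst v)" "frac y = frac (Y0 + t * snd v)"
proof -
  have "class_val torus_x (L t) = frac x" "class_val torus_y (L t) = frac y"
    unfolding assms(2) using class_val_surface_point[of P torus_x "(s, x, y)", OF torus_x_invariant]
      class_val_surface_point[of P torus_y "(s, x, y)", OF torus_y_invariant] by (auto simp: torus_x_def torus_y_def)
  then show "frac x = frac (X0 + t * fst v)" "frac y = frac (Y0 + t * snd v)"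
    using torus_orbit[of torus_x "fst v" t] torus_orbit[of torus_y "snd v" t] assms(1)
    by (auto simp: X0_def Y0_def)
qed

text \<open>\<open>X0\<close> is at least 0 and less than 1. If it is 0, the starting point is
  itself on a vertical edge and counts as the crossing at time 0; hence the ceiling rather than the
  next larger integer.\<close>

definition crossing :: "nat \<Rightarrow> real" where
  "crossing i = (of_int \<lceil>X0\<rceil> + real i - X0) / fst v"

lemma crossing_nonneg: "0 \<le> crossing i"
proof -
  have "0 \<le> of_int \<lceil>X0\<rceil> + real i - X0" using le_of_int_ceiling[of X0] by linarith
  then show ?thesis using v1 unfolding crossing_def by simp
qed

lemma crossing_Suc: "crossing (Suc i) = crossing i + 1 / fst v"
  by (simp add: crossing_def add_divide_distrib diff_divide_distrib)

lemma crossing_less_iff: "crossing i < crossing j \<longleftrightarrow> i < j"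
  using v1 by (simp add: crossing_def divide_less_cancel)

lemma crossing_X: "X0 + crossing i * fst v = of_int (\<lceil>X0\<rceil> + int i)"
  using v1 by (simp add: crossing_def)

lemma in_crossing_times_iff: "0 \<le> t \<Longrightarrow> t \<in> crossing_times P L \<longleftrightarrow> X0 + t * fst v \<in> \<int>"
proof
  assume t: "0 \<le> t"
  show "X0 + t * fst v \<in> \<int>" if "t \<in> crossing_times P L"
  proof -
    have "\<exists>s y. L t = surface_point P (s, 0, y)"
      using that unfolding crossing_times_def vertical_edge_def edge_part_def by blast
    then obtain s y where "L t = surface_point P (s, 0, y)" by blast
    from torus_coordinates(1)[OF t this] show ?thesis by (simp add: frac_eq_0_iff eq_commute[of 0])
  qed
  show "t \<in> crossing_times P L" if int: "X0 + t * fst v \<in> \<int>"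
  proof -
    obtain s x y where p: "s \<in> S" "x \<in> {0..1}" "y \<in> {0..1}" "L t = surface_point P (s, x, y)"
      using L_point[OF t] .
    have "frac x = 0" using torus_coordinates(1)[OF t p(4)] int by (simp add: frac_eq_0_iff)
    then have "x = 0 \<or> x = 1" using p(2) frac_in_unit_interval[of x] by (metis atLeastAtMost_iff frac_eq less_eq_real_def)
    then have "\<exists>s'\<in>S. L t = surface_point P (s', 0, y)"
    proof
      assume "x = 1"
      then have "L t = surface_point P (right_of P s, 0, y)"
        using p surface_point_eqI[OF edge_glue.vertical, of s P y] by simp
      moreover have "right_of P s \<in> S" using p(1) bijR by (auto simp: bij_betw_def)
      ultimately show ?thesis by blast
    qed (use p in blast)
    then obtain s' where "s' \<in> S" "L t = surface_point P (s', 0, y)" by blast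
    moreover have "L t \<in> (\<lambda>y. surface_point P (s', 0, y)) ` {0..1}"
      using calculation(2) p(3) by (rule image_eqI)
    ultimately show ?thesis using t unfolding crossing_times_def vertical_edge_def edge_part_def by blast
  qed
qed

lemma crossing_times_eq: "crossing_times P L = range crossing"
proof (intro equalityI subsetI)
  fix t assume t: "t \<in> crossing_times P L"
  then have t0: "0 \<le> t" by (simp add: crossing_times_def)
  then obtain k where k: "X0 + t * fst v = of_int k" using t in_crossing_times_iff by (auto elim: Ints_cases)
  have "X0 \<le> of_int k" using k t0 v1 by (metis add_increasing2 less_imp_le mult_nonneg_nonneg order_refl)
  then have "\<lceil>X0\<rceil> \<le> k" by (simp add: ceiling_le_iff)
  then have "t = crossing (nat (k - \<lceil>X0\<rceil>))" using k v1 by (simp add: crossing_def field_simps)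
  then show "t \<in> range crossing" by blast
next
  fix t assume "t \<in> range crossing"
  then show "t \<in> crossing_times P L"
    using in_crossing_times_iff[OF crossing_nonneg] crossing_X by (metis (no_types, lifting) Ints_of_int rangeE)
qed

definition height :: "nat \<Rightarrow> real" where
  "height i = frac (Y0 + crossing 0 * snd v + real i * \<alpha>)"

lemma height_eq: "height i = frac (Y0 + crossing i * snd v)"
proof -
  have "crossing i * snd v = crossing 0 * snd v + real i * \<alpha>"
    using v1 by (simp add: crossing_def v2 field_simps)
  then show ?thesis by (simp add: height_def add.assoc)
qed

lemma height_range: "0 \<le> height i" "height i < 1"
  by (auto simp: height_def frac_lt_1)

text \<open>By irrationality all crossing points are distinct, and at most one of them is a vertex,
  namely one at height 0.\<close>

lemma height_inj: "height i = height j \<Longrightarrow> i = j"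
proof (rule ccontr)
  assume eq: "height i = height j" and "i \<noteq> j"
  then have "(real i - real j) * \<alpha> \<in> \<int>"
    unfolding height_def frac_eq_iff_Ints by (simp add: algebra_simps)
  then have "(real i - real j) * \<alpha> / (real i - real j) \<in> \<rat>"
    using Ints_subset_Rats by (intro Rats_divide Rats_diff) auto
  then show False using irrational \<open>i \<noteq> j\<close> by simp
qed

lemma height_add: "height (i + j) = frac (height i + real j * \<alpha>)"
  by (simp add: height_def frac_frac_add algebra_simps)

lemma crossing_point_ex: "\<exists>s\<in>S. \<exists>y\<in>{0..1}. L (crossing i) = surface_point P (s, 0, y) \<and> frac y = height i"
proof -
  have "crossing i \<in> crossing_times P L" by (simp add: crossing_times_eq)
  then obtain s y where "s \<in> S" "y \<in> {0..1}" "L (crossing i) = surface_point P (s, 0, y)"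
    by (auto simp: crossing_times_def vertical_edge_def edge_part_def)
  then show ?thesis using torus_coordinates(2)[OF crossing_nonneg] height_eq by metis
qed

text \<open>At a vertex several left edges may contain the point, with \<open>y\<close> equal to 0
  or 1, and the choice is arbitrary. At all other heights the square is determined, by
  \<open>crossing_in_edge_part_iff\<close>.\<close>

definition square_at :: "nat \<Rightarrow> 'a" where
  "square_at i = (SOME s. s \<in> S \<and> (\<exists>y\<in>{0..1}. L (crossing i) = surface_point P (s, 0, y) \<and> frac y = height i))"

lemma square_at: "square_at i \<in> S" "\<exists>y\<in>{0..1}. L (crossing i) = surface_point P (square_at i, 0, y) \<and> frac y = height i"
  using someI_ex[of "\<lambda>s. s \<in> S \<and> (\<exists>y\<in>{0..1}. L (crossing i) = surface_point P (s, 0, y) \<and> frac y = height i)"]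
    crossing_point_ex[of i] unfolding square_at_def[symmetric] by blast+

lemma crossing_point:
  assumes "height i \<noteq> 0"
  shows "L (crossing i) = surface_point P (square_at i, 0, height i)" "0 < height i"
proof -
  obtain y where y: "y \<in> {0..1}" "L (crossing i) = surface_point P (square_at i, 0, y)" "frac y = height i"
    using square_at(2) by blast
  then have "y = height i" using frac_in_unit_interval[of y] assms by simp
  then show "L (crossing i) = surface_point P (square_at i, 0, height i)" using y by simp
  show "0 < height i" using assms height_range[of i] by simp
qed

lemma crossing_in_edge_part_iff:
  assumes "height i \<noteq> 0" "J \<subseteq> {0..1}"
  shows "L (crossing i) \<in> edge_part P s J \<longleftrightarrow> square_at i = s \<and> height i \<in> J"
proof
  assume "L (crossing i) \<in> edge_part P s J"
  then obtain y where "y \<in> J" "surface_point P (square_at i, 0, height i) = surface_point P (s, 0, y)"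
    using crossing_point[OF assms(1)] by (auto simp: edge_part_def)
  moreover from surface_point_eqD(3)[OF this(2)] have "square_at i = s \<and> height i = y"
    using crossing_point(2)[OF assms(1)] height_range[of i] by (auto simp: chart_v_def split: if_splits)
  ultimately show "square_at i = s \<and> height i \<in> J" by blast
qed (use crossing_point[OF assms(1)] in \<open>auto simp: edge_part_def\<close>)

text \<open>Strictly between two vertical crossings the path is off the vertical grid lines, hence
  off the vertices, and it passes through horizontal gluings only. Their net number can be read off
  from the height, so comparing the square just after the first crossing with the one just before
  the second gives the power of \<open>A\<close>.\<close>

lemma square_at_Suc:
  assumes h0: "height i \<noteq> 0" and h1: "height (Suc i) \<noteq> 0"
  shows "square_at (Suc i) = right_of P (zpow A \<lfloor>height i + \<alpha>\<rfloor> (square_at i))"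
proof -
  define t where "t = crossing i"
  define y where "y = height i"
  define H where "H = 1 / fst v"
  have H: "0 < H" "H * fst v = 1" "H * snd v = \<alpha>" using v1 by (auto simp: H_def v2)
  have t0: "0 \<le> t" by (simp add: t_def crossing_nonneg)
  have Lt: "L t = surface_point P (square_at i, 0, y)" and y: "0 < y" "y < 1"
    using crossing_point[OF h0] height_range[of i] by (auto simp: t_def y_def)
  have tS: "crossing (Suc i) = t + H" by (simp add: crossing_Suc t_def H_def)
  have coord: "frac x' = h * fst v" "frac y' = frac (y + h * snd v)"
    if "0 < h" "h < H" "L (t + h) = surface_point P (s, x', y')" for h s x' y'
  proof -
    have "0 \<le> t + h" using that t0 by simp
    note tc = torus_coordinates[OF this that(3)]
    have "X0 + (t + h) * fst v = of_int (\<lceil>X0\<rceil> + int i) + h * fst v"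
      using crossing_X[of i] by (simp add: t_def algebra_simps)
    then have "frac x' = frac (of_int (\<lceil>X0\<rceil> + int i) + h * fst v)" using tc(1) by simp
    also have "\<dots> = frac (h * fst v)" by (simp add: frac_eq_iff_Ints del: of_int_add)
    also have "\<dots> = h * fst v"
    proof -
      have "h * fst v < H * fst v" using that v1 by (intro mult_strict_right_mono)
      then show ?thesis using that v1 H by (simp add: frac_eq)
    qed
    finally show "frac x' = h * fst v" .
    have "frac (y + h * snd v) = frac (Y0 + t * snd v + h * snd v)"
      by (simp add: y_def height_eq t_def frac_frac_add)
    then show "frac y' = frac (y + h * snd v)" using tc(2) by (simp add: algebra_simps)
  qed
  text \<open>\<open>\<kappa> h\<close> is the current square with the horizontal crossings since time \<open>t\<close> undone, hence locally
    constant between two vertical crossings.\<close>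
  define \<kappa> where "\<kappa> h = zpow A (- \<lfloor>y + h * snd v\<rfloor>) (fst (the (class_val (chart_h P) (L (t + h)))))" for h
  have \<kappa>: "\<kappa> h = zpow A (- m) s"
    if h: "0 < h" "h < H" and Lh: "L (t + h) = surface_point P (s, x', y')"
      and s: "s \<in> S" and x': "x' \<in> {0..1}" and y': "y' \<in> {0..1}" "y' = y + h * snd v - of_int m" for h s x' y' m
  proof -
    have "0 < h * fst v" using h v1 by simp
    then have "frac x' \<noteq> 0" using coord(1)[OF h Lh] by linarith
    then have x'01: "0 < x'" "x' < 1"
      using x' frac_in_unit_interval[of x'] by auto
    have cv: "class_val (chart_h P) (L (t + h)) = Some (if y' = 1 then (above P s, x', 0) else (s, x', y'))"
      unfolding Lh using class_val_surface_point[of P "chart_h P" "(s, x', y')", OF chart_h_invariant] x'01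
      by (simp add: chart_h_def)
    \<comment> \<open>On a top edge \<open>chart_h\<close> has already passed to the square above,
      and the floor has already increased by one; the two effects cancel.\<close>
    show ?thesis
    proof (cases "y' = 1")
      case True
      then have "\<lfloor>y + h * snd v\<rfloor> = m + 1" using y' by (intro floor_unique) auto
      then have "\<kappa> h = zpow A (- (m + 1)) (A s)" using cv True s by (simp add: \<kappa>_def A_eq)
      also have "\<dots> = zpow A (- m) s" using zpow_add[OF bijA, of "- (m + 1)" 1 s] by simp
      finally show ?thesis .
    next
      case False
      then have "\<lfloor>y + h * snd v\<rfloor> = m" using y' by (intro floor_unique) auto
      then show ?thesis using cv False by (simp add: \<kappa>_def)
    qed
  qed
  have const: "\<kappa> a = \<kappa> b" if "0 < a" "a < H" "0 < b" "b < H" for a b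
  proof (rule locally_constant_connected[where D = "{0<..<H}" and f = \<kappa>])
    fix h assume "h \<in> {0<..<H}"
    then have h: "0 < h" "h < H" by auto
    have th: "0 < t + h" using t0 h by simp
    from forward[of "t + h"] th obtain \<delta> s p where F: "\<delta> > 0" "s \<in> S" 
      "\<And>k. 0 \<le> k \<Longrightarrow> k \<le> \<delta> \<Longrightarrow> p + k *\<^sub>R v \<in> unit_square \<and> L (t + h + k) = surface_point P (s, p + k *\<^sub>R v)"
      by fastforce
    from backward[OF th] obtain \<delta>' s' p' where B: "\<delta>' > 0" "s' \<in> S"
      "\<And>k. 0 \<le> k \<Longrightarrow> k \<le> \<delta>' \<Longrightarrow> p' - k *\<^sub>R v \<in> unit_square \<and> L (t + h - k) = surface_point P (s', p' - k *\<^sub>R v)"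
      by fastforce
    have *: "\<exists>m. \<forall>k. \<bar>k\<bar> \<le> \<epsilon> \<and> 0 < h + k \<and> h + k < H \<and> p + k *\<^sub>R v \<in> unit_square \<and> L (t + h + k) = surface_point P (s, p + k *\<^sub>R v) \<longrightarrow>
        \<kappa> (h + k) = zpow A (- m) s"
      if "s \<in> S" "L (t + h) = surface_point P (s, p)" for s p and \<epsilon> :: real
    proof -
      have "L (t + h) = surface_point P (s, fst p, snd p)" using that by simp
      from coord(2)[OF h this] have "y + h * snd v - snd p \<in> \<int>" by (simp add: frac_eq_iff_Ints[symmetric])
      then obtain m where m: "y + h * snd v - snd p = of_int m" by (elim Ints_cases)
      have "\<kappa> (h + k) = zpow A (- m) s"
        if k: "0 < h + k" "h + k < H" "p + k *\<^sub>R v \<in> unit_square" "L (t + h + k) = surface_point P (s, p + k *\<^sub>R v)" for k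
      proof (rule \<kappa>[OF k(1,2) _ \<open>s \<in> S\<close>, of "fst (p + k *\<^sub>R v)" "snd (p + k *\<^sub>R v)"])
        show "L (t + (h + k)) = surface_point P (s, fst (p + k *\<^sub>R v), snd (p + k *\<^sub>R v))"
          using k(4) unfolding add.assoc prod.collapse .
        show "fst (p + k *\<^sub>R v) \<in> {0..1}" "snd (p + k *\<^sub>R v) \<in> {0..1}"
          using k(3) by (auto simp: unit_square_def mem_Times_iff)
        show "snd (p + k *\<^sub>R v) = y + (h + k) * snd v - of_int m" using m by (simp add: algebra_simps)
      qed
      then show ?thesis by blast
    qed
    have F0: "p \<in> unit_square" "L (t + h) = surface_point P (s, p)" using F(3)[of 0] F(1) by auto
    have B0: "p' \<in> unit_square" "L (t + h) = surface_point P (s', p')" using B(3)[of 0] B(1) by auto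
    obtain m where m: "\<And>k. \<bar>k\<bar> \<le> 1 \<Longrightarrow> 0 < h + k \<Longrightarrow> h + k < H \<Longrightarrow> p + k *\<^sub>R v \<in> unit_square \<Longrightarrow>
        L (t + h + k) = surface_point P (s, p + k *\<^sub>R v) \<Longrightarrow> \<kappa> (h + k) = zpow A (- m) s"
      using *[OF F(2) F0(2), of 1] by blast
    obtain m' where m': "\<And>k. \<bar>k\<bar> \<le> 1 \<Longrightarrow> 0 < h + k \<Longrightarrow> h + k < H \<Longrightarrow> p' + k *\<^sub>R v \<in> unit_square \<Longrightarrow>
        L (t + h + k) = surface_point P (s', p' + k *\<^sub>R v) \<Longrightarrow> \<kappa> (h + k) = zpow A (- m') s'"
      using *[OF B(2) B0(2), of 1] by blast
    have k0: "\<kappa> h = zpow A (- m) s" "\<kappa> h = zpow A (- m') s'"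
      using m[of 0] m'[of 0] F0 B0 h by auto
    have "\<kappa> h' = \<kappa> h" if h': "h' \<in> {0<..<H}" "\<bar>h' - h\<bar> < min 1 (min \<delta> \<delta>')" for h'
    proof (cases "h \<le> h'")
      case True
      then show ?thesis using m[of "h' - h"] F(3)[of "h' - h"] h' k0 by auto
    next
      case False
      then show ?thesis using m'[of "h' - h"] B(3)[of "h - h'"] h' k0 
        by (auto simp: scaleR_left_diff_distrib algebra_simps)
    qed
    moreover have "0 < min 1 (min \<delta> \<delta>')" using F(1) B(1) by simp
    ultimately show "\<exists>\<delta>>0. \<forall>h'\<in>{0<..<H}. \<bar>h' - h\<bar> < \<delta> \<longrightarrow> \<kappa> h' = \<kappa> h" by blast
  qed (use that in auto)
  have small: "\<exists>k>0. k < H \<and> k \<le> \<delta>" if "0 < \<delta>" for \<delta>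
    using that H by (intro exI[of _ "min \<delta> (H / 2)"]) auto
  obtain a where a: "0 < a" "a < H" "\<kappa> a = square_at i"
  proof -
    from forward[OF t0] obtain \<delta> s p where F: "\<delta> > 0" "s \<in> S"
      "\<And>k. 0 \<le> k \<Longrightarrow> k \<le> \<delta> \<Longrightarrow> p + k *\<^sub>R v \<in> unit_square \<and> L (t + k) = surface_point P (s, p + k *\<^sub>R v)"
      by fastforce
    obtain k where k: "0 < k" "k < H" "k \<le> \<delta>" using small[OF F(1)] by blast
    have p: "fst p + k * fst v \<le> 1" "0 \<le> fst p"
      using F(3)[of k] F(3)[of 0] k F(1) by (auto simp: unit_square_def mem_Times_iff)
    have "0 < k * fst v" using k v1 by simp
    \<comment> \<open>A path moving right cannot start on the right edge of the square it stays in;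
      \<open>chart_v\<close> then identifies this square as \<open>square_at i\<close>.\<close>
    then have p1: "fst p \<noteq> 1" using p by linarith
    have "surface_point P (s, fst p, snd p) = surface_point P (square_at i, 0, y)" using F(3)[of 0] F(1) Lt by simp
    from surface_point_eqD(3)[OF this] have "s = square_at i" "fst p = 0" "snd p = y"
      using y p1 by (auto simp: chart_v_def case_prod_beta split: if_splits)
    note sp = this
    have "\<kappa> k = zpow A (- 0) (square_at i)"
    proof (rule \<kappa>[OF k(1,2), of _ "fst (p + k *\<^sub>R v)" "snd (p + k *\<^sub>R v)"])
      show "L (t + k) = surface_point P (square_at i, fst (p + k *\<^sub>R v), snd (p + k *\<^sub>R v))"
        using F(3)[of k] k unfolding sp(1) prod.collapse by simp
      show "fst (p + k *\<^sub>R v) \<in> {0..1}" "snd (p + k *\<^sub>R v) \<in> {0..1}"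
        using F(3)[of k] k by (auto simp: unit_square_def mem_Times_iff)
      show "square_at i \<in> S" using F(2) sp(1) by simp
      show "snd (p + k *\<^sub>R v) = y + k * snd v - of_int 0" using sp(3) by simp
    qed
    then show ?thesis using that k by simp
  qed
  have tH: "0 < t + H" using t0 H by simp
  from backward[OF tH] obtain \<delta> s p where B: "\<delta> > 0" "s \<in> S"
    "\<And>k. 0 \<le> k \<Longrightarrow> k \<le> \<delta> \<Longrightarrow> p - k *\<^sub>R v \<in> unit_square \<and> L (t + H - k) = surface_point P (s, p - k *\<^sub>R v)"
    by fastforce
  obtain k where k: "0 < k" "k < H" "k \<le> \<delta>" using small[OF B(1)] by blast
  have LH: "L (t + H) = surface_point P (s, fst p, snd p)" and pu: "p \<in> unit_square" using B(3)[of 0] B(1) by auto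
  have y1: "height (Suc i) = frac (y + \<alpha>)" using height_add[of i 1] by (simp add: y_def)
  have f: "frac (fst p) = 0" "frac (snd p) = height (Suc i)"
    using torus_coordinates[OF _ LH] tH crossing_X[of "Suc i"] height_eq[of "Suc i"] unfolding tS
    by (auto simp del: of_int_add)
  \<comment> \<open>Seen backward from the next crossing, the representative must lie on a right
    edge. This is where the final application of \<open>right_of P\<close> comes from.\<close>
  have "0 \<le> fst p - k * fst v" using B(3)[of k] k by (auto simp: unit_square_def mem_Times_iff)
  moreover have "0 < k * fst v" using k v1 by simp
  ultimately have p0: "0 < fst p" by linarith
  have pr: "fst p \<le> 1" "0 \<le> snd p" "snd p \<le> 1" using pu by (auto simp: unit_square_def mem_Times_iff)
  have "fst p = 1"
  proof (rule ccontr)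
    assume "fst p \<noteq> 1"
    then have "frac (fst p) = fst p" using p0 pr by (simp add: frac_eq)
    then show False using f(1) p0 by simp
  qed
  moreover have "snd p = height (Suc i)"
    using frac_in_unit_interval[OF pr(2,3)] f(2) h1 by simp
  ultimately have p: "fst p = 1" "snd p = height (Suc i)" .
  have "\<kappa> (H - k) = zpow A (- \<lfloor>y + \<alpha>\<rfloor>) s"
  proof (rule \<kappa>[OF _ _ _ B(2), of _ "fst (p - k *\<^sub>R v)" "snd (p - k *\<^sub>R v)"])
    show "L (t + (H - k)) = surface_point P (s, fst (p - k *\<^sub>R v), snd (p - k *\<^sub>R v))"
      using B(3)[of k] k unfolding prod.collapse by (simp add: add_diff_eq)
    show "fst (p - k *\<^sub>R v) \<in> {0..1}" "snd (p - k *\<^sub>R v) \<in> {0..1}"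
      using B(3)[of k] k by (auto simp: unit_square_def mem_Times_iff)
    show "snd (p - k *\<^sub>R v) = y + (H - k) * snd v - of_int \<lfloor>y + \<alpha>\<rfloor>"
      using p y1 H(3) by (simp add: frac_def algebra_simps)
  qed (use k in auto)
  moreover have "\<kappa> (H - k) = square_at i" using const[of "H - k" a] a k by simp
  ultimately have s: "s = zpow A \<lfloor>y + \<alpha>\<rfloor> (square_at i)" using zpow_uminus(2)[OF bijA] by metis
  have "surface_point P (square_at (Suc i), 0, height (Suc i)) = surface_point P (s, 1, height (Suc i))"
    using crossing_point(1)[OF h1] LH p by (simp add: tS)
  from surface_point_eqD(3)[OF this] have "square_at (Suc i) = right_of P s"
    using crossing_point(2)[OF h1] height_range[of "Suc i"] by (auto simp: chart_v_def)
  then show ?thesis using s by (simp add: y_def)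
qed

text \<open>Visiting numbers count points, not times; since distinct crossings have distinct
  heights, counting indices gives the same.\<close>

lemma visiting_number_eq:
  "visiting_number P L n (edge_part P s J) = card {i. i < n \<and> L (crossing i) \<in> edge_part P s J}"
proof -
  have below: "{t' \<in> crossing_times P L. t' < crossing i} = crossing ` {..<i}" for i
    by (auto simp: crossing_times_eq crossing_less_iff)
  have injc: "inj crossing" by (rule injI) (metis crossing_less_iff less_irrefl nat_neq_iff)
  have "first_crossings P L n = L ` crossing ` {..<n}"
  proof -
    have "{t \<in> crossing_times P L. finite {t' \<in> crossing_times P L. t' < t} \<and> card {t' \<in> crossing_times P L. t' < t} < n} = crossing ` {..<n}"
    proof (intro equalityI subsetI)
      fix t assume t: "t \<in> {t \<in> crossing_times P L. finite {t' \<in> crossing_times P L. t' < t} \<and> card {t' \<in> crossing_times P L. t' < t} < n}"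
      then obtain i where i: "t = crossing i" by (auto simp: crossing_times_eq)
      have "card (crossing ` {..<i}) = i" using injc by (simp add: card_image inj_on_subset)
      then show "t \<in> crossing ` {..<n}" using t unfolding i by (simp add: below)
    next
      fix t assume "t \<in> crossing ` {..<n}"
      then obtain i where i: "t = crossing i" "i < n" by blast
      have "card (crossing ` {..<i}) = i" using injc by (simp add: card_image inj_on_subset)
      then show "t \<in> {t \<in> crossing_times P L. finite {t' \<in> crossing_times P L. t' < t} \<and> card {t' \<in> crossing_times P L. t' < t} < n}"
        using i by (simp add: below) (simp add: crossing_times_eq)
    qed
    then show ?thesis by (simp add: first_crossings_def)
  qed
  then have "edge_part P s J \<inter> first_crossings P L n = (\<lambda>i. L (crossing i)) ` {i. i < n \<and> L (crossing i) \<in> edge_part P s J}"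
    by auto
  moreover have "inj (\<lambda>i. L (crossing i))"
  proof (rule injI)
    fix i j assume eq: "L (crossing i) = L (crossing j)"
    obtain s y where "L (crossing i) = surface_point P (s, 0, y)" using crossing_point_ex by blast
    then show "i = j"
      using torus_coordinates(2)[OF crossing_nonneg, of i] torus_coordinates(2)[OF crossing_nonneg, of j] eq
      by (intro height_inj) (simp add: height_eq)
  qed
  ultimately show ?thesis unfolding visiting_number_def by (simp add: card_image inj_on_subset)
qed

end

section \<open>From the gluing maps and connectedness to the skew product\<close>

lemma bij_extend:
  assumes "bij_betw f S S"
  shows "bij (\<lambda>s. if s \<in> S then f s else s)" "(\<lambda>s. if s \<in> S then f s else s) ` S = S"
proof -
  let ?g = "\<lambda>s. if s \<in> S then f s else s"
  have *: "bij_betw ?g S S" using assms by (simp cong: bij_betw_cong)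
  moreover have "bij_betw ?g (- S) (- S)" by (auto simp: bij_betw_def inj_on_def)
  ultimately have "bij_betw ?g (S \<union> - S) (S \<union> - S)" by (rule bij_betw_combine) auto
  then show "bij ?g" by simp
  show "?g ` S = S" using * by (simp add: bij_betw_def)
qed

text \<open>On a finite set forward invariance under a permutation is invariance in both directions,
  so the gluings respect membership in \<open>F\<close>. The squares in \<open>F\<close> and the
  remaining ones then yield two disjoint open sets covering the surface.\<close>

lemma invariant_squares:
  assumes P: "polysquare_surface P" and F: "F \<subseteq> squares P" "F \<noteq> {}"
    and inv: "above P ` F \<subseteq> F" "right_of P ` F \<subseteq> F"
  shows "F = squares P"
proof (rule ccontr)
  assume ne: "F \<noteq> squares P"
  have fin: "finite (squares P)" and bij: "bij_betw (right_of P) (squares P) (squares P)" "bij_betw (above P) (squares P) (squares P)"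
    and conn: "connected_space (surface_topology P)" using P by (auto simp: polysquare_surface_def)
  have finF: "finite F" using fin F(1) finite_subset by blast
  have preserve: "s \<in> F \<longleftrightarrow> f s \<in> F" if f: "bij_betw f (squares P) (squares P)" "f ` F \<subseteq> F" "s \<in> squares P" for f s
  proof
    have inj: "inj_on f (squares P)" using f(1) by (simp add: bij_betw_def)
    have "f ` F = F" using f(2) finF card_image[OF inj_on_subset[OF inj F(1)]] by (intro card_subset_eq) auto
    moreover assume "f s \<in> F"
    ultimately obtain s' where "s' \<in> F" "f s = f s'" by (metis imageE)
    then show "s \<in> F" using inj f(3) F(1) by (metis inj_onD subsetD)
  qed (use f in auto)
  have glue: "(fst p \<in> F) = (fst q \<in> F)" if "edge_glue P p q" for p q
    using that
  proof cases
    case (vertical s y) then show ?thesis using preserve[OF bij(1) inv(2), of s] by simp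
  next
    case (horizontal s x) then show ?thesis using preserve[OF bij(2) inv(1), of s] by simp
  qed
  have same: "(fst q \<in> F) = (fst p \<in> F)" if "surface_point P p = surface_point P q" for p q
  proof -
    have "q \<in> surface_point P p" using that surface_point_self by metis
    then show ?thesis using edge_invariant[of P "\<lambda>p. fst p \<in> F" q p] glue by blast
  qed
  define U where "U = (\<lambda>F. surface_point P ` (F \<times> unit_square))"
  have pre: "{p \<in> unit_square. surface_point P (s, p) \<in> U G} = (if s \<in> G then unit_square else {})"
    if "s \<in> squares P" "G = F \<or> G = squares P - F" for s G
    using that same[of "(s, _)"] by (auto simp: U_def)
  have op: "openin (surface_topology P) (U G)" if "G = F \<or> G = squares P - F" for G
    unfolding openin_surface_topology
  proof (intro conjI ballI)
    show "U G \<subseteq> surface P" using that F(1) by (auto simp: U_def surface_def)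
    fix s assume "s \<in> squares P"
    from pre[OF this that] show "openin (top_of_set unit_square) {p \<in> unit_square. surface_point P (s, p) \<in> U G}"
      by simp
  qed
  have u: "(0, 0) \<in> unit_square" by (simp add: unit_square_def)
  show False
  proof (rule connected_spaceD[OF conn op[of F] op[of "squares P - F"]])
    have "topspace (surface_topology P) \<subseteq> surface P"
      using openin_topspace[of "surface_topology P"] unfolding openin_surface_topology by blast
    also have "\<dots> \<subseteq> U F \<union> U (squares P - F)" unfolding U_def surface_def by blast
    finally show "topspace (surface_topology P) \<subseteq> U F \<union> U (squares P - F)" .
    show "U F \<inter> U (squares P - F) = {}"
    proof (rule ccontr)
      assume "\<not> ?thesis"
      then obtain p q where "surface_point P p = surface_point P q" "p \<in> F \<times> unit_square"
        "q \<in> (squares P - F) \<times> unit_square"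
        unfolding U_def by blast
      then have "surface_point P p = surface_point P q" "fst p \<in> F" "fst q \<notin> F" by auto
      then show False using same by blast
    qed
    show "U F \<noteq> {}" "U (squares P - F) \<noteq> {}" using F ne u by (auto simp: U_def)
  qed auto
qed

subsection \<open>Visiting numbers of geodesics moving to the right\<close>

context right_geodesic
begin

text \<open>As \<open>\<alpha>\<close> is irrational, at most one crossing is a vertex; it splits the crossings into two orbits of
  \<open>T\<close>, whatever the geodesic does at the vertex.\<close>

lemma visiting_number_bound:
  assumes skew: "skew_rotation S (right_of P) A \<alpha> c"
    and C0: "0 \<le> C" and C: "\<And>s (J :: real set) m x. s \<in> S \<Longrightarrow> is_interval J \<Longrightarrow> J \<subseteq> {0..1} \<Longrightarrow> 0 < measure lborel J \<Longrightarrow>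
      x \<in> skew_rotation.phase S \<Longrightarrow>
      \<bar>real (skew_rotation.visits (right_of P) A \<alpha> s J m x) - real m * measure lborel J / real (card S)\<bar> \<le> d * measure lborel J * real m + C"
    and s: "s \<in> S" and J: "is_interval J" "J \<subseteq> {0..1}" "0 < measure lborel J"
  shows "\<bar>real (visiting_number P L n (edge_part P s J)) - real n * measure lborel J / real (card S)\<bar>
    \<le> d * measure lborel J * real n + (2 * C + 2)"
proof -
  interpret skew_rotation S "right_of P" A \<alpha> c by (rule skew)
  define l where "l = measure lborel J"
  define b where "b = real (card S)"
  have b: "1 \<le> b" using card_pos by (simp add: b_def)
  have l: "0 < l" "l \<le> 1" using J unit_interval_measure_le_1[of J] by (auto simp: l_def)
  define x where "x i = (square_at i, height i)" for i
  have xph: "x i \<in> phase" for i using square_at(1) height_range by (auto simp: x_def phase_def)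
  define hits where "hits I = {i \<in> I. L (crossing i) \<in> edge_part P s J}" for I
  have block: "card (hits {a..<a + m}) = visits s J m (x a)"
    if nz: "\<And>i. a \<le> i \<Longrightarrow> i < a + m \<Longrightarrow> height i \<noteq> 0" for a m
  proof -
    have orb: "x (a + j) = (T ^^ j) (x a)" if "j < m" for j
      using that
    proof (induction j)
      case (Suc j)
      have "x (a + Suc j) = T (x (a + j))"
        using square_at_Suc[of "a + j"] nz[of "a + j"] nz[of "a + Suc j"] height_add[of "a + j" 1] Suc.prems
        by (simp add: x_def T_def)
      then show ?case using Suc by simp
    qed simp
    have "hits {a..<a + m} = (+) a ` {j. j < m \<and> fst ((T ^^ j) (x a)) = s \<and> snd ((T ^^ j) (x a)) \<in> J}"
    proof (intro equalityI subsetI)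
      fix i assume i: "i \<in> hits {a..<a + m}"
      then have "i = a + (i - a)" "i - a < m" by (auto simp: hits_def)
      moreover have "square_at i = s" "height i \<in> J"
        using i nz crossing_in_edge_part_iff[OF _ J(2)] by (auto simp: hits_def)
      moreover have "(T ^^ (i - a)) (x a) = (square_at i, height i)"
        using orb[of "i - a"] calculation(1,2) by (simp add: x_def)
      ultimately show "i \<in> (+) a ` {j. j < m \<and> fst ((T ^^ j) (x a)) = s \<and> snd ((T ^^ j) (x a)) \<in> J}"
        by (intro image_eqI[of _ _ "i - a"]) simp_all
    next
      fix i assume "i \<in> (+) a ` {j. j < m \<and> fst ((T ^^ j) (x a)) = s \<and> snd ((T ^^ j) (x a)) \<in> J}"
      then obtain j where j: "i = a + j" "j < m" "fst (x (a + j)) = s" "snd (x (a + j)) \<in> J"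
        by (auto simp: orb)
      then show "i \<in> hits {a..<a + m}"
        using nz crossing_in_edge_part_iff[OF _ J(2)] by (auto simp: hits_def x_def)
    qed
    then show ?thesis by (simp add: visits_def card_image)
  qed
  have bound: "\<bar>real (card (hits {a..<a + m})) - real m * l / b\<bar> \<le> d * l * real m + C"
    if "\<And>i. a \<le> i \<Longrightarrow> i < a + m \<Longrightarrow> height i \<noteq> 0" for a m
  proof -
    have "card (hits {a..<a + m}) = visits s J m (x a)" by (rule block) (rule that)
    then show ?thesis using C[OF s J xph, of m a] by (simp add: l_def b_def)
  qed
  have vn: "visiting_number P L n (edge_part P s J) = card (hits {0..<n})"
    unfolding visiting_number_eq hits_def by (simp add: atLeast0LessThan)
  have "\<bar>real (card (hits {0..<n})) - real n * l / b\<bar> \<le> d * l * real n + (2 * C + 2)"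
  proof (cases "\<exists>i<n. height i = 0")
    case False
    then show ?thesis using bound[of 0 n] C0 by auto
  next
    case True
    then obtain i where i: "i < n" "height i = 0" by blast
    \<comment> \<open>The orbit is cut at the vertex: the two pieces give \<open>2 * C\<close>, and
      the crossing there changes the count and the mean by at most 1 each.\<close>
    define m where "m = n - Suc i"
    have n: "n = Suc i + m" using i by (simp add: m_def)
    have nz: "height j \<noteq> 0" if "j \<noteq> i" for j using height_inj[of j i] i that by auto
    have "{0..<n} = {0..<0 + i} \<union> {i} \<union> {Suc i..<Suc i + m}" using n by auto
    then have "hits {0..<n} = (hits {0..<0 + i} \<union> hits {i}) \<union> hits {Suc i..<Suc i + m}" by (auto simp: hits_def)
    moreover have "card (hits {0..<0 + i} \<union> hits {i} \<union> hits {Suc i..<Suc i + m}) =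
        card (hits {0..<0 + i}) + card (hits {i}) + card (hits {Suc i..<Suc i + m})"
      by (subst card_Un_disjoint; (subst card_Un_disjoint)?) (auto simp: hits_def)
    moreover have "card (hits {i}) \<le> card {i}" by (intro card_mono) (auto simp: hits_def)
    ultimately have card: "real (card (hits {0..<0 + i})) + real (card (hits {Suc i..<Suc i + m})) \<le> real (card (hits {0..<n}))"
      "real (card (hits {0..<n})) \<le> real (card (hits {0..<0 + i})) + real (card (hits {Suc i..<Suc i + m})) + 1" by auto
    have b1: "\<bar>real (card (hits {0..<0 + i})) - real i * l / b\<bar> \<le> d * l * real i + C"
      by (intro bound nz) auto
    have b2: "\<bar>real (card (hits {Suc i..<Suc i + m})) - real m * l / b\<bar> \<le> d * l * real m + C"
      by (intro bound nz) auto
    \<comment> \<open>The two pieces together have one crossing fewer than \<open>n\<close>, so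
      enlarging their error to that of \<open>n\<close> takes a nonnegative slope. A negative one
      would contradict the assumed bound for long orbits.\<close>
    have d0: "0 \<le> d * l"
    proof (rule ccontr)
      assume "\<not> 0 \<le> d * l"
      then obtain k :: nat where "C < real k * (- (d * l))" using reals_Archimedean3[of "- (d * l)"] by auto
      moreover have "0 \<le> d * l * real k + C" using C[OF s J xph, of k 0] unfolding l_def by linarith
      ultimately show False by (simp add: mult.commute)
    qed
    have "0 \<le> l / b" "l / b \<le> 1" using l b by auto
    then show ?thesis
      using card b1 b2 d0 unfolding n by (simp add: algebra_simps add_divide_distrib abs_le_iff)
  qed
  then show ?thesis by (simp add: vn l_def b_def)
qed

end

subsection \<open>Reflection in a vertical axis\<close>

text \<open>Reflection exchanges left and right edges, so the map to the right neighbour is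
  inverted, and a geodesic of slope \<alpha> moving left becomes one of slope
  \<open>- \<alpha>\<close> moving right.\<close>

definition reflected :: "'a polysquare \<Rightarrow> 'a polysquare" where
  "reflected P = \<lparr>squares = squares P, right_of = inv_into (squares P) (right_of P), above = above P\<rparr>"

definition reflect :: "'a \<times> real \<times> real \<Rightarrow> 'a \<times> real \<times> real" where
  "reflect = (\<lambda>(s, x, y). (s, 1 - x, y))"

lemma reflect_reflect [simp]: "reflect (reflect p) = p"
  by (cases p) (simp add: reflect_def)

lemma inj_reflect: "inj reflect"
  by (metis injI reflect_reflect)

text \<open>A vertical gluing is reversed by the reflection, so \<open>edge_glue\<close> is
  preserved only up to direction; the generated equivalence does not see this.\<close>

lemma surface_point_reflected:
  assumes bij: "bij_betw (right_of P) (squares P) (squares P)"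
  shows "surface_point (reflected P) (reflect p) = reflect ` surface_point P p"
proof -
  have inj: "inj_on (right_of P) (squares P)" "right_of P ` squares P = squares P" using bij by (auto simp: bij_betw_def)
  have glue_to: "edge_glue (reflected P) (reflect p) (reflect q) \<or> edge_glue (reflected P) (reflect q) (reflect p)"
    if "edge_glue P p q" for p q
    using that
  proof cases
    case (vertical s y)
    have "edge_glue (reflected P) (right_of P s, 1, y) (right_of (reflected P) (right_of P s), 0, y)"
      using vertical inj by (intro edge_glue.vertical) (auto simp: reflected_def)
    then show ?thesis using vertical inj by (simp add: reflect_def reflected_def)
  next
    case (horizontal s x)
    have "edge_glue (reflected P) (s, 1 - x, 1) (above (reflected P) s, 1 - x, 0)"
      using horizontal by (intro edge_glue.horizontal) (auto simp: reflected_def)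
    then show ?thesis using horizontal by (simp add: reflect_def reflected_def)
  qed
  have glue_back: "edge_glue P (reflect p) (reflect q) \<or> edge_glue P (reflect q) (reflect p)"
    if "edge_glue (reflected P) p q" for p q
    using that
  proof cases
    case (vertical s y)
    let ?s = "inv_into (squares P) (right_of P) s"
    have "?s \<in> squares P" "right_of P ?s = s"
      using vertical inj by (auto simp: reflected_def inv_into_into f_inv_into_f)
    then have "edge_glue P (?s, 1, y) (s, 0, y)" using edge_glue.vertical[of ?s P y] vertical by simp
    then show ?thesis using vertical by (simp add: reflect_def reflected_def)
  next
    case (horizontal s x)
    have "edge_glue P (s, 1 - x, 1) (above P s, 1 - x, 0)"
      using horizontal by (intro edge_glue.horizontal) (auto simp: reflected_def)
    then show ?thesis using horizontal by (simp add: reflect_def reflected_def)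
  qed
  have A: "equivclp (edge_glue P) p q \<Longrightarrow> equivclp (edge_glue (reflected P)) (reflect p) (reflect q)" for q
  proof (induction rule: equivclp_induct)
    case (step y z) then show ?case using glue_to by (meson equivclp_into_equivclp)
  qed simp
  have B: "equivclp (edge_glue (reflected P)) (reflect p) q \<Longrightarrow> equivclp (edge_glue P) p (reflect q)" for q
  proof (induction rule: equivclp_induct)
    case (step y z) then show ?case using glue_back by (meson equivclp_into_equivclp)
  qed simp
  show ?thesis
  proof (intro equalityI subsetI)
    fix q assume "q \<in> surface_point (reflected P) (reflect p)"
    then have "reflect q \<in> surface_point P p" using B by (simp add: surface_point_def)
    then show "q \<in> reflect ` surface_point P p" by (metis image_eqI reflect_reflect)
  next
    fix q assume "q \<in> reflect ` surface_point P p"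
    then show "q \<in> surface_point (reflected P) (reflect p)" using A by (auto simp: surface_point_def)
  qed
qed

text \<open>The left edge of \<open>s\<close> is reflected to the right edge of \<open>s\<close>,
  which on the reflected surface is the left edge of the new right neighbour.\<close>

lemma edge_part_reflected:
  assumes bij: "bij_betw (right_of P) (squares P) (squares P)" and s: "s \<in> squares P" and J: "J \<subseteq> {0..1}"
  shows "edge_part (reflected P) (right_of (reflected P) s) J = (`) reflect ` edge_part P s J"
proof -
  have "surface_point (reflected P) (right_of (reflected P) s, 0, y) = reflect ` surface_point P (s, 0, y)" if "y \<in> J" for y
  proof -
    have "edge_glue (reflected P) (s, 1, y) (right_of (reflected P) s, 0, y)"
      using s that J by (intro edge_glue.vertical) (auto simp: reflected_def)
    then have "surface_point (reflected P) (right_of (reflected P) s, 0, y) = surface_point (reflected P) (reflect (s, 0, y))"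
      by (simp add: surface_point_eqI[symmetric] reflect_def)
    then show ?thesis by (simp add: surface_point_reflected[OF bij])
  qed
  then show ?thesis by (auto simp: edge_part_def image_image)
qed

lemma bij_betw_right_of_reflected:
  assumes "bij_betw (right_of P) (squares P) (squares P)"
  shows "bij_betw (right_of (reflected P)) (squares P) (squares P)"
  using bij_betw_inv_into[OF assms] by (simp add: reflected_def)

lemma visiting_number_reflected:
  assumes bij: "bij_betw (right_of P) (squares P) (squares P)" and s: "s \<in> squares P" and J: "J \<subseteq> {0..1}"
  shows "visiting_number (reflected P) (\<lambda>t. reflect ` L t) n (edge_part (reflected P) (right_of (reflected P) s) J)
    = visiting_number P L n (edge_part P s J)"
proof -
  have inj: "inj ((`) reflect)" using inj_reflect by (metis injI inj_image_eq_iff)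
  have "squares (reflected P) = squares P" by (simp add: reflected_def)
  also have "\<dots> = right_of (reflected P) ` squares P"
    using bij_betw_right_of_reflected[OF bij] by (simp add: bij_betw_def)
  finally have sq: "squares (reflected P) = right_of (reflected P) ` squares P" .
  have "(\<Union>s\<in>squares (reflected P). vertical_edge (reflected P) s)
      = (\<Union>s\<in>squares P. vertical_edge (reflected P) (right_of (reflected P) s))"
    unfolding sq by (simp only: image_image)
  also have "\<dots> = (`) reflect ` (\<Union>s\<in>squares P. vertical_edge P s)"
    unfolding image_UN vertical_edge_def by (intro SUP_cong refl edge_part_reflected[OF bij]) auto
  finally have un: "(\<Union>s\<in>squares (reflected P). vertical_edge (reflected P) s) = (`) reflect ` (\<Union>s\<in>squares P. vertical_edge P s)" .
  have ct: "crossing_times (reflected P) (\<lambda>t. reflect ` L t) = crossing_times P L"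
    unfolding crossing_times_def un inj_image_mem_iff[OF inj] ..
  have fc: "first_crossings (reflected P) (\<lambda>t. reflect ` L t) n = (`) reflect ` first_crossings P L n"
    unfolding first_crossings_def ct image_image ..
  show ?thesis
    unfolding visiting_number_def fc edge_part_reflected[OF bij s J]
    by (simp add: image_Int[OF inj, symmetric] card_image inj_on_subset[OF inj])
qed

theorem theorem1:
  fixes P :: "'a polysquare" and \<alpha> :: real
  assumes "polysquare_surface P" and "badly_approximable \<alpha>"
  shows "\<forall>\<epsilon>>0. \<exists>C>1. \<forall>L. half_infinite_geodesic P \<alpha> L \<longrightarrow>
    (\<forall>n::nat. real n > C \<longrightarrow>
      (\<forall>s\<in>squares P. \<forall>J. is_interval J \<and> J \<subseteq> {0..1} \<and> measure lborel J \<ge> C / real n \<longrightarrow>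
        \<bar>real (visiting_number P L n (edge_part P s J))
            - real n * measure lborel J / real (card (squares P))\<bar>
          < \<epsilon> * (real n * measure lborel J / real (card (squares P)))))"
proof (intro allI impI)
  fix \<epsilon> :: real assume \<epsilon>: "0 < \<epsilon>"
  define Sq where "Sq = squares P"
  define P' where "P' = reflected P"
  define A where "A = (\<lambda>s. if s \<in> Sq then above P s else s)"
  have fin: "finite Sq" "Sq \<noteq> {}" and br: "bij_betw (right_of P) Sq Sq" and bijU: "bij_betw (above P) Sq Sq"
    using assms(1) by (auto simp: polysquare_surface_def Sq_def)
  have br': "bij_betw (right_of P') Sq Sq"
    using bij_betw_right_of_reflected[of P] br by (simp add: Sq_def P'_def)
  have SqP': "squares P' = Sq" "above P' = above P" by (simp_all add: P'_def reflected_def Sq_def)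
  have A: "bij A" "A ` Sq = Sq" using bij_extend[OF bijU] by (simp_all add: A_def)
  have irr: "\<alpha> \<notin> \<rat>" using assms(2) by (simp add: badly_approximable_def)
  obtain c where c: "0 < c" "\<And>p q :: int. 0 < q \<Longrightarrow> c / of_int q \<le> \<bar>of_int q * \<alpha> - of_int p\<bar>"
    using badly_approximable_lower_bound[OF assms(2)] by blast
  have c': "c / of_int q \<le> \<bar>of_int q * (- \<alpha>) - of_int p\<bar>" if "0 < q" for p q :: int
    using c(2)[OF that, of "- p"] by simp
  have irred: "F = Sq" if F: "F \<subseteq> Sq" "F \<noteq> {}" "A ` F \<subseteq> F" "right_of P ` F \<subseteq> F" for F
  proof -
    have "above P ` F \<subseteq> F" using F(1,3) by (auto simp: A_def)
    then show ?thesis using invariant_squares[OF assms(1)] F by (simp add: Sq_def)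
  qed
  \<comment> \<open>For finite sets, invariance under the inverse of \<open>right_of P\<close>
    amounts to invariance under \<open>right_of P\<close> itself.\<close>
  have irred': "F = Sq" if F: "F \<subseteq> Sq" "F \<noteq> {}" "A ` F \<subseteq> F" "right_of P' ` F \<subseteq> F" for F
  proof (rule irred[OF F(1-3)])
    have "finite F" using fin F(1) finite_subset by blast
    then have e: "right_of P' ` F = F"
      using F(1,4) br' by (intro card_subset_eq) (auto simp: bij_betw_def card_image inj_on_subset)
    have "right_of P (right_of P' s) = s" if "s \<in> Sq" for s
      using that br by (auto simp: P'_def reflected_def Sq_def bij_betw_def f_inv_into_f)
    then have "right_of P ` right_of P' ` F = F" using F(1) by (force simp: image_image)
    then show "right_of P ` F \<subseteq> F" by (simp add: e)
  qed
  have sk: "skew_rotation Sq (right_of P) A \<alpha> c"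
    by unfold_locales (fact fin br A irred c)+
  have sk': "skew_rotation Sq (right_of P') A (- \<alpha>) c"
    by unfold_locales (fact fin br' A irred' c(1) c')+
  define b where "b = real (card Sq)"
  have b: "0 < b" using fin by (simp add: b_def card_gt_0_iff)
  \<comment> \<open>The tolerated error is \<open>2 * d * l * n\<close>. Half of it is the
    proportional part, and \<open>C\<close> is chosen so that \<open>l * n >= C\<close> makes
    \<open>D\<close> smaller than the other half.\<close>
  define d where "d = \<epsilon> / (2 * b)"
  have d: "0 < d" using \<epsilon> b by (simp add: d_def)
  obtain C1 where C1: "0 \<le> C1" "\<And>s (J :: real set) m x. s \<in> Sq \<Longrightarrow> is_interval J \<Longrightarrow> J \<subseteq> {0..1} \<Longrightarrow> 0 < measure lborel J \<Longrightarrow>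
      x \<in> skew_rotation.phase Sq \<Longrightarrow>
      \<bar>real (skew_rotation.visits (right_of P) A \<alpha> s J m x) - real m * measure lborel J / real (card Sq)\<bar> \<le> d * measure lborel J * real m + C1"
    using skew_rotation.visits_uniform[OF sk d] by blast
  obtain C2 where C2: "0 \<le> C2" "\<And>s (J :: real set) m x. s \<in> Sq \<Longrightarrow> is_interval J \<Longrightarrow> J \<subseteq> {0..1} \<Longrightarrow> 0 < measure lborel J \<Longrightarrow>
      x \<in> skew_rotation.phase Sq \<Longrightarrow>
      \<bar>real (skew_rotation.visits (right_of P') A (- \<alpha>) s J m x) - real m * measure lborel J / real (card Sq)\<bar> \<le> d * measure lborel J * real m + C2"
    using skew_rotation.visits_uniform[OF sk' d] by blast
  \<comment> \<open>Covers both directions of motion, so the threshold does not depend on the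
    geodesic.\<close>
  define D where "D = 2 * max C1 C2 + 2"
  define C where "C = max 2 ((D + 1) / d)"
  have bound: "\<bar>real (visiting_number P L n (edge_part P s J)) - real n * measure lborel J / b\<bar> \<le> d * measure lborel J * real n + D"
    if L: "half_infinite_geodesic P \<alpha> L" and s: "s \<in> Sq" and J: "is_interval J" "J \<subseteq> {0..1}" "0 < measure lborel J" for L n s J
  proof -
    obtain v where v: "norm v = 1" "snd v = \<alpha> * fst v"
      and fwd: "\<And>t. 0 \<le> t \<Longrightarrow> \<exists>\<delta>>0. \<exists>s\<in>squares P. \<exists>p. \<forall>h\<in>{0..\<delta>}.
           p + h *\<^sub>R v \<in> unit_square \<and> L (t + h) = surface_point P (s, p + h *\<^sub>R v)"
      and bwd: "\<And>t. 0 < t \<Longrightarrow> \<exists>\<delta>\<in>{0<..t}. \<exists>s\<in>squares P. \<exists>p. \<forall>h\<in>{0..\<delta>}.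
           p - h *\<^sub>R v \<in> unit_square \<and> L (t - h) = surface_point P (s, p - h *\<^sub>R v)"
      using L unfolding half_infinite_geodesic_def by blast
    have "fst v \<noteq> 0" using v by (metis mult_zero_right norm_zero prod.collapse zero_neq_one zero_prod_def)
    then consider "0 < fst v" | "fst v < 0" by linarith
    then show ?thesis
    proof cases
      case 1
      interpret right_geodesic P \<alpha> L v A
        by unfold_locales (use fin br A irr 1 v fwd bwd in \<open>auto simp: Sq_def A_def\<close>)
      show ?thesis
        using visiting_number_bound[of c C1 d s J n] sk C1 s J by (simp add: Sq_def b_def D_def)
    next
      case 2
      define v' where "v' = (- fst v, snd v)"
      define r where "r p = (1 - fst p, snd p)" for p :: "real \<times> real"
      have r: "r p \<in> unit_square \<longleftrightarrow> p \<in> unit_square" "reflect (s, p) = (s, r p)" for p and s :: 'a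
        by (auto simp: r_def unit_square_def mem_Times_iff reflect_def case_prod_beta)
      have rv: "r (p + h *\<^sub>R v) = r p + h *\<^sub>R v'" "r (p - h *\<^sub>R v) = r p - h *\<^sub>R v'" for p h
        by (auto simp: r_def v'_def prod_eq_iff)
      have sp: "reflect ` surface_point P (s, p) = surface_point P' (s, r p)" for s p
        using surface_point_reflected[of P "(s, p)"] br by (simp add: r P'_def Sq_def)
      interpret right_geodesic P' "- \<alpha>" "\<lambda>t. reflect ` L t" v' A
      proof unfold_locales
        show "0 < fst v'" "snd v' = - \<alpha> * fst v'" using 2 v by (auto simp: v'_def)
        fix t :: real
        {
          assume "0 \<le> t"
          from fwd[OF this] obtain \<delta> s p where "\<delta> > 0" "s \<in> Sq"
            "\<And>h. h \<in> {0..\<delta>} \<Longrightarrow> p + h *\<^sub>R v \<in> unit_square \<and> L (t + h) = surface_point P (s, p + h *\<^sub>R v)"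
            unfolding Sq_def by blast
          then show "\<exists>\<delta>>0. \<exists>s\<in>squares P'. \<exists>p. \<forall>h\<in>{0..\<delta>}.
            p + h *\<^sub>R v' \<in> unit_square \<and> reflect ` L (t + h) = surface_point P' (s, p + h *\<^sub>R v')"
            by (intro exI[of _ \<delta>] conjI bexI[of _ s] exI[of _ "r p"] ballI) (auto simp: sp r SqP' simp flip: rv)
        }
        assume "0 < t"
        from bwd[OF this] obtain \<delta> s p where "\<delta> \<in> {0<..t}" "s \<in> Sq"
          "\<And>h. h \<in> {0..\<delta>} \<Longrightarrow> p - h *\<^sub>R v \<in> unit_square \<and> L (t - h) = surface_point P (s, p - h *\<^sub>R v)"
          unfolding Sq_def by blast
        then show "\<exists>\<delta>\<in>{0<..t}. \<exists>s\<in>squares P'. \<exists>p. \<forall>h\<in>{0..\<delta>}.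
          p - h *\<^sub>R v' \<in> unit_square \<and> reflect ` L (t - h) = surface_point P' (s, p - h *\<^sub>R v')"
          by (intro bexI[of _ \<delta>] bexI[of _ s] exI[of _ "r p"] ballI) (auto simp: sp r SqP' simp flip: rv)
      qed (use fin br' A irr in \<open>auto simp: SqP' A_def\<close>)
      have "right_of P' s \<in> Sq" using br' s by (auto simp: bij_betw_def)
      then have "\<bar>real (visiting_number P' (\<lambda>t. reflect ` L t) n (edge_part P' (right_of P' s) J)) - real n * measure lborel J / real (card Sq)\<bar>
          \<le> d * measure lborel J * real n + (2 * C2 + 2)"
        using visiting_number_bound[of c C2 d "right_of P' s" J n] sk' C2 J by (simp add: SqP')
      moreover have "visiting_number P' (\<lambda>t. reflect ` L t) n (edge_part P' (right_of P' s) J) = visiting_number P L n (edge_part P s J)"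
        unfolding P'_def using visiting_number_reflected[of P s J L n] br s J by (simp add: Sq_def)
      ultimately show ?thesis by (simp add: b_def D_def)
    qed
  qed
  show "\<exists>C>1. \<forall>L. half_infinite_geodesic P \<alpha> L \<longrightarrow>
    (\<forall>n::nat. real n > C \<longrightarrow>
      (\<forall>s\<in>squares P. \<forall>J. is_interval J \<and> J \<subseteq> {0..1} \<and> measure lborel J \<ge> C / real n \<longrightarrow>
        \<bar>real (visiting_number P L n (edge_part P s J))
            - real n * measure lborel J / real (card (squares P))\<bar>
          < \<epsilon> * (real n * measure lborel J / real (card (squares P)))))"
  proof (intro exI[of _ C] conjI allI impI ballI)
    show "1 < C" by (simp add: C_def)
    fix L and n :: nat and s :: 'a and J :: "real set"
    assume L: "half_infinite_geodesic P \<alpha> L" and n: "C < real n" and s: "s \<in> squares P"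
      and J: "is_interval J \<and> J \<subseteq> {0..1} \<and> C / real n \<le> measure lborel J"
    define l where "l = measure lborel J"
    have Cpos: "1 < C" "(D + 1) / d \<le> C" by (auto simp: C_def)
    have n0: "0 < real n" using n Cpos by linarith
    have "0 < C / real n" using Cpos n0 by simp
    then have "0 < l" using J unfolding l_def by linarith
    moreover have "C \<le> l * real n" using J n0 by (simp add: l_def pos_divide_le_eq)
    ultimately have l: "0 < l" "C \<le> l * real n" .
    have "D + 1 \<le> d * (l * real n)"
      using Cpos(2) l(2) d by (simp add: pos_divide_le_eq mult.commute) (metis mult.commute mult_left_mono order_trans less_imp_le)
    then have "d * l * real n + D < 2 * d * (l * real n)" by (simp add: algebra_simps)
    also have "2 * d * (l * real n) = \<epsilon> * (real n * l / b)" using b by (simp add: d_def)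
    finally show "\<bar>real (visiting_number P L n (edge_part P s J))
            - real n * measure lborel J / real (card (squares P))\<bar>
          < \<epsilon> * (real n * measure lborel J / real (card (squares P)))"
      using bound[OF L, of s J n] s J l by (simp add: l_def b_def Sq_def)
  qed
qed

end
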